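(* Consider the iterates $(x^k,y^k,\lambda^k)$ of AS-ADMM (defined in the context). Suppose: (L1) $f$ and $g$ are strongly convex with modulus $\alpha>0$, and both $f$ and $g$ have Lipschitz continuous gradients with Lipschitz constant $\nu$. (L2) $\mathcal{X}=\mathbb{R}^{n_1}$ and $\mathcal{Y}=\mathbb{R}^{n_2}$. (L3) The stepsize satisfies $s\in(0,(1+\sqrt5)/2)$, and for some $c_1,c_2>0$ and for all $k$, $c_1I\preceq\mathcal{D}_{k+1}\preceq\mathcal{D}_k:=\mathcal{M}_k-\beta A^{\sf T}A\preceq c_2I$. Moreover, $\mathbb{E}\big[\|\delta_t\|_{\mathcal{H}^{-1}}^2\big]\le\sigma^2$ for some $\sigma>0$ independent of $t$ and the iteration number $k$. (L4) For some $\theta>0$, $M_k=\lceil(1+\theta)^2M_{k-1}(\|\breve x^k\|^2+1)\rceil$ (for $k\ge1$, with $M_0$ a positive integer) and $\eta_k=(1+\theta)^{-k}/M_k$. Then there exist $c>0$ and $0<\tau<1$ such that for all $k\ge0$ $$\mathbb{E}\big[\|x^k-x^*\|^2+\|y^k-y^*\|^2+\|\lambda^k-\bar\lambda^k\|^2\big]\le c\,\tau^k,$$ where $(x^*,y^* )$ is the solution of $\min\{f(x)+g(y):x\in\mathcal{X},\ y\in\mathcal{Y},\ Ax+By=b\}$, $\Lambda^*$ is the set of all multipliers associated with $(x^*,y^* )$, i.e. $\Lambda^*=\{\lambda\in\mathbb{R}^n:A^{\sf T}\lambda=\nabla f(x^* ),\ B^{\sf T}\lambda=\nabla g(y^* )\}$,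 and $\bar\lambda^k$ is the projection of $\lambda^k$ onto $\Lambda^*$.
   Context: Problem: $\min\{f(x)+g(y): x\in\mathcal{X},\ y\in\mathcal{Y},\ Ax+By=b\}$, where $\mathcal{X}\subset\mathbb{R}^{n_1}$, $\mathcal{Y}\subset\mathbb{R}^{n_2}$ are closed convex sets, $g:\mathcal{Y}\to\mathbb{R}\cup\{+\infty\}$ is convex, $A\in\mathbb{R}^{n\times n_1}$, $B\in\mathbb{R}^{n\times n_2}$, $b\in\mathbb{R}^n$, and $f=\frac1N\sum_{j=1}^N f_j$ with each $f_j$ real-valued, convex, defined on an open set containing $\mathcal{X}$, and Lipschitz continuously differentiable on $\mathcal{X}$. For symmetric $G$, $\|x\|_G^2:=x^{\sf T}Gx$; $\|\cdot\|$ is the Euclidean norm; $\succeq$, $\succ$ denote the semidefinite/definite orders; $\mathbb{E}$ denotes expectation. Algorithm AS-ADMM. Parameters $\beta>0$, $s\in(0,(1+\sqrt5)/2]$, $\mathcal{H}\succ0$. Start from $(x^0,y^0,\lambda^0)\in\mathcal{X}\times\mathcal{Y}\times\mathbb{R}^n$, $\breve x^0=x^0$. For $k=0,1,\dots$: choose an integer $M_k>0$, $\eta_k>0$ and a symmetric matrix $\mathcal{M}_k$ with $\mathcal{D}_k:=\mathcal{M}_k-\beta A^{\sf T}A\succeq0$; put $h^k=-A^{\sf T}[\lambda^k-\beta(Ax^k+By^k-b)]$. Inner loop: $x_1=x^k$, $\breve x_1=\breve x^k$; for $t=1,\dots,M_k$: randomly select $\xi_t\in\{1,\dots,N\}$ with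 uniform probability; $\beta_t=2/(t+1)$, $\gamma_t=2/(t\eta_k)$, $\hat x_t=\beta_t\breve x_t+(1-\beta_t)x_t$; $d_t=\nabla f_{\xi_t}(\hat x_t)+e_t$ where $e_t$ is a random vector satisfying $\mathbb{E}[e_t]=0$; $\breve x_{t+1}=\arg\min_{x\in\mathcal{X}}\{\langle d_t+h^k,x\rangle+\frac{\gamma_t}2\|x-\breve x_t\|_{\mathcal{H}}^2+\frac12\|x-x^k\|_{\mathcal{M}_k}^2\}$; $x_{t+1}=\beta_t\breve x_{t+1}+(1-\beta_t)x_t$. Then $x^{k+1}=x_{M_k+1}$, $\breve x^{k+1}=\breve x_{M_k+1}$, $y^{k+1}\in\arg\min_{y\in\mathcal{Y}}\{g(y)+\frac\beta2\|Ax^{k+1}+By-b-\lambda^k/\beta\|^2\}$, $\lambda^{k+1}=\lambda^k-s\beta(Ax^{k+1}+By^{k+1}-b)$. In outer iteration $k$, $\delta_t:=\nabla f(\hat x_t)-d_t$. Standing assumptions: the primal-dual solution set of the problem is nonempty, i.e. there is $(x^*,y^*,\lambda^* )\in\mathcal{X}\times\mathcal{Y}\times\mathbb{R}^n$ that is a saddle point of $f(x)+g(y)+\lambda^{\sf T}(b-Ax-By)$ (minimized over $(x,y)\in\mathcal{X}\times\mathcal{Y}$, maximized over $\lambda\in\mathbb{R}^n$); for every $z\in\mathbb{R}^{n_2}$ the problem $\min_{y\in\mathcal{Y}}\{g(y)+\frac\beta2 y^{\sf T}B^{\sf T}By+z^{\sf T}y\}$ has a minimizer; and for some $\nu>0$,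 $\|\nabla f_j(x_1)-\nabla f_j(x_2)\|_{\mathcal{H}^{-1}}\le\nu\|x_1-x_2\|_{\mathcal{H}}$ for all $x_1,x_2\in\mathcal{X}$ and all $j$.
   Formalization: The condition E[e_t]=0 is taken as mean zero conditionally on the past of the algorithm; with only the unconditional mean the claim fails (e.g. one random sign used as the error at every step). The choices of M_k, η_k and the matrices are nonanticipating. *)

theory Defs
  imports "HOL-Probability.Probability"
begin

definition qform :: "real^'n^'n \<Rightarrow> real^'n \<Rightarrow> real" where
  "qform G x = x \<bullet> (G *v x)"

definition pos_semidef :: "real^'n^'n \<Rightarrow> bool" where
  "pos_semidef G \<longleftrightarrow> transpose G = G \<and> (\<forall>x. 0 \<le> qform G x)"

definition pos_def :: "real^'n^'n \<Rightarrow> bool" where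
  "pos_def G \<longleftrightarrow> transpose G = G \<and> (\<forall>x. x \<noteq> 0 \<longrightarrow> 0 < qform G x)"

definition loewner_le :: "real^'n^'n \<Rightarrow> real^'n^'n \<Rightarrow> bool"  (infix \<open>\<preceq>\<^sub>L\<close> 50) where
  "G \<preceq>\<^sub>L K \<longleftrightarrow> pos_semidef (K - G)"

text \<open>Meaningful only at points of differentiability.\<close>

definition grad :: "('a::real_inner \<Rightarrow> real) \<Rightarrow> 'a \<Rightarrow> 'a" where
  "grad f x = (THE D. GDERIV f x :> D)"

definition strongly_convex_on :: "'a::real_inner set \<Rightarrow> real \<Rightarrow> ('a \<Rightarrow> real) \<Rightarrow> bool" where
  "strongly_convex_on S \<alpha> f \<longleftrightarrow> convex S \<and>
     (\<forall>x\<in>S. \<forall>y\<in>S. \<forall>u\<ge>0. \<forall>v\<ge>0. u + v = 1 \<longrightarrow>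
        f (u *\<^sub>R x + v *\<^sub>R y) \<le> u * f x + v * f y - \<alpha> / 2 * u * v * (norm (x - y))\<^sup>2)"

definition saddle_point ::
  "'a set \<Rightarrow> 'b set \<Rightarrow> 'c set \<Rightarrow> ('a \<Rightarrow> 'b \<Rightarrow> 'c \<Rightarrow> real) \<Rightarrow> 'a \<Rightarrow> 'b \<Rightarrow> 'c \<Rightarrow> bool" where
  "saddle_point X Y Z L x y z \<longleftrightarrow> x \<in> X \<and> y \<in> Y \<and> z \<in> Z \<and>
     (\<forall>x'\<in>X. \<forall>y'\<in>Y. L x y z \<le> L x' y' z) \<and> (\<forall>z'\<in>Z. L x y z' \<le> L x y z)"

text \<open>
  \<open>F k t\<close> is the information available just before inner step \<open>t \<ge> 1\<close> of outer iteration \<open>k\<close>;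
  in particular \<open>F k 1\<close> is the information available when outer iteration \<open>k\<close> starts.  The inner
  loop lengths are random, so the samples \<open>\<xi> k t\<close> and errors \<open>e k t\<close> are given for every
  \<open>t \<ge> 1\<close>, and a run uses only as many of them as it needs.  A sample is uniform and drawn
  independently of the past.  The errors are centred given the past (a martingale difference
  condition); an error may depend on the sample of the same step, as in variance reduction.
\<close>

definition stochastic_oracle ::
  "'w measure \<Rightarrow> (nat \<Rightarrow> nat \<Rightarrow> 'w measure) \<Rightarrow> nat \<Rightarrow> (nat \<Rightarrow> nat \<Rightarrow> 'w \<Rightarrow> nat) \<Rightarrow>
   (nat \<Rightarrow> nat \<Rightarrow> 'w \<Rightarrow> real^'n) \<Rightarrow> bool" where
  "stochastic_oracle P F N \<xi> e \<longleftrightarrow>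
     prob_space P \<and>
     (\<forall>k. \<forall>t\<ge>1. subalgebra P (F k t) \<and> subalgebra (F k (t + 1)) (F k t) \<and>
        subalgebra (F (k + 1) 1) (F k t)) \<and>
     (\<forall>k. \<forall>t\<ge>1.
        \<xi> k t \<in> F k (t + 1) \<rightarrow>\<^sub>M count_space {1..N} \<and>
        (\<forall>j\<in>{1..N}. measure P {\<omega> \<in> space P. \<xi> k t \<omega> = j} = 1 / real N) \<and>
        prob_space.indep_set P (sets (F k t)) {\<xi> k t -` J \<inter> space P | J. J \<subseteq> {1..N}}) \<and>
     (\<forall>k. \<forall>t\<ge>1.
        e k t \<in> borel_measurable (F k (t + 1)) \<and> integrable P (e k t) \<and>
        (\<forall>i. AE \<omega> in P. real_cond_exp P (F k t) (\<lambda>\<omega>'. e k t \<omega>' $ i) \<omega> = 0))"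

end

theory Submission
  imports Defs
begin

text \<open>
The iterate \<open>x\<^sup>k\<^sup>+\<^sup>1\<close> is compared with the exact proximal point \<open>u\<close>, which solves
\<open>\<nabla>f(u) + M\<^sub>k (u - x\<^sup>k) + h\<^sup>k = 0\<close>.  For exact \<open>x\<close>-steps, the Lyapunov function
\<open>|x - x*|\<^sub>D\<^sup>2 + \<alpha> |y - y*|\<^sup>2 + \<beta> |B(y - y*)|\<^sup>2 + dist(\<lambda>, \<Lambda>*)\<^sup>2 / (s \<beta>) + \<omega> \<beta> |Ax + By - b|\<^sup>2\<close>
contracts by a fixed factor: the stationarity of two consecutive \<open>y\<close>-iterates bounds the cross term as long
as \<open>(1 - s)\<^sup>2 < 2 - s\<close>, strong convexity controls the primal errors, and the distance to \<open>\<Lambda>*\<close> is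
bounded by the residuals of the linear system that defines \<open>\<Lambda>*\<close>.  An inexact step adds a multiple of
\<open>|x\<^sup>k\<^sup>+\<^sup>1 - u|\<^sup>2\<close>, so it is enough that \<open>E |x\<^sup>k\<^sup>+\<^sup>1 - u|\<^sup>2 \<le> C \<rho>\<^sup>k (1 + E Lyapunov)\<close>
with \<open>\<rho> = 1 / (1 + \<theta>)\<close>.

The length \<open>M\<^sub>k\<close> is random and unbounded and the variance bound is unconditional, so the usual estimate,
with noise weight \<open>t\<^sup>2 / M\<^sub>k\<^sup>3\<close> in step \<open>t\<close>, is not summable.  Instead the part of the inner iterates
that is linear in the noise is split off.  What remains is an accelerated gradient method with a deterministic
gradient error, and the weighted average of the linear part is so small that the total noise
contribution is of order \<open>M\<^sub>k\<^sup>-\<^sup>2 \<Sum>\<^sub>t |\<delta>\<^sub>t|\<^sup>2\<close>.  Since \<open>M\<^sub>k\<^sup>-\<^sup>2 \<le> \<rho>\<^sup>k t\<^sup>-\<^sup>3\<^sup>/\<^sup>2\<close> for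
\<open>t \<le> M\<^sub>k\<close>, its expectation is of order \<open>\<rho>\<^sup>k\<close>.  The growth rule for \<open>M\<^sub>k\<close> cancels the initial gap
of the inner loop in the same way.
\<close>

section \<open>Gradients and strong convexity\<close>

text \<open>An unconditional second moment does not control the share of a single event M = m, so a
  noise weight must be maximized over all lengths m \<ge> t. For t^2 / m^3 the maximum is 1 / t, a
  divergent series; for m^-2 it is t^-2, which is summable with half a power to spare. The spare
  power buys the rate: with the deterministic lower bound m0 = (1 + \<theta>)^(2 k) of
  \<open>M k\<close>, the factor m0^(-1/2) equals \<rho>^k.

  The exact proximal point depends on the random outer state. It is chosen separately for each
  outcome and eliminated again by bounding its distance to \<open>xs\<close> by the Lyapunov
  function, so it never appears under an integral.

  The start \<open>y0\<close> is arbitrary, so two consecutive stationary y-iterates exist only from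
  the outer step k = 1 on. Step 0 is covered by a bound with some large constant, which also
  propagates integrability.

  The accelerated estimate needs \<eta> \<nu> \<le> hmin, which can fail in early outer steps. As
  \<eta> times \<open>M k\<close> is \<rho>^k \<le> 1, a failure forces a bounded number of inner
  steps, for which a crude growth bound suffices.\<close>

lemma gderiv_unique:
  assumes "GDERIV f x :> D" "GDERIV f x :> E"
  shows "D = E"
proof -
  have "(\<lambda>h. inner h E) = (\<lambda>h. inner h D)"
    using assms(2,1) unfolding gderiv_def by (rule has_derivative_unique)
  then have "inner h (E - D) = 0" for h by (simp add: fun_eq_iff inner_diff_right)
  then show ?thesis by (metis eq_iff_diff_eq_0 inner_eq_zero_iff)
qed

lemma grad_eqI:
  fixes f :: "'a::real_inner \<Rightarrow> real"
  assumes "GDERIV f x :> D"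
  shows "grad f x = D"
  unfolding grad_def using assms gderiv_unique by (metis the_equality)

lemma gderiv_grad:
  fixes f :: "'a::euclidean_space \<Rightarrow> real"
  assumes "f differentiable (at x)"
  shows "GDERIV f x :> grad f x"
proof -
  obtain f' where f': "(f has_derivative f') (at x)"
    using assms by (auto simp: differentiable_def)
  then have l: "linear f'" by (rule has_derivative_linear)
  define D where "D = adjoint f' (1::real)"
  have "f' h = inner h D" for h
    using adjoint_works[OF l, of h 1] by (simp add: D_def inner_commute)
  then have "f' = (\<lambda>h. inner h D)" by (rule ext)
  then have D: "GDERIV f x :> D"
    using f' by (simp add: gderiv_def)
  then show ?thesis using grad_eqI by metis
qed

lemma gderiv_line:
  fixes f :: "'a::euclidean_space \<Rightarrow> real"
  assumes "GDERIV f (x + t *\<^sub>R d) :> D"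
  shows "((\<lambda>t. f (x + t *\<^sub>R d)) has_real_derivative D \<bullet> d) (at t)"
proof -
  have 1: "((\<lambda>t. x + t *\<^sub>R d) has_derivative (\<lambda>h. h *\<^sub>R d)) (at t)"
    by (auto intro!: derivative_eq_intros)
  have 2: "(f has_derivative (\<lambda>h. inner h D)) (at (x + t *\<^sub>R d))"
    using assms by (simp add: gderiv_def)
  show ?thesis
    using diff_chain_at[OF 1 2]
    by (simp add: has_field_derivative_def o_def inner_commute mult.commute fun_eq_iff)
       (metis (no_types, lifting) ext inner_commute mult.commute)
qed

lemma descent_lemma:
  fixes f :: "'a::euclidean_space \<Rightarrow> real"
  assumes G: "\<And>x. GDERIV f x :> G x" and L: "\<And>x y. norm (G x - G y) \<le> \<nu> * norm (x - y)"
  shows "f y \<le> f x + G x \<bullet> (y - x) + \<nu> / 2 * (norm (y - x))\<^sup>2"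
proof -
  define d where "d = y - x"
  \<comment> \<open>\<open>h\<close> is f along the segment minus its quadratic upper model. The
    Lipschitz bound makes its derivative nonpositive on [0, 1], and the claim is h 1 \<le> h
    0.\<close>
  define h where "h t = f (x + t *\<^sub>R d) - t * (G x \<bullet> d) - \<nu> / 2 * t\<^sup>2 * (norm d)\<^sup>2" for t
  have dh: "(h has_real_derivative (G (x + t *\<^sub>R d) \<bullet> d - G x \<bullet> d - \<nu> * t * (norm d)\<^sup>2)) (at t)" for t
    unfolding h_def by (auto intro!: derivative_eq_intros gderiv_line[OF G])
  have "h 1 \<le> h 0"
  proof (rule DERIV_nonpos_imp_nonincreasing[of 0 1 h])
    fix t :: real assume t: "0 \<le> t" "t \<le> 1"
    have "G (x + t *\<^sub>R d) \<bullet> d - G x \<bullet> d \<le> norm (G (x + t *\<^sub>R d) - G x) * norm d"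
      by (metis inner_diff_left norm_cauchy_schwarz)
    also have "\<dots> \<le> (\<nu> * norm (t *\<^sub>R d)) * norm d"
      using L[of "x + t *\<^sub>R d" x] by (intro mult_right_mono) auto
    also have "\<dots> = \<nu> * t * (norm d)\<^sup>2" using t by (simp add: power2_eq_square)
    finally show "\<exists>y. (h has_real_derivative y) (at t) \<and> y \<le> 0" using dh[of t] by auto
  qed simp
  then show ?thesis by (simp add: h_def d_def)
qed

text \<open>Strong convexity on the segment from \<open>x\<close> to \<open>y\<close> bounds the
  difference quotient at parameter t; letting t tend to 0 gives the claim. The limit is one-sided
  because t must lie in (0, 1).\<close>

lemma strongly_convex_gradient_ineq:
  fixes f :: "'a::euclidean_space \<Rightarrow> real"
  assumes sc: "strongly_convex_on UNIV \<alpha> f" and G: "GDERIV f x :> D"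
  shows "f x + D \<bullet> (y - x) + \<alpha> / 2 * (norm (y - x))\<^sup>2 \<le> f y"
proof -
  define d where "d = y - x"
  have der: "((\<lambda>t. f (x + t *\<^sub>R d)) has_real_derivative D \<bullet> d) (at 0)"
    by (rule gderiv_line) (simp add: G)
  then have "((\<lambda>t. (f (x + t *\<^sub>R d) - f x) / t) \<longlongrightarrow> D \<bullet> d) (at 0)"
    by (simp add: has_field_derivative_iff)
  then have lim1: "((\<lambda>t. (f (x + t *\<^sub>R d) - f x) / t) \<longlongrightarrow> D \<bullet> d) (at_right 0)"
    by (rule filterlim_at_split[THEN iffD1, THEN conjunct2])
  have lim2: "((\<lambda>t. f y - f x - \<alpha> / 2 * (1 - t) * (norm d)\<^sup>2) \<longlongrightarrow> f y - f x - \<alpha> / 2 * (1 - 0) * (norm d)\<^sup>2) (at_right 0)"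
    by (intro tendsto_intros)
  have ev: "\<forall>\<^sub>F t in at_right (0::real). t \<in> {0<..<1}"
    by (rule eventually_at_right_real) simp
  have "\<forall>\<^sub>F t in at_right 0. (f (x + t *\<^sub>R d) - f x) / t \<le> f y - f x - \<alpha> / 2 * (1 - t) * (norm d)\<^sup>2"
    using ev
  proof eventually_elim
    case (elim t)
    have "f (t *\<^sub>R y + (1 - t) *\<^sub>R x) \<le> t * f y + (1 - t) * f x - \<alpha> / 2 * t * (1 - t) * (norm (y - x))\<^sup>2"
      using sc elim unfolding strongly_convex_on_def by auto
    moreover have "t *\<^sub>R y + (1 - t) *\<^sub>R x = x + t *\<^sub>R d"
      by (simp add: d_def algebra_simps)
    ultimately have "f (x + t *\<^sub>R d) - f x \<le> t * (f y - f x - \<alpha> / 2 * (1 - t) * (norm d)\<^sup>2)"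
      by (simp add: d_def algebra_simps)
    then show ?case using elim by (simp add: divide_le_eq mult.commute)
  qed
  then have "D \<bullet> d \<le> f y - f x - \<alpha> / 2 * (1 - 0) * (norm d)\<^sup>2"
    by (rule tendsto_le[OF trivial_limit_at_right_real lim2 lim1])
  then show ?thesis by (simp add: d_def)
qed

lemma strongly_convex_monotone:
  fixes f :: "'a::euclidean_space \<Rightarrow> real"
  assumes "strongly_convex_on UNIV \<alpha> f" "GDERIV f x :> D" "GDERIV f y :> E"
  shows "\<alpha> * (norm (x - y))\<^sup>2 \<le> (D - E) \<bullet> (x - y)"
  using strongly_convex_gradient_ineq[OF assms(1,2), of y]
    strongly_convex_gradient_ineq[OF assms(1,3), of x]
  by (simp add: norm_minus_commute inner_diff_left inner_diff_right)

lemma gderiv_minimum: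
  fixes f :: "'a::euclidean_space \<Rightarrow> real"
  assumes "GDERIV f x :> D" "\<And>y. f x \<le> f y"
  shows "D = 0"
proof -
  have "(\<lambda>h. inner h D) = (\<lambda>v. 0)"
    by (rule differential_zero_maxmin[of x UNIV f]) (use assms in \<open>auto simp: gderiv_def\<close>)
  then show ?thesis by (metis inner_eq_zero_iff)
qed

lemma matrix_inner_transpose:
  fixes A :: "real^'n^'m"
  shows "x \<bullet> (A *v y) = (transpose A *v x) \<bullet> y"
  by (metis dot_lmul_matrix vector_transpose_matrix transpose_transpose transpose_matrix_vector)

lemma gderiv_qform:
  fixes G :: "real^'n^'n"
  assumes "transpose G = G"
  shows "GDERIV (\<lambda>u. qform G (u - c)) x :> 2 *\<^sub>R (G *v (x - c))"
proof -
  have bl: "bounded_linear ((*v) G)" by (simp add: matrix_vector_mul_bounded_linear)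
  have 1: "((\<lambda>u. G *v (u - c)) has_derivative (\<lambda>h. G *v h)) (at x)"
    by (rule bounded_linear.has_derivative[OF bl, of "\<lambda>u. u - c" "\<lambda>h. h"])
       (auto intro!: derivative_eq_intros)
  have 2: "((\<lambda>u. u - c) has_derivative (\<lambda>h. h)) (at x)" by (auto intro!: derivative_eq_intros)
  have "((\<lambda>u. (u - c) \<bullet> (G *v (u - c))) has_derivative (\<lambda>h. (x - c) \<bullet> (G *v h) + h \<bullet> (G *v (x - c)))) (at x)"
    by (rule has_derivative_inner[OF 2 1])
  moreover have "(x - c) \<bullet> (G *v h) + h \<bullet> (G *v (x - c)) = h \<bullet> (2 *\<^sub>R (G *v (x - c)))" for h
    using matrix_inner_transpose[of "x - c" G h] assms by (simp add: inner_commute)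
  ultimately show ?thesis by (simp add: gderiv_def qform_def)
qed

lemma gderiv_norm_affine:
  fixes B :: "real^'n^'m"
  shows "GDERIV (\<lambda>v. (norm (c + B *v v))\<^sup>2) x :> 2 *\<^sub>R (transpose B *v (c + B *v x))"
proof -
  have bl: "bounded_linear ((*v) B)" by (simp add: matrix_vector_mul_bounded_linear)
  have 1: "((\<lambda>u. c + B *v u) has_derivative (\<lambda>h. B *v h)) (at x)"
    using bounded_linear.has_derivative[OF bl, of "\<lambda>u. u" "\<lambda>h. h" "at x"]
    by (auto intro!: derivative_eq_intros)
  have "((\<lambda>u. (c + B *v u) \<bullet> (c + B *v u)) has_derivative (\<lambda>h. (c + B *v x) \<bullet> (B *v h) + (B *v h) \<bullet> (c + B *v x))) (at x)"
    by (rule has_derivative_inner[OF 1 1])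
  moreover have "(c + B *v x) \<bullet> (B *v h) + (B *v h) \<bullet> (c + B *v x) = h \<bullet> (2 *\<^sub>R (transpose B *v (c + B *v x)))" for h
    using matrix_inner_transpose[of "c + B *v x" B h] by (simp add: inner_commute)
  ultimately show ?thesis by (simp add: gderiv_def dot_square_norm)
qed

lemma gderiv_inner_const: "GDERIV (\<lambda>u. c \<bullet> u) x :> c"
  by (simp add: gderiv_def inner_commute bounded_linear_imp_has_derivative bounded_linear_inner_left)

section \<open>Linear algebra and strongly monotone equations\<close>

text \<open>The form is continuous and positive on the compact unit sphere; its minimum there is the
  constant, by homogeneity.\<close>

lemma pos_def_coercive:
  fixes H :: "real^'n^'n"
  assumes "pos_def H"
  obtains c where "c > 0" "\<And>x. c * (norm x)\<^sup>2 \<le> x \<bullet> (H *v x)"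
proof -
  have cont: "continuous_on (sphere 0 1) (\<lambda>x. x \<bullet> (H *v x))"
    by (intro continuous_intros matrix_vector_mult_linear_continuous_on)
  have ne: "sphere (0::real^'n) 1 \<noteq> {}"
    using vector_choose_size[of 1] by (metis dist_0_norm empty_iff mem_sphere zero_le_one)
  obtain x0 where x0: "x0 \<in> sphere 0 1" "\<And>x. x \<in> sphere 0 1 \<Longrightarrow> x0 \<bullet> (H *v x0) \<le> x \<bullet> (H *v x)"
    using continuous_attains_inf[OF compact_sphere ne cont] by auto
  define c where "c = x0 \<bullet> (H *v x0)"
  have "c > 0" using assms x0(1) unfolding pos_def_def qform_def c_def by (cases "x0 = 0") auto
  moreover have "c * (norm x)\<^sup>2 \<le> x \<bullet> (H *v x)" for x
  proof (cases "x = 0")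
    case False
    define y where "y = x /\<^sub>R norm x"
    have y: "y \<in> sphere 0 1" using False by (simp add: y_def)
    have x: "x = norm x *\<^sub>R y" using False by (simp add: y_def)
    have "x \<bullet> (H *v x) = (norm x)\<^sup>2 * (y \<bullet> (H *v y))"
      by (subst (1 2) x) (simp add: matrix_vector_mult_scaleR power2_eq_square)
    then show ?thesis using mult_right_mono[OF x0(2)[OF y], of "(norm x)\<^sup>2"]
      by (simp add: c_def mult.commute)
  qed simp
  ultimately show ?thesis using that by blast
qed

lemma matrix_norm_bound:
  fixes H :: "real^'n^'m"
  shows "\<exists>K>0. \<forall>x. norm (H *v x) \<le> K * norm x"
  using bounded_linear.pos_bounded[OF matrix_vector_mul_bounded_linear[of H]]
  by (auto simp: mult.commute)

lemma coercive_det_nonzero: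
  fixes K :: "real^'n^'n"
  assumes "\<And>x. x \<noteq> 0 \<Longrightarrow> 0 < x \<bullet> (K *v x)"
  shows "det K \<noteq> 0"
proof -
  have "\<forall>x. K *v x = 0 \<longrightarrow> x = 0" using assms by (metis inner_zero_right less_irrefl)
  then have "\<exists>B. B ** K = mat 1" using matrix_left_invertible_ker[of K] by blast
  then show ?thesis using invertible_det_nz invertible_left_inverse by blast
qed

text \<open>Cramer's formula makes the solution of a linear system a measurable function of its data.\<close>

definition cramer_solve :: "real^'n^'n \<Rightarrow> real^'n \<Rightarrow> real^'n" where
  "cramer_solve K r = (\<chi> k. det (\<chi> i j. if j = k then r $ i else K $ i $ j) / det K)"

lemma cramer_solve:
  assumes "\<And>x. x \<noteq> 0 \<Longrightarrow> 0 < x \<bullet> (K *v x)"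
  shows "K *v cramer_solve K r = r" "K *v z = r \<Longrightarrow> z = cramer_solve K r"
  using cramer[OF coercive_det_nonzero[OF assms], of _ r] unfolding cramer_solve_def by auto

section \<open>Measurability of coordinates, determinants and solutions of linear systems\<close>

lemma borel_measurable_nth [measurable (raw)]:
  fixes f :: "'a \<Rightarrow> ('b::second_countable_topology)^'n"
  assumes "f \<in> borel_measurable M"
  shows "(\<lambda>w. f w $ i) \<in> borel_measurable M"
  by (rule borel_measurable_continuous_on[OF _ assms]) (intro continuous_intros)

lemma borel_measurable_vec_lambda:
  fixes f :: "'a \<Rightarrow> 'n::finite \<Rightarrow> real"
  assumes "\<And>i. (\<lambda>w. f w i) \<in> borel_measurable M"
  shows "(\<lambda>w. \<chi> i. f w i) \<in> borel_measurable M"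
proof -
  have "(\<lambda>w. (\<chi> i. f w i) \<bullet> b) \<in> borel_measurable M" if "b \<in> Basis" for b
    using that assms by (auto simp: Basis_vec_def inner_axis)
  then show ?thesis by (simp add: borel_measurable_euclidean_space[where f = "\<lambda>w. \<chi> i. f w i"])
qed

lemma borel_measurable_det:
  fixes f :: "'a \<Rightarrow> 'n \<Rightarrow> 'n::finite \<Rightarrow> real"
  assumes [measurable]: "\<And>i j. (\<lambda>w. f w i j) \<in> borel_measurable M"
  shows "(\<lambda>w. det (\<chi> i j. f w i j)) \<in> borel_measurable M"
  unfolding det_def by (intro borel_measurable_sum borel_measurable_times borel_measurable_const borel_measurable_prod) simp

lemma borel_measurable_cramer_solve [measurable (raw)]:
  fixes K :: "'a \<Rightarrow> real^'n^'n"
  assumes [measurable]: "K \<in> borel_measurable M" "r \<in> borel_measurable M"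
  shows "(\<lambda>w. cramer_solve (K w) (r w)) \<in> borel_measurable M"
proof -
  have K: "det (K w) = det (\<chi> i j. K w $ i $ j)" for w by simp
  have "(\<lambda>w. det (\<chi> i j. if j = k then r w $ i else K w $ i $ j)) \<in> borel_measurable M" for k
    by (rule borel_measurable_det) measurable
  moreover have "(\<lambda>w. det (K w)) \<in> borel_measurable M"
    unfolding K by (rule borel_measurable_det) measurable
  ultimately show ?thesis
    unfolding cramer_solve_def by (intro borel_measurable_vec_lambda borel_measurable_divide)
qed

lemma borel_measurable_matrix_vector_mult [measurable (raw)]:
  fixes K :: "'a \<Rightarrow> real^'n^'m"
  assumes [measurable]: "K \<in> borel_measurable M" "r \<in> borel_measurable M"
  shows "(\<lambda>w. K w *v r w) \<in> borel_measurable M"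
  unfolding matrix_vector_mult_def by (rule borel_measurable_vec_lambda) measurable

text \<open>Evaluating the form at \<open>v - (1/c) *\<^sub>R (D *v v)\<close> avoids the square
  root of \<open>D\<close>. The lemma lets the energy of an x-step, measured in \<open>D\<close>,
  control the vector \<open>D *v (x' - x)\<close> that occurs in the optimality condition.\<close>

lemma psd_apply_norm_le:
  fixes D :: "real^'n^'n"
  assumes sym: "transpose D = D" and nonneg: "\<And>x. 0 \<le> x \<bullet> (D *v x)"
    and c: "c > 0" and le: "\<And>x. x \<bullet> (D *v x) \<le> c * (norm x)\<^sup>2"
  shows "(norm (D *v v))\<^sup>2 \<le> c * (v \<bullet> (D *v v))"
proof -
  define w where "w = D *v v"
  have vw: "v \<bullet> (D *v w) = (norm w)\<^sup>2"
    using matrix_inner_transpose[of v D w] sym by (simp add: w_def power2_norm_eq_inner)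
  have "0 \<le> (v - (1/c) *\<^sub>R w) \<bullet> (D *v (v - (1/c) *\<^sub>R w))" by (rule nonneg)
  also have "\<dots> = v \<bullet> (D *v v) - 2 / c * (norm w)\<^sup>2 + (1/c)\<^sup>2 * (w \<bullet> (D *v w))"
    by (simp add: matrix_vector_mult_diff_distrib inner_diff_left inner_diff_right vw
        matrix_vector_mult_scaleR power2_eq_square)
       (simp add: w_def[symmetric] dot_square_norm power2_eq_square diff_divide_distrib)
  also have "\<dots> \<le> v \<bullet> (D *v v) - 2 / c * (norm w)\<^sup>2 + (1/c)\<^sup>2 * (c * (norm w)\<^sup>2)"
    using le[of w] by (intro add_left_mono mult_left_mono) auto
  also have "\<dots> = v \<bullet> (D *v v) - (norm w)\<^sup>2 / c" using c by (simp add: power2_eq_square field_simps)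
  finally show ?thesis using c by (simp add: w_def field_simps)
qed

text \<open>A Hoffman bound for linear equations. The joint map \<open>T\<close> is injective on the
  orthogonal complement of its kernel, hence bounded below there by some \<open>e\<close>, and
  removing from \<open>l\<close> the component \<open>z\<close> of \<open>l - l0\<close> in that
  complement reaches the solution set. The constant comes from \<open>A\<close> and \<open>B\<close>
  alone, so it serves for every right-hand side.\<close>

lemma dist_solution_set_le:
  fixes A :: "real^'p^'n" and B :: "real^'q^'n"
  defines "S \<equiv> \<lambda>a b. {l::real^'n. transpose A *v l = a \<and> transpose B *v l = b}"
  shows "\<exists>C>0. \<forall>a b l. S a b \<noteq> {} \<longrightarrow> (norm (l - closest_point (S a b) l))\<^sup>2
       \<le> C * ((norm (transpose A *v l - a))\<^sup>2 + (norm (transpose B *v l - b))\<^sup>2)"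
proof -
  define T where "T l = (transpose A *v l, transpose B *v l)" for l :: "real^'n"
  have T: "bounded_linear T" unfolding T_def
    by (intro bounded_linear_Pair matrix_vector_mul_bounded_linear)
  interpret T: bounded_linear T by (rule T)
  define K where "K = {l. T l = 0}"
  have K: "subspace K" unfolding K_def by (rule subspaceI) (auto simp: T.add T.scaleR T.zero)
  define K' where "K' = {z. \<forall>w\<in>K. orthogonal z w}"
  have K': "subspace K'" unfolding K'_def
    by (rule subspaceI) (auto simp: orthogonal_def inner_add_left)
  have inj: "\<forall>z\<in>K'. T z = 0 \<longrightarrow> z = 0"
    by (auto simp: K'_def K_def orthogonal_def)
  obtain e where e: "e > 0" "\<And>z. z \<in> K' \<Longrightarrow> e * norm z \<le> norm (T z)"
    using injective_imp_isometric[OF closed_subspace[OF K'] K' T inj] by auto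
  have "(norm (l - closest_point (S a b) l))\<^sup>2
       \<le> (1/e)\<^sup>2 * ((norm (transpose A *v l - a))\<^sup>2 + (norm (transpose B *v l - b))\<^sup>2)"
    if ne: "S a b \<noteq> {}" for a b l
  proof -
    obtain l0 where l0: "l0 \<in> S a b" using ne by auto
    obtain y z where yz: "y \<in> span K" "\<And>w. w \<in> span K \<Longrightarrow> orthogonal z w" "l - l0 = y + z"
      using orthogonal_subspace_decomp_exists[of K "l - l0"] by metis
    have y: "y \<in> K" using yz(1) K by (simp add: span_eq_iff[THEN iffD2])
    have z: "z \<in> K'" using yz(2) by (auto simp: K'_def span_base)
    have Ty: "T y = 0" using y by (simp add: K_def)
    have "T z = T (l - l0) - T y" using yz(3) T.diff[of "l - l0" y] by simp
    then have Tz: "T z = (transpose A *v l - a, transpose B *v l - b)"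
      using l0 Ty by (simp add: T.diff) (simp add: T_def S_def)
    have "closed (S a b)" unfolding S_def
      by (intro closed_Collect_conj closed_Collect_eq continuous_intros
          matrix_vector_mult_linear_continuous_on)
    moreover have "l0 + y \<in> S a b" using l0 Ty
      by (auto simp: S_def T_def matrix_vector_right_distrib zero_prod_def simp del: transpose_matrix_vector)
    ultimately have "dist l (closest_point (S a b) l) \<le> dist l (l0 + y)"
      by (rule closest_point_le)
    also have "\<dots> = norm z" using yz(3) by (simp add: dist_norm algebra_simps)
    also have "\<dots> \<le> (1/e) * norm (T z)" using e z by (simp add: field_simps)
    finally have "(norm (l - closest_point (S a b) l))\<^sup>2 \<le> ((1/e) * norm (T z))\<^sup>2"
      by (intro power_mono) (auto simp: dist_norm)
    also have "\<dots> = (1/e)\<^sup>2 * (norm (T z))\<^sup>2" by (rule power_mult_distrib)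
    also have "(norm (T z))\<^sup>2 = (norm (transpose A *v l - a))\<^sup>2 + (norm (transpose B *v l - b))\<^sup>2"
      unfolding Tz norm_Pair by simp
    finally show ?thesis .
  qed
  moreover have "(1/e)\<^sup>2 > 0" using e by simp
  ultimately show ?thesis by blast
qed

text \<open>For a suitable step t the map x - t T x is a contraction, and its fixed point is a zero
  of \<open>T\<close>.\<close>

lemma strongly_monotone_surj:
  fixes T :: "'a::euclidean_space \<Rightarrow> 'a"
  assumes a: "a > 0" and mono: "\<And>x y. a * (norm (x - y))\<^sup>2 \<le> (T x - T y) \<bullet> (x - y)"
    and lip: "\<And>x y. norm (T x - T y) \<le> L * norm (x - y)"
  obtains x where "T x = 0"
proof -
  \<comment> \<open>A Lipschitz constant of at least \<open>a\<close> keeps 1 - a^2 / L'^2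
    nonnegative, so that \<open>c\<close> is a genuine square root. The step \<open>t\<close> chosen
    below minimizes the bound 1 - 2 t a + t^2 L'^2 for the squared contraction factor.\<close>
  define L' where "L' = max L a"
  have L': "L' > 0" "L' \<ge> a" using a by (auto simp: L'_def)
  have lip': "norm (T x - T y) \<le> L' * norm (x - y)" for x y
    using lip[of x y] mult_right_mono[of L L' "norm (x - y)"] by (auto simp: L'_def)
  define t where "t = a / L'\<^sup>2"
  have t: "t > 0" using a L' by (simp add: t_def)
  define c where "c = sqrt (1 - a\<^sup>2 / L'\<^sup>2)"
  have q: "0 \<le> 1 - a\<^sup>2 / L'\<^sup>2" "1 - a\<^sup>2 / L'\<^sup>2 < 1" using a L' by (auto simp: power_mono)
  have c: "0 \<le> c" "c < 1" using q by (auto simp: c_def)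
  define f where "f x = x - t *\<^sub>R T x" for x
  have "dist (f x) (f y) \<le> c * dist x y" for x y
  proof -
    have "(norm (f x - f y))\<^sup>2 = (norm (x - y))\<^sup>2 - 2 * t * ((T x - T y) \<bullet> (x - y)) + t\<^sup>2 * (norm (T x - T y))\<^sup>2"
      unfolding f_def power2_norm_eq_inner
      by (simp add: inner_diff_left inner_diff_right power2_eq_square inner_commute algebra_simps)
    also have "\<dots> \<le> (norm (x - y))\<^sup>2 - 2 * t * (a * (norm (x - y))\<^sup>2) + t\<^sup>2 * (L' * norm (x - y))\<^sup>2"
      using mono[of x y] lip'[of x y] t
      by (intro add_mono diff_mono mult_left_mono power_mono) auto
    also have "\<dots> = (1 - a\<^sup>2 / L'\<^sup>2) * (norm (x - y))\<^sup>2"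
      using L' by (simp add: t_def field_simps power2_eq_square)
    also have "\<dots> = (c * norm (x - y))\<^sup>2"
      using q(1) by (simp add: c_def power_mult_distrib)
    finally show ?thesis using c by (simp add: dist_norm power2_le_iff_abs_le)
  qed
  then obtain x where "f x = x" using banach_fix_type[OF c, of f] by blast
  then have "T x = 0" using t by (simp add: f_def)
  then show ?thesis by (rule that)
qed

section \<open>The inner loop as an inexact accelerated method\<close>

lemma two_mult_le_weighted:
  fixes p q c :: real
  assumes "c > 0"
  shows "2 * (p * q) \<le> c * p\<^sup>2 + q\<^sup>2 / c"
proof -
  have "0 \<le> (c * p - q)\<^sup>2 / c" using assms by simp
  also have "\<dots> = c * p\<^sup>2 - 2 * (p * q) + q\<^sup>2 / c"
    using assms by (simp add: power2_eq_square field_simps)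
  finally show ?thesis by simp
qed

text \<open>One step of an accelerated gradient method whose gradient is taken at a shifted point.
  \<open>a\<close> is the error of the prox sequence relative to \<open>u\<close>, \<open>A\<close>
  its weighted sum, so that 2 A / (t (t - 1)) is the error of the averaged iterate, and
  \<open>nh\<close> is the shift. The energy consists of (2 / \<eta>) times the
  \<open>H\<close>-form of \<open>a\<close> and t (t - 1) times the Bregman distance
  \<open>br\<close> of the average from \<open>u\<close>; the inequality results from testing the
  step equation with 2 t a'.\<close>

lemma accelerated_energy_step:
  fixes H Q :: "real^'n^'n" and f :: "real^'n \<Rightarrow> real" and t :: real
  assumes H: "transpose H = H" "hmin > 0" "\<And>v. hmin * (norm v)\<^sup>2 \<le> v \<bullet> (H *v v)"
    and Q: "c1 > 0" "\<And>v. c1 * (norm v)\<^sup>2 \<le> v \<bullet> (Q *v v)"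
    and G: "\<And>v. GDERIV f v :> G v" "\<And>v w. f v + G v \<bullet> (w - v) \<le> f w"
      "\<And>v w. norm (G v - G w) \<le> \<nu> * norm (v - w)"
    and \<nu>: "\<nu> > 0" and \<eta>: "\<eta> > 0" "\<eta> * \<nu> \<le> hmin" and t: "t \<ge> 1"
    and A': "A' = A + t *\<^sub>R a'" and A1: "t = 1 \<Longrightarrow> A = 0"
    and eq: "(2 / (t * \<eta>)) *\<^sub>R (H *v (a' - a)) + Q *v a'
        + (G (u + (2 / (t * (t + 1))) *\<^sub>R (t *\<^sub>R a + A) + nh) - G u) = 0"
  defines "br \<equiv> \<lambda>v. f v - f u - G u \<bullet> (v - u)"
  shows "c1 * t * (norm a')\<^sup>2 + (2 / \<eta>) * (a' \<bullet> (H *v a')) + t * (t + 1) * br (u + (2 / (t * (t + 1))) *\<^sub>R A')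
    \<le> (2 / \<eta>) * (a \<bullet> (H *v a)) + t * (t - 1) * br (u + (2 / (t * (t - 1))) *\<^sub>R A)
        + \<nu>\<^sup>2 / c1 * (t * (norm nh)\<^sup>2)"
proof -
  define zh where "zh = u + (2 / (t * (t + 1))) *\<^sub>R (t *\<^sub>R a + A)"
  define xh where "xh = zh + nh"
  define Z where "Z = u + (2 / (t * (t - 1))) *\<^sub>R A"
  define Z' where "Z' = u + (2 / (t * (t + 1))) *\<^sub>R A'"
  have t0: "t > 0" using t by simp
  have Zh: "Z' - zh = (2 / (t + 1)) *\<^sub>R (a' - a)"
    using t0 by (simp add: Z'_def zh_def A' scaleR_add_right scaleR_diff_right)
  \<comment> \<open>At t = 1 there is no average yet: division by zero makes \<open>Z\<close> equal
    to \<open>u\<close>, and the identity survives because \<open>A\<close> is 0.\<close>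
  have ZA: "(t * (t - 1)) *\<^sub>R (Z - u) = 2 *\<^sub>R A"
    using A1 t0 by (cases "t = 1") (simp_all add: Z_def)
  have ZA': "(t * (t + 1)) *\<^sub>R (Z' - u) = 2 *\<^sub>R A'"
    using t0 by (simp add: Z'_def)
  \<comment> \<open>The test vector 2 t a' splits into three moves that are paid for separately:
    from the extrapolated point \<open>zh\<close> to the new average by the descent lemma, from
    \<open>u\<close> to \<open>zh\<close> by convexity, and between \<open>zh\<close> and the old
    average again by convexity.\<close>
  have "(t * (t + 1)) *\<^sub>R (Z' - zh) + (2 * t) *\<^sub>R (zh - u) - (t * (t - 1)) *\<^sub>R (Z - zh)
      = (t * (t + 1)) *\<^sub>R (Z' - u) - (t * (t - 1)) *\<^sub>R (Z - u)"
    by (simp add: vec_eq_iff algebra_simps)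
  also have "\<dots> = (2 * t) *\<^sub>R a'" unfolding ZA ZA' A' by (simp add: algebra_simps)
  finally have dec: "(2 * t) *\<^sub>R a' = (t * (t + 1)) *\<^sub>R (Z' - zh) + (2 * t) *\<^sub>R (zh - u) - (t * (t - 1)) *\<^sub>R (Z - zh)"
    by simp
  define g where "g = G zh - G u"
  have b1: "br Z' - br zh - \<nu> / 2 * (norm (Z' - zh))\<^sup>2 \<le> g \<bullet> (Z' - zh)"
    using descent_lemma[OF G(1) G(3), of Z' zh] by (simp add: br_def g_def inner_diff_left inner_diff_right)
  have b2: "br zh \<le> g \<bullet> (zh - u)"
    using G(2)[of zh u] by (simp add: br_def g_def inner_diff_left inner_diff_right)
  have b3: "br zh - br Z \<le> - (g \<bullet> (Z - zh))"
    using G(2)[of zh Z] by (simp add: br_def g_def inner_diff_left inner_diff_right)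
  have "t * (t + 1) * (br Z' - br zh - \<nu> / 2 * (norm (Z' - zh))\<^sup>2) + 2 * t * br zh + t * (t - 1) * (br zh - br Z)
      \<le> t * (t + 1) * (g \<bullet> (Z' - zh)) + 2 * t * (g \<bullet> (zh - u)) + t * (t - 1) * (- (g \<bullet> (Z - zh)))"
    using b1 b2 b3 t by (intro add_mono mult_left_mono) auto
  also have "\<dots> = g \<bullet> ((2 * t) *\<^sub>R a')" unfolding dec
    by (simp add: inner_add_right inner_diff_right) (simp add: right_diff_distrib)
  finally have "t * (t + 1) * br Z' - t * (t - 1) * br Z - t * (t + 1) * (\<nu> / 2 * (norm (Z' - zh))\<^sup>2) \<le> 2 * t * (g \<bullet> a')"
    by (simp add: algebra_simps)
  moreover have "t * (t + 1) * (\<nu> / 2 * (norm (Z' - zh))\<^sup>2) \<le> 2 * \<nu> * (norm (a' - a))\<^sup>2"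
  proof -
    have Zn: "(norm (Z' - zh))\<^sup>2 = (2 / (t + 1))\<^sup>2 * (norm (a' - a))\<^sup>2"
      unfolding Zh by (simp add: power_mult_distrib power_divide)
    have "t * (t + 1) * (\<nu> / 2 * (norm (Z' - zh))\<^sup>2) = (t / (t + 1)) * (2 * \<nu> * (norm (a' - a))\<^sup>2)"
    proof -
      define q where "q = t + 1"
      have "q > 0" using t0 by (simp add: q_def)
      then show ?thesis unfolding Zn q_def[symmetric] by (simp add: power2_eq_square field_simps)
    qed
    also have "\<dots> \<le> 1 * (2 * \<nu> * (norm (a' - a))\<^sup>2)"
      using t0 \<nu> by (intro mult_right_mono) auto
    finally show ?thesis by simp
  qed
  ultimately have I4: "t * (t + 1) * br Z' - t * (t - 1) * br Z - 2 * \<nu> * (norm (a' - a))\<^sup>2 \<le> 2 * t * (g \<bullet> a')"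
    by linarith
  \<comment> \<open>\<open>Q\<close> supplies 2 c1 t |a'|^2. Half of it pays for the gradient error
    caused by the shift; the other half survives in the claim.\<close>
  have I3: "- (c1 * t * (norm a')\<^sup>2 + \<nu>\<^sup>2 / c1 * (t * (norm nh)\<^sup>2)) \<le> 2 * t * ((G xh - G zh) \<bullet> a')"
  proof -
    have "\<bar>(G xh - G zh) \<bullet> a'\<bar> \<le> norm (G xh - G zh) * norm a'" by (rule Cauchy_Schwarz_ineq2)
    also have "\<dots> \<le> (\<nu> * norm nh) * norm a'"
      using G(3)[of xh zh] by (intro mult_right_mono) (auto simp: xh_def)
    finally have "2 * t * \<bar>(G xh - G zh) \<bullet> a'\<bar> \<le> t * (2 * (norm a' * (\<nu> * norm nh)))"
      using t0 by (simp add: mult.commute)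
    also have "\<dots> \<le> t * (c1 * (norm a')\<^sup>2 + (\<nu> * norm nh)\<^sup>2 / c1)"
      using t0 two_mult_le_weighted[OF Q(1), of "norm a'" "\<nu> * norm nh"] by (intro mult_left_mono) auto
    finally have "2 * t * \<bar>(G xh - G zh) \<bullet> a'\<bar> \<le> c1 * t * (norm a')\<^sup>2 + \<nu>\<^sup>2 / c1 * (t * (norm nh)\<^sup>2)"
      by (simp add: algebra_simps)
    moreover have "- (2 * t * \<bar>(G xh - G zh) \<bullet> a'\<bar>) \<le> 2 * t * ((G xh - G zh) \<bullet> a')"
      using t0 by (simp add: abs_if)
    ultimately show ?thesis by linarith
  qed
  have I1: "(4 / \<eta>) * (a' \<bullet> (H *v (a' - a))) + 2 * t * (a' \<bullet> (Q *v a')) + 2 * t * ((G xh - G zh) \<bullet> a') + 2 * t * (g \<bullet> a') = 0"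
  proof -
    have "((2 * t) *\<^sub>R a') \<bullet> ((2 / (t * \<eta>)) *\<^sub>R (H *v (a' - a)) + Q *v a' + (G xh - G u)) = 0"
      using eq by (simp add: xh_def zh_def)
    then have "2 * t * ((2 / (t * \<eta>)) * (a' \<bullet> (H *v (a' - a)))) + 2 * t * (a' \<bullet> (Q *v a')) + 2 * t * (a' \<bullet> (G xh - G u)) = 0"
      by (simp add: inner_add_right algebra_simps)
    moreover have "2 * t * ((2 / (t * \<eta>)) * (a' \<bullet> (H *v (a' - a)))) = (4 / \<eta>) * (a' \<bullet> (H *v (a' - a)))"
      using t0 \<eta> by (simp add: field_simps)
    moreover have "2 * t * (a' \<bullet> (G xh - G u)) = 2 * t * ((G xh - G zh) \<bullet> a') + 2 * t * (g \<bullet> a')"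
      by (simp add: g_def inner_diff_left inner_diff_right inner_commute algebra_simps)
    ultimately show ?thesis by simp
  qed
  have sym: "a \<bullet> (H *v a') = a' \<bullet> (H *v a)"
    using matrix_inner_transpose[of a H a'] H(1) by (simp add: inner_commute)
  have I2: "(4 / \<eta>) * (a' \<bullet> (H *v (a' - a))) = (2 / \<eta>) * (a' \<bullet> (H *v a')) - (2 / \<eta>) * (a \<bullet> (H *v a))
      + (2 / \<eta>) * ((a' - a) \<bullet> (H *v (a' - a)))"
    by (simp add: matrix_vector_mult_diff_distrib inner_diff_left inner_diff_right sym algebra_simps)
  \<comment> \<open>Here the step size condition enters: the proximal term absorbs the quadratic
    error of the descent lemma.\<close>
  have "2 * \<nu> * (norm (a' - a))\<^sup>2 \<le> (2 / \<eta>) * (hmin * (norm (a' - a))\<^sup>2)"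
    using \<eta>(1) mult_right_mono[OF \<eta>(2), of "(norm (a' - a))\<^sup>2"] by (simp add: field_simps)
  also have "\<dots> \<le> (2 / \<eta>) * ((a' - a) \<bullet> (H *v (a' - a)))"
    using \<eta> H(3)[of "a' - a"] by (intro mult_left_mono) auto
  finally have I5: "2 * \<nu> * (norm (a' - a))\<^sup>2 \<le> (2 / \<eta>) * ((a' - a) \<bullet> (H *v (a' - a)))" .
  have I6: "2 * (c1 * t * (norm a')\<^sup>2) \<le> 2 * t * (a' \<bullet> (Q *v a'))"
    using Q(2)[of a'] t0 by simp
  show ?thesis using I1 I2 I3 I4 I5 I6 unfolding Z_def[symmetric] Z'_def[symmetric] by linarith
qed

text \<open>The steps telescope since the coefficient t (t + 1) after step t is the coefficient t (t
  - 1) of step t + 1. What is kept is the weighted sum of |a|^2 that the coercivity of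
  \<open>Q\<close> provides; by Cauchy-Schwarz it bounds the averaged iterate itself rather than a
  function value.\<close>

lemma accelerated_energy:
  fixes H Q :: "real^'n^'n" and f :: "real^'n \<Rightarrow> real" and a A nh :: "nat \<Rightarrow> real^'n"
  assumes H: "transpose H = H" "hmin > 0" "\<And>v. hmin * (norm v)\<^sup>2 \<le> v \<bullet> (H *v v)"
    and Q: "c1 > 0" "\<And>v. c1 * (norm v)\<^sup>2 \<le> v \<bullet> (Q *v v)"
    and G: "\<And>v. GDERIV f v :> G v" "\<And>v w. f v + G v \<bullet> (w - v) \<le> f w"
      "\<And>v w. norm (G v - G w) \<le> \<nu> * norm (v - w)"
    and \<nu>: "\<nu> > 0" and \<eta>: "\<eta> > 0" "\<eta> * \<nu> \<le> hmin"
    and A: "A 1 = 0" "\<And>t. t \<in> {1..M} \<Longrightarrow> A (Suc t) = A t + real t *\<^sub>R a (Suc t)"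
    and eq: "\<And>t. t \<in> {1..M} \<Longrightarrow> (2 / (real t * \<eta>)) *\<^sub>R (H *v (a (Suc t) - a t)) + Q *v a (Suc t)
        + (G (u + (2 / (real t * (real t + 1))) *\<^sub>R (real t *\<^sub>R a t + A t) + nh t) - G u) = 0"
  shows "c1 * (\<Sum>t=1..M. real t * (norm (a (Suc t)))\<^sup>2)
    \<le> (2 / \<eta>) * (a 1 \<bullet> (H *v a 1)) + \<nu>\<^sup>2 / c1 * (\<Sum>t=1..M. real t * (norm (nh t))\<^sup>2)"
proof -
  define br where "br v = f v - f u - G u \<bullet> (v - u)" for v
  have br0: "0 \<le> br v" for v using G(2)[of u v] by (simp add: br_def)
  have step: "c1 * real t * (norm (a (Suc t)))\<^sup>2 + (2 / \<eta>) * (a (Suc t) \<bullet> (H *v a (Suc t)))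
        + real t * (real t + 1) * br (u + (2 / (real t * (real t + 1))) *\<^sub>R A (Suc t))
    \<le> (2 / \<eta>) * (a t \<bullet> (H *v a t)) + real t * (real t - 1) * br (u + (2 / (real t * (real t - 1))) *\<^sub>R A t)
        + \<nu>\<^sup>2 / c1 * (real t * (norm (nh t))\<^sup>2)" if "t \<in> {1..M}" for t
    unfolding br_def
    by (rule accelerated_energy_step[OF H Q G \<nu> \<eta> _ A(2)[OF that] _ eq[OF that]]) (use that A(1) in auto)
  have "m \<le> M \<Longrightarrow> c1 * (\<Sum>t=1..m. real t * (norm (a (Suc t)))\<^sup>2) + (2 / \<eta>) * (a (Suc m) \<bullet> (H *v a (Suc m)))
        + real m * (real m + 1) * br (u + (2 / (real m * (real m + 1))) *\<^sub>R A (Suc m))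
      \<le> (2 / \<eta>) * (a 1 \<bullet> (H *v a 1)) + \<nu>\<^sup>2 / c1 * (\<Sum>t=1..m. real t * (norm (nh t))\<^sup>2)" for m
  proof (induction m)
    case (Suc m)
    then have "Suc m \<in> {1..M}" by simp
    from step[OF this] Suc show ?case by (simp add: algebra_simps)
  qed simp
  from this[of M] have "c1 * (\<Sum>t=1..M. real t * (norm (a (Suc t)))\<^sup>2) + (2 / \<eta>) * (a (Suc M) \<bullet> (H *v a (Suc M)))
        + real M * (real M + 1) * br (u + (2 / (real M * (real M + 1))) *\<^sub>R A (Suc M))
      \<le> (2 / \<eta>) * (a 1 \<bullet> (H *v a 1)) + \<nu>\<^sup>2 / c1 * (\<Sum>t=1..M. real t * (norm (nh t))\<^sup>2)" by simp
  moreover have "0 \<le> (2 / \<eta>) * (a (Suc M) \<bullet> (H *v a (Suc M)))"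
    using H(3)[of "a (Suc M)"] H(2) \<eta>(1) by (smt (verit) divide_nonneg_nonneg mult_nonneg_nonneg zero_le_power2)
  moreover have "0 \<le> real M * (real M + 1) * br (u + (2 / (real M * (real M + 1))) *\<^sub>R A (Suc M))"
    using br0 by simp
  ultimately show ?thesis by linarith
qed

text \<open>A substitute for large step sizes, where the proximal term is too weak for the energy
  estimate: testing with a' and dropping the \<open>Q\<close> term leaves a bounded growth factor,
  because t \<eta> \<le> 1.\<close>

lemma inner_step_growth:
  fixes H Q :: "real^'n^'n" and a A :: "real^'n"
  assumes H: "hmin > 0" "\<And>v. hmin * (norm v)\<^sup>2 \<le> v \<bullet> (H *v v)" "hmax > 0" "\<And>v. norm (H *v v) \<le> hmax * norm v"
    and Q: "\<And>v. 0 \<le> v \<bullet> (Q *v v)"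
    and G: "\<And>v w. norm (G v - G w) \<le> \<nu> * norm (v - w)"
    and \<nu>: "\<nu> > 0" and \<eta>: "\<eta> > 0" "t * \<eta> \<le> 1" and t: "t \<ge> 1"
    and eq: "(2 / (t * \<eta>)) *\<^sub>R (H *v (a' - a)) + Q *v a'
        + (G (u + (2 / (t * (t + 1))) *\<^sub>R (t *\<^sub>R a + A) + nh) - G u) = 0"
  shows "norm a' \<le> (hmax + \<nu>) / hmin * (norm a + norm A + norm nh)"
proof -
  define y where "y = (2 / (t * (t + 1))) *\<^sub>R (t *\<^sub>R a + A) + nh"
  have t0: "t > 0" using t by simp
  have "norm y \<le> norm ((2 / (t * (t + 1))) *\<^sub>R (t *\<^sub>R a + A)) + norm nh"
    unfolding y_def by (rule norm_triangle_ineq)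
  also have "norm ((2 / (t * (t + 1))) *\<^sub>R (t *\<^sub>R a + A)) = (2 / (t * (t + 1))) * norm (t *\<^sub>R a + A)"
    using t0 by simp
  also have "\<dots> \<le> (2 / (t * (t + 1))) * (t * norm a + norm A)"
    using t0 norm_triangle_ineq[of "t *\<^sub>R a" A] by (intro mult_left_mono) auto
  also have "\<dots> = 2 / (t + 1) * norm a + 2 / (t * (t + 1)) * norm A"
  proof -
    define q where "q = t + 1"
    have "q > 0" using t0 by (simp add: q_def)
    then show ?thesis unfolding q_def[symmetric] using t0 by (simp add: field_simps)
  qed
  also have "\<dots> \<le> 1 * norm a + 1 * norm A"
  proof (intro add_mono mult_right_mono)
    show "2 / (t + 1) \<le> 1" using t by simp
    have "2 \<le> t * (t + 1)" using mult_mono[of 1 t 2 "t + 1"] t by simp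
    then show "2 / (t * (t + 1)) \<le> 1" using t0 by simp
  qed auto
  finally have y: "norm y \<le> norm a + norm A + norm nh" by simp
  define g where "g = G (u + y) - G u"
  have g: "norm g \<le> \<nu> * norm y" using G[of "u + y" u] by (simp add: g_def)
  have "a' \<bullet> ((2 / (t * \<eta>)) *\<^sub>R (H *v (a' - a)) + Q *v a' + g) = 0"
    using eq by (simp add: g_def y_def add.assoc)
  then have "(2 / (t * \<eta>)) * (a' \<bullet> (H *v (a' - a))) + a' \<bullet> (Q *v a') + a' \<bullet> g = 0"
    by (simp add: inner_add_right)
  then have "(2 / (t * \<eta>)) * (a' \<bullet> (H *v (a' - a))) \<le> - (a' \<bullet> g)" using Q[of a'] by linarith
  also have "- (a' \<bullet> g) \<le> norm a' * norm g" using Cauchy_Schwarz_ineq2[of a' g] by (simp add: abs_if split: if_splits)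
  finally have "a' \<bullet> (H *v (a' - a)) \<le> (t * \<eta> / 2) * (norm a' * norm g)"
    using t0 \<eta> by (simp add: field_simps)
  also have "\<dots> \<le> 1 * (norm a' * norm g)" using \<eta> by (intro mult_right_mono) auto
  finally have 1: "a' \<bullet> (H *v (a' - a)) \<le> norm a' * norm g" by simp
  have "hmin * (norm a')\<^sup>2 \<le> a' \<bullet> (H *v a')" by (rule H(2))
  also have "\<dots> = a' \<bullet> (H *v (a' - a)) + a' \<bullet> (H *v a)"
    by (simp add: matrix_vector_mult_diff_distrib inner_diff_right)
  also have "a' \<bullet> (H *v a) \<le> norm a' * (hmax * norm a)"
    using norm_cauchy_schwarz[of a' "H *v a"] mult_left_mono[OF H(4)[of a], of "norm a'"] by simp
  also note 1
  finally have "hmin * (norm a')\<^sup>2 \<le> norm a' * (norm g + hmax * norm a)" by (simp add: algebra_simps)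
  then have "norm a' * (hmin * norm a') \<le> norm a' * (norm g + hmax * norm a)"
    by (simp add: power2_eq_square mult.left_commute)
  then have "hmin * norm a' \<le> norm g + hmax * norm a"
    using H(3) by (cases "a' = 0") auto
  also have "\<dots> \<le> \<nu> * (norm a + norm A + norm nh) + hmax * (norm a + norm A + norm nh)"
    using order_trans[OF g mult_left_mono[OF y, of \<nu>]] \<nu> H(3) by (intro add_mono mult_left_mono) auto
  finally have "hmin * norm a' \<le> (hmax + \<nu>) * (norm a + norm A + norm nh)" by (simp add: algebra_simps)
  then show ?thesis using H(1) by (simp add: field_simps)
qed

text \<open>Every step costs a factor, so the bound is exponential in \<open>K\<close>. It is meant
  for a \<open>K\<close> that depends on \<nu> and \<open>hmin\<close> only.\<close>

lemma inner_growth: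
  fixes H Q :: "real^'n^'n" and a A nh :: "nat \<Rightarrow> real^'n"
  assumes H: "hmin > 0" "\<And>v. hmin * (norm v)\<^sup>2 \<le> v \<bullet> (H *v v)" "hmax > 0" "\<And>v. norm (H *v v) \<le> hmax * norm v"
    and Q: "\<And>v. 0 \<le> v \<bullet> (Q *v v)"
    and G: "\<And>v w. norm (G v - G w) \<le> \<nu> * norm (v - w)"
    and \<nu>: "\<nu> > 0" and \<eta>: "\<eta> > 0" "real M * \<eta> \<le> 1" and K: "M \<le> K"
    and A: "A 1 = 0" "\<And>t. t \<in> {1..M} \<Longrightarrow> A (Suc t) = A t + real t *\<^sub>R a (Suc t)"
    and eq: "\<And>t. t \<in> {1..M} \<Longrightarrow> (2 / (real t * \<eta>)) *\<^sub>R (H *v (a (Suc t) - a t)) + Q *v a (Suc t)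
        + (G (u + (2 / (real t * (real t + 1))) *\<^sub>R (real t *\<^sub>R a t + A t) + nh t) - G u) = 0"
  shows "norm (A (Suc M)) \<le> ((1 + real K) * ((hmax + \<nu>) / hmin) + 1) ^ K * (norm (a 1) + (\<Sum>t=1..M. norm (nh t)))"
proof -
  define L0 where "L0 = (hmax + \<nu>) / hmin"
  define L where "L = (1 + real K) * L0 + 1"
  have L0: "L0 \<ge> 0" using H \<nu> by (simp add: L0_def)
  have L: "L \<ge> 1" using L0 by (simp add: L_def)
  have "m \<le> M \<Longrightarrow> norm (a (Suc m)) + norm (A (Suc m)) \<le> L ^ m * (norm (a 1) + (\<Sum>t=1..m. norm (nh t)))" for m
  proof (induction m)
    case 0 then show ?case using A(1) by simp
  next
    case (Suc m)
    define t where "t = Suc m"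
    have t: "t \<in> {1..M}" using Suc by (simp add: t_def)
    define S where "S = norm (a t) + norm (A t) + norm (nh t)"
    have "real t * \<eta> \<le> real M * \<eta>" using t \<eta> by (intro mult_right_mono) auto
    then have a: "norm (a (Suc t)) \<le> L0 * S" unfolding L0_def S_def
      using inner_step_growth[OF H Q G \<nu> \<eta>(1) _ _ eq[OF t]] \<eta>(2) t by force
    have "norm (A (Suc t)) \<le> norm (A t) + real t * norm (a (Suc t))"
      unfolding A(2)[OF t] using norm_triangle_ineq[of "A t" "real t *\<^sub>R a (Suc t)"] by simp
    then have "norm (a (Suc t)) + norm (A (Suc t)) \<le> (1 + real t) * norm (a (Suc t)) + norm (A t)"
      by (simp add: algebra_simps)
    also have "\<dots> \<le> (1 + real K) * (L0 * S) + S"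
      using a t K by (intro add_mono mult_mono) (auto simp: S_def)
    also have "\<dots> = L * S" by (simp add: L_def algebra_simps)
    also have "\<dots> \<le> L * (L ^ m * (norm (a 1) + (\<Sum>t=1..m. norm (nh t))) + L ^ m * norm (nh t))"
    proof (intro mult_left_mono)
      have "norm (nh t) \<le> L ^ m * norm (nh t)" using L mult_right_mono[of 1 "L^m" "norm (nh t)"] by simp
      then show "S \<le> L ^ m * (norm (a 1) + (\<Sum>t=1..m. norm (nh t))) + L ^ m * norm (nh t)"
        using Suc by (simp add: S_def t_def)
    qed (use L in auto)
    finally show ?case by (simp add: t_def algebra_simps)
  qed
  from this[of M] have "norm (A (Suc M)) \<le> L ^ M * (norm (a 1) + (\<Sum>t=1..M. norm (nh t)))"
    using norm_ge_zero[of "a (Suc M)"] by linarith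
  also have "\<dots> \<le> L ^ K * (norm (a 1) + (\<Sum>t=1..M. norm (nh t)))"
    using L K by (intro mult_right_mono power_increasing) (auto intro!: add_nonneg_nonneg sum_nonneg)
  finally show ?thesis by (simp add: L_def L0_def)
qed

lemma norm_weighted_sum_sq_le:
  fixes a :: "nat \<Rightarrow> 'a::real_normed_vector"
  shows "(norm (\<Sum>t=1..M. real t *\<^sub>R a t))\<^sup>2 \<le> real M * (real M + 1) / 2 * (\<Sum>t=1..M. real t * (norm (a t))\<^sup>2)"
proof -
  have "norm (\<Sum>t=1..M. real t *\<^sub>R a t) \<le> (\<Sum>t=1..M. sqrt (real t) * (sqrt (real t) * norm (a t)))"
    by (rule order_trans[OF norm_sum]) (auto intro!: sum_mono simp: mult.assoc[symmetric])
  then have "(norm (\<Sum>t=1..M. real t *\<^sub>R a t))\<^sup>2 \<le> (\<Sum>t=1..M. sqrt (real t) * (sqrt (real t) * norm (a t)))\<^sup>2"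
    by (intro power_mono) auto
  also have "\<dots> \<le> (\<Sum>t=1..M. (sqrt (real t))\<^sup>2) * (\<Sum>t=1..M. (sqrt (real t) * norm (a t))\<^sup>2)"
    by (rule Cauchy_Schwarz_ineq_sum)
  also have "(\<Sum>t=1..M. (sqrt (real t))\<^sup>2) = real M * (real M + 1) / 2"
    by (induction M) (auto simp: field_simps)
  finally show ?thesis by (simp add: power_mult_distrib)
qed

text \<open>Bundling the data of a run into a predicate allows a constant to be fixed before the
  matrix, the step size and the length of the loop, all of which are random in the
  application.\<close>

definition inexact_prox_system ::
  "real^'n^'n \<Rightarrow> (real^'n \<Rightarrow> real^'n) \<Rightarrow> real \<Rightarrow> real^'n^'n \<Rightarrow> nat \<Rightarrow> real \<Rightarrow>
   (nat \<Rightarrow> real^'n) \<Rightarrow> (nat \<Rightarrow> real^'n) \<Rightarrow> real^'n \<Rightarrow> (nat \<Rightarrow> real^'n) \<Rightarrow> bool" where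
  "inexact_prox_system H G c1 Q M \<eta> A a u nh \<longleftrightarrow>
     (\<forall>v. c1 * (norm v)\<^sup>2 \<le> v \<bullet> (Q *v v)) \<and> M > 0 \<and> \<eta> > 0 \<and> real M * \<eta> \<le> 1 \<and>
     A 1 = 0 \<and> (\<forall>t\<in>{1..M}. A (Suc t) = A t + real t *\<^sub>R a (Suc t)) \<and>
     (\<forall>t\<in>{1..M}. (2 / (real t * \<eta>)) *\<^sub>R (H *v (a (Suc t) - a t)) + Q *v a (Suc t)
        + (G (u + (2 / (real t * (real t + 1))) *\<^sub>R (real t *\<^sub>R a t + A t) + nh t) - G u) = 0)"

text \<open>Two regimes give a constant that is uniform in \<eta> and \<open>M\<close>. If \<eta>
  \<nu> \<le> hmin, the accelerated energy applies together with Cauchy-Schwarz. Otherwise M \<eta>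
  \<le> 1 forces M \<le> \<nu> / hmin, and the exponential growth over at most \<open>K\<close>
  steps is itself a constant.\<close>

lemma inner_average_bound:
  fixes H :: "real^'n^'n" and f :: "real^'n \<Rightarrow> real"
  assumes H: "transpose H = H" "hmin > 0" "\<And>v. hmin * (norm v)\<^sup>2 \<le> v \<bullet> (H *v v)"
      "hmax > 0" "\<And>v. norm (H *v v) \<le> hmax * norm v"
    and c1: "c1 > 0"
    and G: "\<And>v. GDERIV f v :> G v" "\<And>v w. f v + G v \<bullet> (w - v) \<le> f w"
      "\<And>v w. norm (G v - G w) \<le> \<nu> * norm (v - w)"
    and \<nu>: "\<nu> > 0"
  shows "\<exists>C>0. \<forall>Q M \<eta> A a u nh. inexact_prox_system H G c1 Q M \<eta> A a u nh \<longrightarrow>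
      (norm ((2 / (real M * (real M + 1))) *\<^sub>R A (Suc M)))\<^sup>2
        \<le> C * ((norm (a 1))\<^sup>2 / (\<eta> * real M * (real M + 1)) + (\<Sum>t=1..M. real t * (norm (nh t))\<^sup>2) / (real M)\<^sup>2)"
proof -
  define K where "K = nat \<lceil>\<nu> / hmin\<rceil>"
  define L where "L = ((1 + real K) * ((hmax + \<nu>) / hmin) + 1) ^ K"
  define C1 where "C1 = 4 * hmax / c1 + 2 * \<nu>\<^sup>2 / c1\<^sup>2"
  define C2 where "C2 = L\<^sup>2 * 2 * (real K + 1) ^ 3"
  have C: "C1 > 0" "C2 \<ge> 0" using H c1 \<nu> by (auto simp: C1_def C2_def intro!: add_pos_nonneg)
  have "(norm ((2 / (real M * (real M + 1))) *\<^sub>R A (Suc M)))\<^sup>2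
        \<le> (C1 + C2) * ((norm (a 1))\<^sup>2 / (\<eta> * real M * (real M + 1)) + (\<Sum>t=1..M. real t * (norm (nh t))\<^sup>2) / (real M)\<^sup>2)"
    if sys: "inexact_prox_system H G c1 Q M \<eta> A a u nh"
    for Q M \<eta> A a u nh
  proof -
    have Q: "\<And>v. c1 * (norm v)\<^sup>2 \<le> v \<bullet> (Q *v v)" and M: "M > 0" and \<eta>: "\<eta> > 0" "real M * \<eta> \<le> 1"
      and A: "A 1 = 0" "\<And>t. t \<in> {1..M} \<Longrightarrow> A (Suc t) = A t + real t *\<^sub>R a (Suc t)"
      and eq: "\<And>t. t \<in> {1..M} \<Longrightarrow> (2 / (real t * \<eta>)) *\<^sub>R (H *v (a (Suc t) - a t)) + Q *v a (Suc t)
        + (G (u + (2 / (real t * (real t + 1))) *\<^sub>R (real t *\<^sub>R a t + A t) + nh t) - G u) = 0"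
      using sys by (auto simp: inexact_prox_system_def)
    define R1 where "R1 = (norm (a 1))\<^sup>2 / (\<eta> * real M * (real M + 1))"
    define V where "V = (\<Sum>t=1..M. real t * (norm (nh t))\<^sup>2)"
    define R2 where "R2 = V / (real M)\<^sup>2"
    have V: "V \<ge> 0" by (auto simp: V_def intro!: sum_nonneg)
    have R: "R1 \<ge> 0" "R2 \<ge> 0" using V \<eta> by (auto simp: R1_def R2_def)
    have m: "real M \<ge> 1" using M by simp
    define m where "m = real M"
    have m: "m \<ge> 1" using M by (simp add: m_def)
    have sq: "(norm ((2 / (m * (m + 1))) *\<^sub>R A (Suc M)))\<^sup>2 = 4 / (m * (m + 1))\<^sup>2 * (norm (A (Suc M)))\<^sup>2"
      using m by (simp add: power_mult_distrib power_divide)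
    have AS: "A (Suc M) = (\<Sum>t=1..M. real t *\<^sub>R a (Suc t))"
    proof -
      have "n \<le> M \<Longrightarrow> A (Suc n) = (\<Sum>t=1..n. real t *\<^sub>R a (Suc t))" for n
        by (induction n) (use A in auto)
      then show ?thesis by simp
    qed
    have "(norm ((2 / (m * (m + 1))) *\<^sub>R A (Suc M)))\<^sup>2 \<le> (C1 + C2) * (R1 + R2)"
    proof (cases "\<eta> * \<nu> \<le> hmin")
      case True
      have "c1 * (\<Sum>t=1..M. real t * (norm (a (Suc t)))\<^sup>2) \<le> (2 / \<eta>) * (a 1 \<bullet> (H *v a 1)) + \<nu>\<^sup>2 / c1 * V"
        unfolding V_def
        by (rule accelerated_energy[OF H(1-3) c1 Q G \<nu> \<eta>(1) True A eq])
      also have "a 1 \<bullet> (H *v a 1) \<le> hmax * (norm (a 1))\<^sup>2"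
        using norm_cauchy_schwarz[of "a 1" "H *v a 1"] mult_left_mono[OF H(5)[of "a 1"], of "norm (a 1)"]
        by (simp add: power2_eq_square mult_ac)
      finally have "c1 * (\<Sum>t=1..M. real t * (norm (a (Suc t)))\<^sup>2) \<le> (2 / \<eta>) * (hmax * (norm (a 1))\<^sup>2) + \<nu>\<^sup>2 / c1 * V"
        using \<eta> by (smt (verit) divide_pos_pos mult_left_mono)
      then have s: "(\<Sum>t=1..M. real t * (norm (a (Suc t)))\<^sup>2) \<le> ((2 / \<eta>) * (hmax * (norm (a 1))\<^sup>2) + \<nu>\<^sup>2 / c1 * V) / c1"
        using c1 by (simp add: field_simps)
      have "4 / (m * (m + 1))\<^sup>2 * (norm (A (Suc M)))\<^sup>2 \<le> 4 / (m * (m + 1))\<^sup>2 * (m * (m + 1) / 2 * (((2 / \<eta>) * (hmax * (norm (a 1))\<^sup>2) + \<nu>\<^sup>2 / c1 * V) / c1))"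
      proof (intro mult_left_mono)
        have "(norm (A (Suc M)))\<^sup>2 \<le> m * (m + 1) / 2 * (\<Sum>t=1..M. real t * (norm (a (Suc t)))\<^sup>2)"
          unfolding AS m_def by (rule norm_weighted_sum_sq_le)
        also have "\<dots> \<le> m * (m + 1) / 2 * (((2 / \<eta>) * (hmax * (norm (a 1))\<^sup>2) + \<nu>\<^sup>2 / c1 * V) / c1)"
          using m s by (intro mult_left_mono) auto
        finally show "(norm (A (Suc M)))\<^sup>2 \<le> \<dots>" .
      qed auto
      also have "\<dots> = 4 * hmax / c1 * R1 + 2 * \<nu>\<^sup>2 / c1\<^sup>2 * (V / (m * (m + 1)))"
      proof -
        define p where "p = m * (m + 1)"
        have p: "p > 0" using m by (simp add: p_def)
        have R1: "R1 = (norm (a 1))\<^sup>2 / (\<eta> * p)" by (simp add: R1_def p_def m_def mult.assoc)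
        show ?thesis unfolding p_def[symmetric] R1
          using p c1 \<eta> by (simp add: field_simps power2_eq_square)
      qed
      also have "\<dots> \<le> 4 * hmax / c1 * R1 + 2 * \<nu>\<^sup>2 / c1\<^sup>2 * R2"
      proof -
        have "V / (m * (m + 1)) \<le> R2"
          unfolding R2_def m_def[symmetric] using V m by (intro divide_left_mono) (auto simp: power2_eq_square)
        then show ?thesis using c1 by (intro add_left_mono mult_left_mono) auto
      qed
      also have "\<dots> \<le> C1 * (R1 + R2)"
      proof -
        have "0 \<le> 4 * hmax / c1 * R2" "0 \<le> 2 * \<nu>\<^sup>2 / c1\<^sup>2 * R1" using R H c1 by simp_all
        then show ?thesis unfolding C1_def distrib_left distrib_right by linarith
      qed
      also have "\<dots> \<le> (C1 + C2) * (R1 + R2)"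
        using R C by (intro mult_right_mono) auto
      finally show ?thesis unfolding sq .
    next
      case False
      then have "hmin / \<nu> < \<eta>" using \<nu> by (simp add: field_simps)
      then have "real M * (hmin / \<nu>) < 1" using \<eta>(2) M by (smt (verit) mult_strict_left_mono of_nat_0_less_iff)
      then have "real M \<le> \<nu> / hmin" using H \<nu> by (simp add: field_simps)
      then have MK: "M \<le> K" unfolding K_def by linarith
      then have mK: "m \<le> real K" by (simp add: m_def)
      have "norm (A (Suc M)) \<le> L * (norm (a 1) + (\<Sum>t=1..M. norm (nh t)))"
        unfolding L_def
        by (rule inner_growth[OF H(2-5) _ G(3) \<nu> \<eta> MK A eq])
           (use Q c1 in \<open>smt (verit) mult_nonneg_nonneg zero_le_power2\<close>)
      then have "(norm (A (Suc M)))\<^sup>2 \<le> (L * (norm (a 1) + (\<Sum>t=1..M. norm (nh t))))\<^sup>2"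
        by (intro power_mono) auto
      also have "\<dots> = L\<^sup>2 * (norm (a 1) + (\<Sum>t=1..M. norm (nh t)))\<^sup>2" by (rule power_mult_distrib)
      also have "(norm (a 1) + (\<Sum>t=1..M. norm (nh t)))\<^sup>2 \<le> 2 * ((norm (a 1))\<^sup>2 + (\<Sum>t=1..M. norm (nh t))\<^sup>2)"
        using sum_squares_bound[of "norm (a 1)" "\<Sum>t=1..M. norm (nh t)"] by (simp add: power2_eq_square algebra_simps)
      also have "(\<Sum>t=1..M. norm (nh t))\<^sup>2 \<le> m * V"
      proof -
        have "(\<Sum>t=1..M. norm (nh t))\<^sup>2 = (\<Sum>t=1..M. 1 * norm (nh t))\<^sup>2" by simp
        also have "\<dots> \<le> (\<Sum>t=1..M. 1\<^sup>2) * (\<Sum>t=1..M. (norm (nh t))\<^sup>2)" by (rule Cauchy_Schwarz_ineq_sum)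
        also have "\<dots> \<le> m * V" unfolding V_def m_def
        proof (simp, intro mult_left_mono sum_mono)
          fix t assume "t \<in> {Suc 0..M}"
          then show "(norm (nh t))\<^sup>2 \<le> real t * (norm (nh t))\<^sup>2"
            using mult_right_mono[of 1 "real t" "(norm (nh t))\<^sup>2"] by simp
        qed auto
        finally show ?thesis .
      qed
      \<comment> \<open>Since M \<le> K and M \<eta> \<le> 1, the denominators in \<open>R1\<close>
        and \<open>R2\<close> are at most (K + 1)^3 up to the factor already present, so they can be
        cleared; the cube serves for both terms.\<close>
      also have "(norm (a 1))\<^sup>2 \<le> (real K + 1) ^ 3 * R1"
      proof -
        have "\<eta> * m * (m + 1) \<le> 1 * (real K + 1)"
          using \<eta> mK m by (intro mult_mono) (auto simp: m_def mult.commute)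
        also have "\<dots> \<le> (real K + 1) ^ 3" by (simp add: self_le_power)
        finally have "\<eta> * m * (m + 1) * R1 \<le> (real K + 1) ^ 3 * R1" using R by (intro mult_right_mono) auto
        then show ?thesis using \<eta> m by (simp add: R1_def m_def[symmetric])
      qed
      also have "m * V \<le> (real K + 1) ^ 3 * R2"
      proof -
        have "m * V = m ^ 3 * R2" using m by (simp add: R2_def m_def[symmetric] power3_eq_cube power2_eq_square)
        also have "\<dots> \<le> (real K + 1) ^ 3 * R2" using m mK R by (intro mult_right_mono power_mono) auto
        finally show ?thesis .
      qed
      finally have "(norm (A (Suc M)))\<^sup>2 \<le> L\<^sup>2 * (2 * ((real K + 1) ^ 3 * R1 + (real K + 1) ^ 3 * R2))"
        by (simp add: mult_left_mono)
      also have "\<dots> = C2 * (R1 + R2)" by (simp add: C2_def algebra_simps)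
      finally have A2: "(norm (A (Suc M)))\<^sup>2 \<le> C2 * (R1 + R2)" .
      have "2 \<le> m * (m + 1)" using m mult_mono[of 1 m 2 "m + 1"] by simp
      then have "2\<^sup>2 \<le> (m * (m + 1))\<^sup>2" by (intro power_mono) auto
      then have "4 / (m * (m + 1))\<^sup>2 \<le> 1" using m by (simp add: divide_le_eq)
      then have "4 / (m * (m + 1))\<^sup>2 * (norm (A (Suc M)))\<^sup>2 \<le> 1 * (norm (A (Suc M)))\<^sup>2"
        by (intro mult_right_mono) auto
      also have "\<dots> \<le> (C1 + C2) * (R1 + R2)"
        using A2 C R by (smt (verit) add_nonneg_nonneg mult_right_mono)
      finally show ?thesis unfolding sq .
    qed
    then show ?thesis by (simp add: R1_def R2_def V_def m_def)
  qed
  moreover have "C1 + C2 > 0" using C by simp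
  ultimately show ?thesis by blast
qed

section \<open>Separating the linear response to the noise from the inner iterates\<close>

lemma norm_add_sq_le: "(norm (x + y :: 'a::real_normed_vector))\<^sup>2 \<le> 2 * (norm x)\<^sup>2 + 2 * (norm y)\<^sup>2"
proof -
  have "(norm (x + y))\<^sup>2 \<le> (norm x + norm y)\<^sup>2" by (intro power_mono norm_triangle_ineq) auto
  also have "\<dots> \<le> 2 * (norm x)\<^sup>2 + 2 * (norm y)\<^sup>2"
    using sum_squares_bound[of "norm x" "norm y"] by (simp add: power2_eq_square algebra_simps)
  finally show ?thesis .
qed

lemma coercive_norm_le:
  fixes Q :: "real^'n^'n"
  assumes "c > 0" "\<And>v. c * (norm v)\<^sup>2 \<le> v \<bullet> (Q *v v)"
  shows "norm v \<le> norm (Q *v v) / c"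
proof (cases "v = 0")
  case False
  have "c * (norm v)\<^sup>2 \<le> norm v * norm (Q *v v)" using assms(2) norm_cauchy_schwarz order_trans by blast
  then have "c * norm v \<le> norm (Q *v v)" using False by (simp add: power2_eq_square)
  then show ?thesis using assms(1) by (simp add: field_simps)
qed simp

text \<open>Stated for reals and applied coordinatewise, so that field arithmetic suffices.
  \<open>A\<close> and \<open>C\<close> are the weighted sums of the noise-free and of the noise
  part. The multiplied form of \<open>avg\<close> stays meaningful at t = 1, where it only says A +
  C = 0.\<close>

lemma averaged_iterate_identities:
  fixes t xi xb xh xi' xb' u n n' A C :: real
  assumes t: "t \<ge> 1"
    and avg: "((t - 1) * t) * (xi - u) = 2 * (A + C)"
    and xh: "xh = (2 / (t + 1)) * xb + (1 - 2 / (t + 1)) * xi"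
    and xi': "xi' = (2 / (t + 1)) * xb' + (1 - 2 / (t + 1)) * xi"
  shows "xh = u + (2 / (t * (t + 1))) * (t * (xb - n - u) + A) + (2 / (t * (t + 1))) * (t * n + C)"
    "(t * (t + 1)) * (xi' - u) = 2 * ((A + t * (xb' - n' - u)) + (C + t * n'))"
proof -
  define c where "c = 2 / (t + 1)"
  define d where "d = 1 - c"
  define r where "r = 2 / (t * (t + 1))"
  have rt: "r * t = c" "t * (t + 1) * c = 2 * t" "t * (t + 1) * d = (t - 1) * t" "r * (t * (t + 1)) = 2"
  proof -
    have ne: "t \<noteq> 0" "t + 1 \<noteq> 0" using t by auto
    show "r * t = c" "r * (t * (t + 1)) = 2" using ne by (simp_all add: r_def c_def)
    show tc: "t * (t + 1) * c = 2 * t" using ne by (simp add: c_def)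
    have "t * (t + 1) * d = t * (t + 1) - t * (t + 1) * c" by (simp add: d_def right_diff_distrib)
    then show "t * (t + 1) * d = (t - 1) * t" unfolding tc by (simp add: algebra_simps)
  qed
  have "r * (2 * (A + C)) = (r * (t * (t + 1))) * (d * (xi - u))"
    unfolding avg[symmetric] rt(3)[symmetric] by simp
  then have rAC: "r * (A + C) = d * (xi - u)" unfolding rt(4) by (simp add: mult.left_commute[of r] distrib_left[of r])
  have "u + r * (t * (xb - n - u) + A) + r * (t * n + C) = u + (r * t) * (xb - u) + r * (A + C)"
    by (simp add: algebra_simps)
  also have "\<dots> = c * xb + d * xi" unfolding rt rAC by (simp add: d_def algebra_simps)
  finally show "xh = u + (2 / (t * (t + 1))) * (t * (xb - n - u) + A) + (2 / (t * (t + 1))) * (t * n + C)"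
    unfolding r_def[symmetric] xh c_def[symmetric] d_def[symmetric] by simp
  have "(t * (t + 1)) * (xi' - u) = (t * (t + 1) * c) * (xb' - u) + (t * (t + 1) * d) * (xi - u)"
    unfolding xi' c_def[symmetric] d_def by (simp add: algebra_simps)
  also have "\<dots> = 2 * ((A + t * (xb' - n' - u)) + (C + t * n'))"
    unfolding rt avg by (simp add: algebra_simps)
  finally show "(t * (t + 1)) * (xi' - u) = 2 * ((A + t * (xb' - n' - u)) + (C + t * n'))" .
qed

definition inner_run ::
  "real^'n^'n \<Rightarrow> (real^'n \<Rightarrow> real^'n) \<Rightarrow> real \<Rightarrow> real^'n^'n \<Rightarrow> nat \<Rightarrow> real \<Rightarrow> (nat \<Rightarrow> real^'n) \<Rightarrow>
   (nat \<Rightarrow> real^'n) \<Rightarrow> (nat \<Rightarrow> real^'n) \<Rightarrow> (nat \<Rightarrow> real^'n) \<Rightarrow> real^'n \<Rightarrow> real^'n \<Rightarrow> bool" where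
  "inner_run H G c1 Q M \<eta> xb xin xhat \<delta> xk h \<longleftrightarrow>
     (\<forall>v. c1 * (norm v)\<^sup>2 \<le> v \<bullet> (Q *v v)) \<and> M > 0 \<and> \<eta> > 0 \<and> real M * \<eta> \<le> 1 \<and>
     (\<forall>t\<in>{1..M}.
        xhat t = (2 / (real t + 1)) *\<^sub>R xb t + (1 - 2 / (real t + 1)) *\<^sub>R xin t \<and>
        (2 / (real t * \<eta>)) *\<^sub>R (H *v (xb (Suc t) - xb t)) + Q *v (xb (Suc t) - xk) + h
          + (G (xhat t) - \<delta> t) = 0 \<and>
        xin (Suc t) = (2 / (real t + 1)) *\<^sub>R xb (Suc t) + (1 - 2 / (real t + 1)) *\<^sub>R xin t)"

text \<open>The part of the inner iterates that is linear in the noise: \<open>\<eta> *\<^sub>R U t\<close> is the response of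
  \<open>xb t\<close> to \<open>\<delta>\<close>.  Since \<open>t \<gamma>\<^sub>t = 2 / \<eta>\<close> does not depend on \<open>t\<close>, summation by parts expresses
  its \<open>t\<close>-weighted average through \<open>S t - 2 H U t\<close>.\<close>

definition noise_run ::
  "real^'n^'n \<Rightarrow> real^'n^'n \<Rightarrow> nat \<Rightarrow> real \<Rightarrow> (nat \<Rightarrow> real^'n) \<Rightarrow> (nat \<Rightarrow> real^'n) \<Rightarrow> (nat \<Rightarrow> real^'n) \<Rightarrow> bool" where
  "noise_run H Q M \<eta> \<delta> S U \<longleftrightarrow> S 1 = 0 \<and> U 1 = 0 \<and>
     (\<forall>t\<in>{1..M}. S (Suc t) = S t + real t *\<^sub>R \<delta> t \<and>
        2 *\<^sub>R (H *v U (Suc t)) + (real t * \<eta>) *\<^sub>R (Q *v U (Suc t)) = 2 *\<^sub>R (H *v U t) + real t *\<^sub>R \<delta> t)"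

text \<open>Removing the noise response \<open>n t\<close> from the prox sequence leaves a sequence
  that satisfies the accelerated scheme with no noise in the equation. The only trace is that the
  gradient is evaluated at a point shifted by \<open>nh t\<close>, the noise part of the
  extrapolated point. The noise part of the final average is added back separately and gives the
  last term.\<close>

lemma inner_loop_error:
  fixes H :: "real^'n^'n" and f :: "real^'n \<Rightarrow> real"
  assumes H: "transpose H = H" "hmin > 0" "\<And>v. hmin * (norm v)\<^sup>2 \<le> v \<bullet> (H *v v)"
      "hmax > 0" "\<And>v. norm (H *v v) \<le> hmax * norm v"
    and c1: "c1 > 0"
    and G: "\<And>v. GDERIV f v :> G v" "\<And>v w. f v + G v \<bullet> (w - v) \<le> f w"
      "\<And>v w. norm (G v - G w) \<le> \<nu> * norm (v - w)"
    and \<nu>: "\<nu> > 0"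
  shows "\<exists>C>0. \<forall>Q M \<eta> xb xin xhat \<delta> xk h u S U.
      inner_run H G c1 Q M \<eta> xb xin xhat \<delta> xk h \<longrightarrow> noise_run H Q M \<eta> \<delta> S U \<longrightarrow>
      G u + Q *v (u - xk) + h = 0 \<longrightarrow>
      (norm (xin (Suc M) - u))\<^sup>2 \<le> C * ((norm (xb 1 - u))\<^sup>2 / (\<eta> * real M * (real M + 1))
         + (\<Sum>t=1..M. ((norm (S t))\<^sup>2 + (norm (U t))\<^sup>2) / real t ^ 3) / (real M)\<^sup>2
         + ((norm (S (Suc M)))\<^sup>2 + (norm (U (Suc M)))\<^sup>2) / real M ^ 4)"
proof -
  obtain C0 where C0: "C0 > 0"
    "\<And>Q M \<eta> A a u nh. inexact_prox_system H G c1 Q M \<eta> A a u nh \<Longrightarrow>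
      (norm ((2 / (real M * (real M + 1))) *\<^sub>R A (Suc M)))\<^sup>2
        \<le> C0 * ((norm (a 1))\<^sup>2 / (\<eta> * real M * (real M + 1)) + (\<Sum>t=1..M. real t * (norm (nh t))\<^sup>2) / (real M)\<^sup>2)"
    using inner_average_bound[OF H c1 G \<nu>] by blast
  \<comment> \<open>The 1 pays for \<open>U t\<close> itself, the fraction for the bound of the
    weighted noise sum \<open>Cc t\<close> by the norms of \<open>S t\<close> and
    \<open>U t\<close>.\<close>
  define k where "k = 1 + (1 + 2 * hmax) / c1"
  have k: "k > 0" using H c1 by (auto simp: k_def intro!: add_pos_nonneg)
  define K where "K = 8 * k\<^sup>2"
  have K: "K > 0" using k by (simp add: K_def)
  define C where "C = 2 * C0 + 2 * C0 * K + 2 * K"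
  have "C > 0" unfolding C_def using C0(1) K by (intro add_pos_pos mult_pos_pos) auto
  moreover have "(norm (xin (Suc M) - u))\<^sup>2 \<le> C * ((norm (xb 1 - u))\<^sup>2 / (\<eta> * real M * (real M + 1))
         + (\<Sum>t=1..M. ((norm (S t))\<^sup>2 + (norm (U t))\<^sup>2) / real t ^ 3) / (real M)\<^sup>2
         + ((norm (S (Suc M)))\<^sup>2 + (norm (U (Suc M)))\<^sup>2) / real M ^ 4)"
    if run: "inner_run H G c1 Q M \<eta> xb xin xhat \<delta> xk h" and noise: "noise_run H Q M \<eta> \<delta> S U"
      and u: "G u + Q *v (u - xk) + h = 0"
    for Q M \<eta> xb xin xhat \<delta> xk h u S U
  proof -
    have Q: "\<And>v. c1 * (norm v)\<^sup>2 \<le> v \<bullet> (Q *v v)" and M: "M > 0" and \<eta>: "\<eta> > 0" "real M * \<eta> \<le> 1"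
      and S1: "S 1 = 0" and U1: "U 1 = 0"
      and S: "\<And>t. t \<in> {1..M} \<Longrightarrow> S (Suc t) = S t + real t *\<^sub>R \<delta> t"
      and U: "\<And>t. t \<in> {1..M} \<Longrightarrow> 2 *\<^sub>R (H *v U (Suc t)) + (real t * \<eta>) *\<^sub>R (Q *v U (Suc t))
          = 2 *\<^sub>R (H *v U t) + real t *\<^sub>R \<delta> t"
      and xhat: "\<And>t. t \<in> {1..M} \<Longrightarrow> xhat t = (2 / (real t + 1)) *\<^sub>R xb t + (1 - 2 / (real t + 1)) *\<^sub>R xin t"
      and xb: "\<And>t. t \<in> {1..M} \<Longrightarrow> (2 / (real t * \<eta>)) *\<^sub>R (H *v (xb (Suc t) - xb t)) + Q *v (xb (Suc t) - xk) + h
          + (G (xhat t) - \<delta> t) = 0"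
      and xin: "\<And>t. t \<in> {1..M} \<Longrightarrow> xin (Suc t) = (2 / (real t + 1)) *\<^sub>R xb (Suc t) + (1 - 2 / (real t + 1)) *\<^sub>R xin t"
      using run noise unfolding inner_run_def noise_run_def by blast+
    define W where "W t = (norm (S t))\<^sup>2 + (norm (U t))\<^sup>2" for t
    define n where "n t = \<eta> *\<^sub>R U t" for t
    define a where "a t = xb t - n t - u" for t
    define A where "A t = (\<Sum>j=1..<t. real j *\<^sub>R a (Suc j))" for t
    define Cc where "Cc t = (\<Sum>j=1..<t. real j *\<^sub>R n (Suc j))" for t
    define nh where "nh t = (2 / (real t * (real t + 1))) *\<^sub>R (real t *\<^sub>R n t + Cc t)" for t
    have A1: "A 1 = 0" and C1: "Cc 1 = 0" and n1: "n 1 = 0" using U1 by (auto simp: A_def Cc_def n_def)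
    have AS: "A (Suc t) = A t + real t *\<^sub>R a (Suc t)" and CS: "Cc (Suc t) = Cc t + real t *\<^sub>R n (Suc t)"
      if "t \<in> {1..M}" for t using that by (auto simp: A_def Cc_def)
    have avg: "((real (Suc m) - 1) * real (Suc m)) *\<^sub>R (xin (Suc m) - u) = 2 *\<^sub>R (A (Suc m) + Cc (Suc m))"
      if "m \<le> M" for m using that
    proof (induction m)
      case 0 then show ?case using A1 C1 by simp
    next
      case (Suc m)
      let ?t = "Suc m"
      have t: "?t \<in> {1..M}" using Suc by simp
      have IH: "((real ?t - 1) * real ?t) *\<^sub>R (xin ?t - u) = 2 *\<^sub>R (A ?t + Cc ?t)" using Suc by simp
      have "(real ?t * (real ?t + 1)) * ((xin (Suc ?t) - u) $ i)
          = 2 * ((A ?t $ i + real ?t * (xb (Suc ?t) $ i - n (Suc ?t) $ i - u $ i)) + (Cc ?t $ i + real ?t * n (Suc ?t) $ i))" for i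
        using averaged_iterate_identities(2)[of "real ?t" "xin ?t $ i" "u $ i" "A ?t $ i" "Cc ?t $ i" _ _ "xin (Suc ?t) $ i" "xb (Suc ?t) $ i" "n (Suc ?t) $ i"]
          arg_cong[OF IH, of "\<lambda>v. v $ i"] xin[OF t] by simp
      then have "(real ?t * (real ?t + 1)) *\<^sub>R (xin (Suc ?t) - u)
          = 2 *\<^sub>R ((A ?t + real ?t *\<^sub>R (xb (Suc ?t) - n (Suc ?t) - u)) + (Cc ?t + real ?t *\<^sub>R n (Suc ?t)))"
        unfolding vec_eq_iff by simp
      then show ?case unfolding AS[OF t] CS[OF t] a_def by (simp add: mult.commute add.commute)
    qed
    have xhat': "xhat t = u + (2 / (real t * (real t + 1))) *\<^sub>R (real t *\<^sub>R a t + A t) + nh t" if t: "t \<in> {1..M}" for t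
    proof -
      obtain m where m: "t = Suc m" "m \<le> M" using t by (cases t) auto
      have IH: "((real t - 1) * real t) *\<^sub>R (xin t - u) = 2 *\<^sub>R (A t + Cc t)" using avg[OF m(2)] m(1) by simp
      have "xhat t $ i = u $ i + (2 / (real t * (real t + 1))) * (real t * (xb t $ i - n t $ i - u $ i) + A t $ i)
          + (2 / (real t * (real t + 1))) * (real t * n t $ i + Cc t $ i)" for i
        using averaged_iterate_identities(1)[of "real t" "xin t $ i" "u $ i" "A t $ i" "Cc t $ i" "xhat t $ i" "xb t $ i" _ _ "n t $ i"]
          arg_cong[OF IH, of "\<lambda>v. v $ i"] xhat[OF t] t by simp
      then show ?thesis by (simp add: vec_eq_iff nh_def a_def)
    qed
    have aeq: "(2 / (real t * \<eta>)) *\<^sub>R (H *v (a (Suc t) - a t)) + Q *v a (Suc t)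
        + (G (u + (2 / (real t * (real t + 1))) *\<^sub>R (real t *\<^sub>R a t + A t) + nh t) - G u) = 0" if t: "t \<in> {1..M}" for t
    proof -
      have t0: "real t > 0" using t by simp
      have "(1 / real t) *\<^sub>R (2 *\<^sub>R (H *v U (Suc t)) + (real t * \<eta>) *\<^sub>R (Q *v U (Suc t)) - 2 *\<^sub>R (H *v U t)) = \<delta> t"
        using t0 unfolding U[OF t] by simp
      moreover have "(1 / real t) *\<^sub>R (2 *\<^sub>R (H *v U (Suc t)) + (real t * \<eta>) *\<^sub>R (Q *v U (Suc t)) - 2 *\<^sub>R (H *v U t))
          = (2 / (real t * \<eta>)) *\<^sub>R (H *v (n (Suc t) - n t)) + Q *v n (Suc t)"
        using t0 \<eta> by (simp add: n_def matrix_vector_mult_diff_distrib matrix_vector_mult_scaleR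
            scaleR_add_right scaleR_diff_right)
      ultimately have neq: "(2 / (real t * \<eta>)) *\<^sub>R (H *v (n (Suc t) - n t)) + Q *v n (Suc t) = \<delta> t" by simp
      have e1: "a (Suc t) - a t = (xb (Suc t) - xb t) - (n (Suc t) - n t)" by (simp add: a_def)
      have e2: "Q *v a (Suc t) = Q *v (xb (Suc t) - xk) - Q *v n (Suc t) - Q *v (u - xk)"
        by (simp add: a_def matrix_vector_mult_diff_distrib)
      have Gu: "G u = - (Q *v (u - xk) + h)" using u unfolding eq_neg_iff_add_eq_0 by (simp only: add.assoc)
      have "(2 / (real t * \<eta>)) *\<^sub>R (H *v (a (Suc t) - a t)) + Q *v a (Suc t) + (G (xhat t) - G u)
         = ((2 / (real t * \<eta>)) *\<^sub>R (H *v (xb (Suc t) - xb t)) + Q *v (xb (Suc t) - xk) + h + (G (xhat t) - \<delta> t))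
           - ((2 / (real t * \<eta>)) *\<^sub>R (H *v (n (Suc t) - n t)) + Q *v n (Suc t) - \<delta> t)"
        unfolding e1 e2 Gu matrix_vector_mult_diff_distrib[of H "xb (Suc t) - xb t"] scaleR_diff_right by simp
      also have "\<dots> = 0" unfolding xb[OF t] neq by simp
      finally show ?thesis unfolding xhat'[OF t] .
    qed
    have QC: "Q *v Cc (Suc m) = S (Suc m) - 2 *\<^sub>R (H *v U (Suc m))" if "m \<le> M" for m using that
    proof (induction m)
      case 0 then show ?case using S1 U1 C1 by simp
    next
      case (Suc m)
      then have t: "Suc m \<in> {1..M}" by simp
      have "Q *v Cc (Suc (Suc m)) = Q *v Cc (Suc m) + (real (Suc m) * \<eta>) *\<^sub>R (Q *v U (Suc (Suc m)))"
        unfolding CS[OF t] n_def by (simp add: matrix_vector_right_distrib matrix_vector_mult_scaleR)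
      also have "(real (Suc m) * \<eta>) *\<^sub>R (Q *v U (Suc (Suc m)))
          = (2 *\<^sub>R (H *v U (Suc (Suc m))) + (real (Suc m) * \<eta>) *\<^sub>R (Q *v U (Suc (Suc m)))) - 2 *\<^sub>R (H *v U (Suc (Suc m)))"
        by (rule add_diff_cancel_left'[symmetric])
      also have "Q *v Cc (Suc m) + \<dots> = S (Suc m) - 2 *\<^sub>R (H *v U (Suc m)) + (2 *\<^sub>R (H *v U (Suc m)) + real (Suc m) *\<^sub>R \<delta> (Suc m) - 2 *\<^sub>R (H *v U (Suc (Suc m))))"
        unfolding U[OF t] using Suc by simp
      also have "\<dots> = S (Suc (Suc m)) - 2 *\<^sub>R (H *v U (Suc (Suc m)))" unfolding S[OF t] by simp
      finally show ?case .
    qed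
    \<comment> \<open>Coercivity of \<open>Q\<close> turns the identity for \<open>Q *v Cc\<close>
      into a norm bound that contains neither \<eta> nor t, so the prefactor 2 / (t (t + 1)) of
      \<open>nh t\<close> is pure gain.\<close>
    have Cn: "norm (U t) + norm (Cc t) \<le> k * (norm (S t) + norm (U t))" if t: "t \<in> {1..Suc M}" for t
    proof -
      obtain m where m: "t = Suc m" "m \<le> M" using t by (cases t) auto
      have "norm (Cc t) \<le> norm (Q *v Cc t) / c1" by (rule coercive_norm_le[OF c1 Q])
      also have "norm (Q *v Cc t) \<le> norm (S t) + 2 * norm (H *v U t)"
        using QC[OF m(2)] m(1) norm_triangle_ineq4[of "S t" "2 *\<^sub>R (H *v U t)"] by simp
      also have "\<dots> \<le> norm (S t) + 2 * (hmax * norm (U t))" using H(5)[of "U t"] by simp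
      also have "\<dots> \<le> (1 + 2 * hmax) * (norm (S t) + norm (U t))"
        using H(4) by (simp add: algebra_simps)
      finally have "norm (Cc t) \<le> (1 + 2 * hmax) / c1 * (norm (S t) + norm (U t))"
        using c1 by (simp add: divide_right_mono)
      then show ?thesis unfolding k_def by (simp add: distrib_right) (smt (verit) norm_ge_zero)
    qed
    have bound: "(norm ((2 / (real t * (real t + 1))) *\<^sub>R v))\<^sup>2 \<le> K * (W j / real t ^ 4)"
      if t: "t \<ge> 1" and v: "norm v \<le> k * (norm (S j) + norm (U j))" for t j v
    proof -
      have "norm ((2 / (real t * (real t + 1))) *\<^sub>R v) = 2 / (real t * (real t + 1)) * norm v" using t by simp
      also have "\<dots> \<le> 2 / (real t)\<^sup>2 * (k * (norm (S j) + norm (U j)))"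
        using t v by (intro mult_mono divide_left_mono) (auto simp: power2_eq_square)
      finally have "(norm ((2 / (real t * (real t + 1))) *\<^sub>R v))\<^sup>2 \<le> (2 / (real t)\<^sup>2 * (k * (norm (S j) + norm (U j))))\<^sup>2"
        by (intro power_mono) auto
      also have "\<dots> = 4 * k\<^sup>2 / real t ^ 4 * (norm (S j) + norm (U j))\<^sup>2"
        by (simp add: power_mult_distrib power_divide)
      also have "\<dots> \<le> 4 * k\<^sup>2 / real t ^ 4 * (2 * W j)"
        using sum_squares_bound[of "norm (S j)" "norm (U j)"]
        by (intro mult_left_mono) (auto simp: W_def power2_eq_square algebra_simps)
      finally show ?thesis by (simp add: K_def)
    qed
    have nhb: "(norm (nh t))\<^sup>2 \<le> K * (W t / real t ^ 4)" if t: "t \<in> {1..M}" for t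
      unfolding nh_def
    proof (rule bound)
      have "real t * \<eta> \<le> real M * \<eta>" using t \<eta> by (intro mult_right_mono) auto
      then have "real t * \<eta> \<le> 1" using \<eta>(2) by linarith
      then have "(real t * \<eta>) * norm (U t) \<le> 1 * norm (U t)" by (intro mult_right_mono) auto
      then have "norm (real t *\<^sub>R n t + Cc t) \<le> norm (U t) + norm (Cc t)"
        using norm_triangle_ineq[of "real t *\<^sub>R n t" "Cc t"] \<eta>(1) by (simp add: n_def)
      also have "\<dots> \<le> k * (norm (S t) + norm (U t))" using t by (intro Cn) auto
      finally show "norm (real t *\<^sub>R n t + Cc t) \<le> k * (norm (S t) + norm (U t))" .
    qed (use t in auto)
    have "(\<Sum>t=1..M. real t * (norm (nh t))\<^sup>2) \<le> (\<Sum>t=1..M. K * (W t / real t ^ 3))"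
    proof (rule sum_mono)
      fix t assume t: "t \<in> {1..M}"
      then have "real t * (norm (nh t))\<^sup>2 \<le> real t * (K * (W t / real t ^ 4))"
        using nhb by (intro mult_left_mono) auto
      also have "\<dots> = K * (W t / real t ^ 3)" using t by (simp add: power_def numeral_eq_Suc)
      finally show "real t * (norm (nh t))\<^sup>2 \<le> K * (W t / real t ^ 3)" .
    qed
    then have nhs: "(\<Sum>t=1..M. real t * (norm (nh t))\<^sup>2) \<le> K * (\<Sum>t=1..M. W t / real t ^ 3)"
      by (simp add: sum_distrib_left)
    define R1 where "R1 = (norm (xb 1 - u))\<^sup>2 / (\<eta> * real M * (real M + 1))"
    define R2 where "R2 = (\<Sum>t=1..M. W t / real t ^ 3) / (real M)\<^sup>2"
    define R3 where "R3 = W (Suc M) / real M ^ 4"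
    have R: "R1 \<ge> 0" "R2 \<ge> 0" "R3 \<ge> 0" using \<eta>(1)
      by (auto simp: R1_def R2_def R3_def W_def intro!: divide_nonneg_nonneg sum_nonneg add_nonneg_nonneg)
    have "(norm ((2 / (real M * (real M + 1))) *\<^sub>R A (Suc M)))\<^sup>2
        \<le> C0 * ((norm (a 1))\<^sup>2 / (\<eta> * real M * (real M + 1)) + (\<Sum>t=1..M. real t * (norm (nh t))\<^sup>2) / (real M)\<^sup>2)"
      by (rule C0(2)[of Q M \<eta> A a u nh]) (use Q M \<eta> A1 AS aeq in \<open>auto simp: inexact_prox_system_def\<close>)
    also have "\<dots> \<le> C0 * (R1 + K * R2)"
    proof (intro mult_left_mono add_mono)
      show "(norm (a 1))\<^sup>2 / (\<eta> * real M * (real M + 1)) \<le> R1" using n1 by (simp add: a_def R1_def)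
      show "(\<Sum>t=1..M. real t * (norm (nh t))\<^sup>2) / (real M)\<^sup>2 \<le> K * R2"
        using divide_right_mono[OF nhs, of "(real M)\<^sup>2"] by (simp add: R2_def)
    qed (use C0 in auto)
    finally have 1: "(norm ((2 / (real M * (real M + 1))) *\<^sub>R A (Suc M)))\<^sup>2 \<le> C0 * (R1 + K * R2)" .
    have 2: "(norm ((2 / (real M * (real M + 1))) *\<^sub>R Cc (Suc M)))\<^sup>2 \<le> K * R3"
      unfolding R3_def using M by (intro bound order_trans[OF _ Cn[of "Suc M"]]) auto
    have "xin (Suc M) - u = (1 / (real M * (real M + 1))) *\<^sub>R ((real M * (real M + 1)) *\<^sub>R (xin (Suc M) - u))"
      using M by simp
    also have "(real M * (real M + 1)) *\<^sub>R (xin (Suc M) - u) = 2 *\<^sub>R (A (Suc M) + Cc (Suc M))"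
      using avg[of M] by (simp add: add.commute mult.commute)
    finally have "xin (Suc M) - u = (2 / (real M * (real M + 1))) *\<^sub>R A (Suc M) + (2 / (real M * (real M + 1))) *\<^sub>R Cc (Suc M)"
      by (simp add: scaleR_add_right)
    then have "(norm (xin (Suc M) - u))\<^sup>2 \<le> 2 * (C0 * (R1 + K * R2)) + 2 * (K * R3)"
      using norm_add_sq_le[of "(2 / (real M * (real M + 1))) *\<^sub>R A (Suc M)" "(2 / (real M * (real M + 1))) *\<^sub>R Cc (Suc M)"] 1 2
      by simp
    also have "\<dots> = 2 * C0 * R1 + 2 * C0 * K * R2 + 2 * K * R3" by (simp add: algebra_simps)
    also have "\<dots> \<le> C * R1 + C * R2 + C * R3"
      using R C0(1) K by (intro add_mono mult_right_mono) (auto simp: C_def)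
    finally show ?thesis by (simp add: R1_def R2_def R3_def W_def algebra_simps)
  qed
  ultimately show ?thesis by blast
qed

section \<open>Contraction of one proximal ADMM step\<close>

text \<open>Both optimality conditions are tested with the primal errors \<open>p'\<close> and
  \<open>q'\<close> and added; \<mu> is the multiplier error, \<open>r\<close> the constraint
  residual, \<open>w\<close> the error of the x-step. The only indefinite term is the product of
  \<open>B *v (q' - q)\<close> with \<open>r'\<close>. By \<open>mono\<close> it is at most the
  product with (1 - s) r, and Young's inequality distributes that between a fraction \<rho> of |B
  (q' - q)|^2 and the old residual, which the Lyapunov function carries with weight
  \<omega>.\<close>

lemma admm_energy:
  fixes A :: "real^'p^'n" and B :: "real^'q^'n" and D :: "real^'p^'p"
  assumes \<beta>: "\<beta> > 0" and s: "s > 0" and \<alpha>: "\<alpha> > 0" and \<rho>: "\<rho> \<ge> 0" "\<omega> > 0" "(1 - s)\<^sup>2 \<le> \<rho> * \<omega>"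
    and D: "transpose D = D"
    and gf: "gf = transpose A *v (\<mu> - \<beta> *\<^sub>R r' + \<beta> *\<^sub>R (B *v (q' - q))) - D *v (p' - p) + w"
    and gg: "gg = transpose B *v (\<mu> - \<beta> *\<^sub>R r')"
    and r': "r' = A *v p' + B *v q'"
    and mono: "0 \<le> (B *v (q' - q)) \<bullet> ((1 - s) *\<^sub>R r - r')"
    and sf: "\<alpha> * (norm p')\<^sup>2 \<le> gf \<bullet> p'" and sg: "\<alpha> * (norm q')\<^sup>2 \<le> gg \<bullet> q'"
  shows "\<alpha> * (norm p')\<^sup>2 + 2 * \<alpha> * (norm q')\<^sup>2 + p' \<bullet> (D *v p') + (p' - p) \<bullet> (D *v (p' - p)) + \<beta> * (norm (B *v q'))\<^sup>2
      + (norm (\<mu> - (s * \<beta>) *\<^sub>R r'))\<^sup>2 / (s * \<beta>) + \<beta> * (1 - \<rho>) * (norm (B *v (q' - q)))\<^sup>2 + \<beta> * (2 - s) * (norm r')\<^sup>2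
    \<le> p \<bullet> (D *v p) + \<beta> * (norm (B *v q))\<^sup>2 + (norm \<mu>)\<^sup>2 / (s * \<beta>) + \<omega> * \<beta> * (norm r)\<^sup>2 + (norm w)\<^sup>2 / \<alpha>"
proof -
  define z where "z = B *v (q' - q)"
  have E1: "gf \<bullet> p' = (\<mu> - \<beta> *\<^sub>R r' + \<beta> *\<^sub>R z) \<bullet> (A *v p') - (p' - p) \<bullet> (D *v p') + w \<bullet> p'"
    using D by (simp add: gf z_def[symmetric] inner_diff_left inner_add_left matrix_inner_transpose del: transpose_matrix_vector)
  have E2: "gg \<bullet> q' = (\<mu> - \<beta> *\<^sub>R r') \<bullet> (B *v q')"
    by (simp add: gg matrix_inner_transpose del: transpose_matrix_vector)
  have Ap: "A *v p' = r' - B *v q'" by (simp add: r')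
  have sum: "gf \<bullet> p' + gg \<bullet> q' = \<mu> \<bullet> r' - \<beta> * (norm r')\<^sup>2 + \<beta> * (z \<bullet> r') - \<beta> * (z \<bullet> (B *v q')) - (p' - p) \<bullet> (D *v p') + w \<bullet> p'"
    unfolding E1 E2 Ap by (simp add: power2_norm_eq_inner inner_diff_left inner_add_left inner_diff_right right_diff_distrib)
  have zB: "z = B *v q' - B *v q" by (simp add: z_def matrix_vector_mult_diff_distrib)
  have T1: "2 * (z \<bullet> (B *v q')) = (norm (B *v q'))\<^sup>2 + (norm z)\<^sup>2 - (norm (B *v q))\<^sup>2"
    unfolding zB power2_norm_eq_inner by (simp add: inner_diff_left inner_diff_right inner_commute)
  have sym: "p \<bullet> (D *v p') = p' \<bullet> (D *v p)"
    using matrix_inner_transpose[of p D p'] D by (simp add: inner_commute)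
  have T2: "2 * ((p' - p) \<bullet> (D *v p')) = p' \<bullet> (D *v p') + (p' - p) \<bullet> (D *v (p' - p)) - p \<bullet> (D *v p)"
    by (simp add: matrix_vector_mult_diff_distrib inner_diff_left inner_diff_right sym)
  have T3: "(norm (\<mu> - (s * \<beta>) *\<^sub>R r'))\<^sup>2 / (s * \<beta>) = (norm \<mu>)\<^sup>2 / (s * \<beta>) - 2 * (\<mu> \<bullet> r') + s * \<beta> * (norm r')\<^sup>2"
  proof -
    have "(norm (\<mu> - (s * \<beta>) *\<^sub>R r'))\<^sup>2 = (norm \<mu>)\<^sup>2 - (s * \<beta>) * (2 * (\<mu> \<bullet> r')) + (s * \<beta>) * (s * \<beta> * (norm r')\<^sup>2)"
      unfolding power2_norm_eq_inner by (simp add: inner_diff_left inner_diff_right inner_commute)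
    then show ?thesis using s \<beta> by (simp add: diff_divide_distrib add_divide_distrib)
  qed
  have T4: "2 * (z \<bullet> r') \<le> \<rho> * (norm z)\<^sup>2 + \<omega> * (norm r)\<^sup>2"
  proof -
    have "z \<bullet> r' \<le> (1 - s) * (z \<bullet> r)" using mono by (simp add: z_def inner_diff_right)
    also have "2 * ((1 - s) * (z \<bullet> r)) \<le> \<rho> * (norm z)\<^sup>2 + \<omega> * (norm r)\<^sup>2"
    \<comment> \<open>Young's inequality divides by \<rho>. If \<rho> is 0, then
      \<open>\<rho>(3)\<close> forces s = 1 and the product vanishes.\<close>
    proof (cases "\<rho> = 0")
      case True
      then show ?thesis using \<rho> by simp
    next
      case False
      have "(1 - s) * (z \<bullet> r) \<le> \<bar>(1 - s) * (z \<bullet> r)\<bar>" by (rule abs_ge_self)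
      also have "\<dots> \<le> norm z * (\<bar>1 - s\<bar> * norm r)"
        using mult_left_mono[OF Cauchy_Schwarz_ineq2[of z r], of "\<bar>1 - s\<bar>"] by (simp add: abs_mult mult_ac)
      finally have "2 * ((1 - s) * (z \<bullet> r)) \<le> \<rho> * (norm z)\<^sup>2 + (\<bar>1 - s\<bar> * norm r)\<^sup>2 / \<rho>"
        using two_mult_le_weighted[of \<rho> "norm z" "\<bar>1 - s\<bar> * norm r"] False \<rho>(1) by simp
      also have "(\<bar>1 - s\<bar> * norm r)\<^sup>2 / \<rho> \<le> \<omega> * (norm r)\<^sup>2"
        using mult_right_mono[OF \<rho>(3), of "(norm r)\<^sup>2"] False \<rho>(1)
        by (simp add: power_mult_distrib divide_le_eq mult_ac)
      finally show ?thesis by simp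
    qed
    finally show ?thesis by simp
  qed
  have T5: "2 * (w \<bullet> p') \<le> \<alpha> * (norm p')\<^sup>2 + (norm w)\<^sup>2 / \<alpha>"
    using two_mult_le_weighted[OF \<alpha>, of "norm p'" "norm w"] norm_cauchy_schwarz[of w p'] by (simp add: mult.commute)
  have T4': "2 * (\<beta> * (z \<bullet> r')) \<le> \<beta> * \<rho> * (norm z)\<^sup>2 + \<omega> * \<beta> * (norm r)\<^sup>2"
    using mult_left_mono[OF T4, of \<beta>] \<beta> by (simp add: algebra_simps)
  have T1': "2 * (\<beta> * (z \<bullet> (B *v q'))) = \<beta> * (norm (B *v q'))\<^sup>2 + \<beta> * (norm z)\<^sup>2 - \<beta> * (norm (B *v q))\<^sup>2"
    using arg_cong[OF T1, of "\<lambda>x. \<beta> * x"] by (simp add: algebra_simps)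
  have e1: "\<beta> * (1 - \<rho>) * (norm z)\<^sup>2 = \<beta> * (norm z)\<^sup>2 - \<beta> * \<rho> * (norm z)\<^sup>2"
    and e2: "\<beta> * (2 - s) * (norm r')\<^sup>2 = 2 * (\<beta> * (norm r')\<^sup>2) - s * \<beta> * (norm r')\<^sup>2"
    by (simp_all add: algebra_simps)
  show ?thesis unfolding z_def[symmetric] e1 e2 using sum sf sg T1' T2 T3 T4' T5 by linarith
qed

text \<open>Nested doubling gives the weights 2, 4, 8, 16, 16; the largest serves for all.\<close>

lemma norm_sum5_sq_le:
  fixes a b c d e :: "'a::real_normed_vector"
  shows "(norm (a + (b + (c + (d + e)))))\<^sup>2 \<le> 16 * ((norm a)\<^sup>2 + (norm b)\<^sup>2 + (norm c)\<^sup>2 + (norm d)\<^sup>2 + (norm e)\<^sup>2)"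
proof -
  define n2 where "n2 v = (norm v)\<^sup>2" for v :: 'a
  have "n2 (v + w) \<le> 2 * n2 v + 2 * n2 w" "0 \<le> n2 v" for v w
    unfolding n2_def by (rule norm_add_sq_le) simp
  from this(1)[of a "b + (c + (d + e))"] this(1)[of b "c + (d + e)"] this(1)[of c "d + e"] this(1)[of d e]
    this(2)[of a] this(2)[of b] this(2)[of c]
  show ?thesis unfolding n2_def[symmetric] by (simp add: algebra_simps)
qed

text \<open>The matrix \<open>D\<close> is random and changes with the outer iteration, so it is not
  fixed here; the constants below are found before quantifying over admissible \<open>D\<close>. The
  objective enters only through its two gradient maps.\<close>

locale admm =
  fixes A :: "real^'p^'n" and B :: "real^'q^'n" and b :: "real^'n"
    and Gf :: "real^'p \<Rightarrow> real^'p" and Gg :: "real^'q \<Rightarrow> real^'q"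
    and xs :: "real^'p" and ys :: "real^'q" and \<alpha> \<nu> \<beta> s c1 c2 :: real and \<Lambda> :: "(real^'n) set"
  assumes \<alpha>: "\<alpha> > 0" and \<nu>: "\<nu> > 0" and \<beta>: "\<beta> > 0" and s: "0 < s" "s < (1 + sqrt 5) / 2"
    and c: "c1 > 0" "c2 > 0"
    and mono_f: "\<And>x y. \<alpha> * (norm (x - y))\<^sup>2 \<le> (Gf x - Gf y) \<bullet> (x - y)"
    and mono_g: "\<And>x y. \<alpha> * (norm (x - y))\<^sup>2 \<le> (Gg x - Gg y) \<bullet> (x - y)"
    and lip_f: "\<And>x y. norm (Gf x - Gf y) \<le> \<nu> * norm (x - y)"
    and lip_g: "\<And>x y. norm (Gg x - Gg y) \<le> \<nu> * norm (x - y)"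
    and feasible: "A *v xs + B *v ys = b"
    and \<Lambda>: "\<Lambda> = {l. transpose A *v l = Gf xs \<and> transpose B *v l = Gg ys}" "\<Lambda> \<noteq> {}"
begin

text \<open>The golden ratio bound on \<open>s\<close> is exactly \<open>(1 - s)\<^sup>2 < 2 - s\<close>; \<open>\<omega>\<close> is the midpoint.\<close>

definition "\<omega> = ((1 - s)\<^sup>2 + (2 - s)) / 2"

lemma \<omega>: "(1 - s)\<^sup>2 < \<omega>" "\<omega> < 2 - s" "\<omega> > 0"
proof -
  have "\<bar>s - 1/2\<bar> < sqrt 5 / 2"
    using s by (auto simp: abs_if intro: less_trans[of _ 1])
  then have "(s - 1/2)\<^sup>2 < (sqrt 5 / 2)\<^sup>2" by (metis abs_ge_zero power2_abs power_strict_mono zero_less_numeral)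
  then have "(1 - s)\<^sup>2 < 2 - s" by (simp add: power2_eq_square algebra_simps)
  then show "(1 - s)\<^sup>2 < \<omega>" "\<omega> < 2 - s" by (auto simp: \<omega>_def)
  then show "\<omega> > 0" using zero_le_power2[of "1 - s"] by linarith
qed

definition "multdist l = norm (l - closest_point \<Lambda> l)"

definition "res x y = A *v x + B *v y - b"

text \<open>The energy inequality offers 2 \<alpha> |y' - ys|^2 on the new side and asks for nothing
  of this kind on the old side. One half becomes the \<alpha>-term here, which makes the function
  control \<open>y\<close>; the other half remains as dissipation.\<close>

definition "lyap D x y l = (x - xs) \<bullet> (D *v (x - xs)) + \<alpha> * (norm (y - ys))\<^sup>2 + \<beta> * (norm (B *v (y - ys)))\<^sup>2
  + (multdist l)\<^sup>2 / (s * \<beta>) + \<omega> * \<beta> * (norm (res x y))\<^sup>2"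

definition admissible :: "real^'p^'p \<Rightarrow> bool" where
  "admissible D \<longleftrightarrow> transpose D = D \<and> (\<forall>v. c1 * (norm v)\<^sup>2 \<le> v \<bullet> (D *v v) \<and> v \<bullet> (D *v v) \<le> c2 * (norm v)\<^sup>2)"

lemma res_errors: "res x y = A *v (x - xs) + B *v (y - ys)"
  using feasible by (simp add: res_def matrix_vector_mult_diff_distrib algebra_simps)

lemma closed_multipliers: "closed \<Lambda>"
  unfolding \<Lambda> by (intro closed_Collect_conj closed_Collect_eq continuous_intros
      matrix_vector_mult_linear_continuous_on)

lemma convex_multipliers: "convex \<Lambda>"
  unfolding \<Lambda> convex_def
  by (auto simp: matrix_vector_right_distrib matrix_vector_mult_scaleR scaleR_left_distrib[symmetric]
      simp del: transpose_matrix_vector)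

lemma closest_multiplier: "closest_point \<Lambda> l \<in> \<Lambda>"
  by (rule closest_point_in_set[OF closed_multipliers \<Lambda>(2)])

lemma multdist_le: "m \<in> \<Lambda> \<Longrightarrow> multdist l \<le> norm (l - m)"
  using closest_point_le[OF closed_multipliers, of m l] by (simp add: multdist_def dist_norm)

lemma admissibleD:
  assumes "admissible D"
  shows "transpose D = D" "c1 * (norm v)\<^sup>2 \<le> v \<bullet> (D *v v)" "v \<bullet> (D *v v) \<le> c2 * (norm v)\<^sup>2" "0 \<le> v \<bullet> (D *v v)"
    "(norm (D *v v))\<^sup>2 \<le> c2 * (v \<bullet> (D *v v))"
proof -
  have *: "transpose D = D" "\<And>v. c1 * (norm v)\<^sup>2 \<le> v \<bullet> (D *v v)" "\<And>v. v \<bullet> (D *v v) \<le> c2 * (norm v)\<^sup>2"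
    using assms by (auto simp: admissible_def)
  have nn: "\<And>v. 0 \<le> v \<bullet> (D *v v)"
    using *(2) c(1) by (meson mult_nonneg_nonneg less_imp_le order_trans zero_le_power2)
  show "transpose D = D" "c1 * (norm v)\<^sup>2 \<le> v \<bullet> (D *v v)" "v \<bullet> (D *v v) \<le> c2 * (norm v)\<^sup>2" "0 \<le> v \<bullet> (D *v v)"
    "(norm (D *v v))\<^sup>2 \<le> c2 * (v \<bullet> (D *v v))"
    using * nn psd_apply_norm_le[OF *(1) nn c(2) *(3)] by auto
qed

lemma lyap_nonneg: "admissible D \<Longrightarrow> 0 \<le> lyap D x y l"
  unfolding lyap_def using admissibleD(4) \<alpha> \<beta> s \<omega> by (intro add_nonneg_nonneg) auto

lemma lyap_lower:
  "\<exists>C>0. \<forall>D x y l. admissible D \<longrightarrow>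
     (norm (x - xs))\<^sup>2 + (norm (y - ys))\<^sup>2 + (multdist l)\<^sup>2 + (norm (res x y))\<^sup>2 \<le> C * lyap D x y l"
proof (intro exI conjI allI impI)
  let ?C = "1 / c1 + 1 / \<alpha> + s * \<beta> + 1 / (\<omega> * \<beta>)"
  show "?C > 0" using \<alpha> \<beta> s \<omega> c by (intro add_pos_pos) auto
  fix D x y l assume D: "admissible D"
  note pos = \<alpha> \<beta> s(1) \<omega>(3) c(1) lyap_nonneg[OF D, of x y l]
  have nn: "0 \<le> \<alpha> * (norm (y - ys))\<^sup>2" "0 \<le> \<beta> * (norm (B *v (y - ys)))\<^sup>2" "0 \<le> (multdist l)\<^sup>2 / (s * \<beta>)"
      "0 \<le> \<omega> * \<beta> * (norm (res x y))\<^sup>2" "0 \<le> (x - xs) \<bullet> (D *v (x - xs))"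
    using pos admissibleD(4)[OF D] by auto
  have "(norm (x - xs))\<^sup>2 \<le> 1 / c1 * lyap D x y l"
    using admissibleD(2)[OF D, of "x - xs"] nn c by (simp add: lyap_def field_simps)
  moreover have "(norm (y - ys))\<^sup>2 \<le> 1 / \<alpha> * lyap D x y l"
  proof -
    have "\<alpha> * (norm (y - ys))\<^sup>2 \<le> lyap D x y l" using nn unfolding lyap_def by linarith
    then show ?thesis using \<alpha> by (simp add: field_simps)
  qed
  moreover have "(multdist l)\<^sup>2 \<le> s * \<beta> * lyap D x y l"
  proof -
    have "(multdist l)\<^sup>2 / (s * \<beta>) \<le> lyap D x y l" using nn unfolding lyap_def by linarith
    then show ?thesis using s \<beta> by (simp add: divide_le_eq mult_ac)
  qed
  moreover have "(norm (res x y))\<^sup>2 \<le> 1 / (\<omega> * \<beta>) * lyap D x y l"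
  proof -
    have "\<omega> * \<beta> * (norm (res x y))\<^sup>2 \<le> lyap D x y l" using nn unfolding lyap_def by linarith
    then show ?thesis using \<omega> \<beta> by (simp add: field_simps)
  qed
  ultimately show "(norm (x - xs))\<^sup>2 + (norm (y - ys))\<^sup>2 + (multdist l)\<^sup>2 + (norm (res x y))\<^sup>2 \<le> ?C * lyap D x y l"
    by (simp add: distrib_right)
qed

text \<open>\<open>w\<close> is the error in the optimality condition of the \<open>x\<close>-step.\<close>

definition "inexact_step D x y l x' y' l' w \<longleftrightarrow>
  Gf x' = transpose A *v (l - \<beta> *\<^sub>R (A *v x' + B *v y - b)) - D *v (x' - x) + w \<and>
  Gg y' = transpose B *v (l - \<beta> *\<^sub>R res x' y') \<and> l' = l - (s * \<beta>) *\<^sub>R res x' y'"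

text \<open>Let \<open>R\<close> collect the squares gained in the step. The energy inequality says
  lyap' + \<kappa> R \<le> lyap + |w|^2 / \<alpha>. Conversely lyap' \<le> K (R + |w|^2), because
  the primal errors and the residual occur in \<open>R\<close>, and the distance to \<Lambda> is
  bounded by stationarity residuals that are combinations of the same quantities and
  \<open>w\<close>. Eliminating \<open>R\<close> gives the factor (K / \<kappa>) / (1 + K /
  \<kappa>).\<close>

lemma lyap_contraction:
  "\<exists>q C. 0 \<le> q \<and> q < 1 \<and> C > 0 \<and> (\<forall>D x y l x' y' l' w. admissible D \<longrightarrow>
     inexact_step D x y l x' y' l' w \<longrightarrow> Gg y = transpose B *v (l + ((s - 1) * \<beta>) *\<^sub>R res x y) \<longrightarrow>
     lyap D x' y' l' \<le> q * lyap D x y l + C * (norm w)\<^sup>2)"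
proof -
  define \<rho> where "\<rho> = (1 - s)\<^sup>2 / \<omega>"
  have \<rho>: "0 \<le> \<rho>" "\<rho> < 1" "(1 - s)\<^sup>2 \<le> \<rho> * \<omega>" using \<omega> by (auto simp: \<rho>_def)
  obtain kA where kA: "kA > 0" "\<And>v. norm (transpose A *v v) \<le> kA * norm v" using matrix_norm_bound[of "transpose A"] by blast
  obtain kB where kB: "kB > 0" "\<And>v. norm (transpose B *v v) \<le> kB * norm v" using matrix_norm_bound[of "transpose B"] by blast
  obtain kb where kb: "kb > 0" "\<And>v. norm (B *v v) \<le> kb * norm v" using matrix_norm_bound[of B] by blast
  obtain Cd where Cd: "Cd > 0" "\<And>l. (multdist l)\<^sup>2 \<le> Cd * ((norm (transpose A *v l - Gf xs))\<^sup>2 + (norm (transpose B *v l - Gg ys))\<^sup>2)"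
    using dist_solution_set_le[of A B] \<Lambda> unfolding multdist_def by blast
  define \<kappa> where "\<kappa> = min (min \<alpha> 1) (min (\<beta> * (1 - \<rho>)) (\<beta> * (2 - s - \<omega>)))"
  have \<kappa>: "\<kappa> > 0" "\<kappa> \<le> \<alpha>" "\<kappa> \<le> 1" "\<kappa> \<le> \<beta> * (1 - \<rho>)" "\<kappa> \<le> \<beta> * (2 - s - \<omega>)"
    using \<alpha> \<beta> \<rho> \<omega> by (auto simp: \<kappa>_def)
  define h where "h = 16 * (\<nu>\<^sup>2 + (\<beta> * (1 - s) * kA)\<^sup>2 + (\<beta> * kA)\<^sup>2 + c2 + 1) + 2 * (\<nu>\<^sup>2 + (\<beta> * (1 - s) * kB)\<^sup>2)"
  define K where "K = c2 + \<alpha> + \<beta> * kb\<^sup>2 + Cd * h / (s * \<beta>) + \<omega> * \<beta>"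
  have h0: "h \<ge> 0" using c by (simp add: h_def)
  have K: "K > 0" unfolding K_def using c \<alpha> \<beta> \<omega> s Cd h0 kb
    by (intro add_pos_nonneg add_pos_pos) (auto intro!: mult_nonneg_nonneg divide_nonneg_nonneg)
  define q where "q = (K / \<kappa>) / (1 + K / \<kappa>)"
  define C where "C = K / (\<kappa> * \<alpha>) + K"
  have "K / \<kappa> > 0" using K \<kappa> by simp
  moreover have "0 \<le> r / (1 + r)" "r / (1 + r) < 1" if "r > 0" for r :: real
    using that by (simp_all add: divide_less_eq)
  ultimately have q: "0 \<le> q" "q < 1" unfolding q_def by blast+
  have C: "C > 0" using K \<kappa> \<alpha> by (auto simp: C_def intro!: add_pos_pos)
  have "lyap D x' y' l' \<le> q * lyap D x y l + C * (norm w)\<^sup>2"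
    if D: "admissible D" and step: "inexact_step D x y l x' y' l' w"
      and yopt: "Gg y = transpose B *v (l + ((s - 1) * \<beta>) *\<^sub>R res x y)" for D x y l x' y' l' w
  proof -
    define lb where "lb = closest_point \<Lambda> l"
    have lb: "lb \<in> \<Lambda>" unfolding lb_def by (rule closest_multiplier)
    then have lbA: "transpose A *v lb = Gf xs" and lbB: "transpose B *v lb = Gg ys" using \<Lambda>(1) by auto
    define \<mu> where "\<mu> = l - lb"
    define p where "p = x - xs"
    define p' where "p' = x' - xs"
    define u where "u = y - ys"
    define u' where "u' = y' - ys"
    define r where "r = res x y"
    define r' where "r' = res x' y'"
    define z where "z = B *v (u' - u)"
    have pp: "p' - p = x' - x" and uu: "u' - u = y' - y" by (auto simp: p_def p'_def u_def u'_def)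
    have Ax: "A *v x' + B *v y - b = r' - z"
      by (simp add: r'_def res_def z_def uu matrix_vector_mult_diff_distrib)
    have Gfx: "Gf x' = transpose A *v (l - \<beta> *\<^sub>R r' + \<beta> *\<^sub>R z) - D *v (p' - p) + w"
      using step unfolding inexact_step_def Ax pp by (simp add: scaleR_diff_right algebra_simps)
    have Ggy: "Gg y' = transpose B *v (l - \<beta> *\<^sub>R r')" and l': "l' = l - (s * \<beta>) *\<^sub>R r'"
      using step by (auto simp: inexact_step_def r'_def)
    have en: "\<alpha> * (norm p')\<^sup>2 + 2 * \<alpha> * (norm u')\<^sup>2 + p' \<bullet> (D *v p') + (p' - p) \<bullet> (D *v (p' - p)) + \<beta> * (norm (B *v u'))\<^sup>2
      + (norm (\<mu> - (s * \<beta>) *\<^sub>R r'))\<^sup>2 / (s * \<beta>) + \<beta> * (1 - \<rho>) * (norm (B *v (u' - u)))\<^sup>2 + \<beta> * (2 - s) * (norm r')\<^sup>2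
    \<le> p \<bullet> (D *v p) + \<beta> * (norm (B *v u))\<^sup>2 + (norm \<mu>)\<^sup>2 / (s * \<beta>) + \<omega> * \<beta> * (norm r)\<^sup>2 + (norm w)\<^sup>2 / \<alpha>"
    proof (rule admm_energy[OF \<beta> s(1) \<alpha> \<rho>(1) \<omega>(3) \<rho>(3) admissibleD(1)[OF D]])
      show "Gf x' - Gf xs = transpose A *v (\<mu> - \<beta> *\<^sub>R r' + \<beta> *\<^sub>R (B *v (u' - u))) - D *v (p' - p) + w"
        unfolding Gfx lbA[symmetric] \<mu>_def z_def[symmetric]
        by (simp add: matrix_vector_mult_diff_distrib matrix_vector_right_distrib del: transpose_matrix_vector)
      show "Gg y' - Gg ys = transpose B *v (\<mu> - \<beta> *\<^sub>R r')"
        unfolding Ggy lbB[symmetric] \<mu>_def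
        by (simp add: matrix_vector_mult_diff_distrib del: transpose_matrix_vector)
      show "r' = A *v p' + B *v u'" by (simp add: r'_def p'_def u'_def res_errors)
      show "\<alpha> * (norm p')\<^sup>2 \<le> (Gf x' - Gf xs) \<bullet> p'" unfolding p'_def by (rule mono_f)
      show "\<alpha> * (norm u')\<^sup>2 \<le> (Gg y' - Gg ys) \<bullet> u'" unfolding u'_def by (rule mono_g)
      \<comment> \<open>Monotonicity of \<open>Gg\<close> between consecutive y-iterates. The old
        stationarity condition is expressed with the already updated multiplier, and this is what
        produces the factor 1 - s.\<close>
      have "0 \<le> \<alpha> * (norm (y' - y))\<^sup>2" using \<alpha> by simp
      also have "\<dots> \<le> (Gg y' - Gg y) \<bullet> (u' - u)" unfolding uu by (rule mono_g)
      also have "Gg y' - Gg y = transpose B *v (\<beta> *\<^sub>R ((1 - s) *\<^sub>R r - r'))"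
        unfolding Ggy yopt r_def[symmetric] matrix_vector_mult_diff_distrib[symmetric]
        by (simp add: algebra_simps del: transpose_matrix_vector)
      also have "\<dots> \<bullet> (u' - u) = \<beta> * ((B *v (u' - u)) \<bullet> ((1 - s) *\<^sub>R r - r'))"
        unfolding matrix_inner_transpose[symmetric] by (simp add: inner_commute)
      finally show "0 \<le> (B *v (u' - u)) \<bullet> ((1 - s) *\<^sub>R r - r')" using \<beta> by (simp add: zero_le_mult_iff)
    qed
    define \<Delta> where "\<Delta> = (p' - p) \<bullet> (D *v (p' - p))"
    define R where "R = (norm p')\<^sup>2 + (norm u')\<^sup>2 + \<Delta> + (norm z)\<^sup>2 + (norm r')\<^sup>2"
    define w2 where "w2 = (norm w)\<^sup>2"
    have \<Delta>0: "\<Delta> \<ge> 0" unfolding \<Delta>_def by (rule admissibleD(4)[OF D])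
    have w0: "w2 \<ge> 0" by (simp add: w2_def)
    have R0: "R \<ge> 0" using \<Delta>0 by (simp add: R_def)
    have Rparts: "(norm p')\<^sup>2 \<le> R" "(norm u')\<^sup>2 \<le> R" "\<Delta> \<le> R" "(norm z)\<^sup>2 \<le> R" "(norm r')\<^sup>2 \<le> R"
      using \<Delta>0 by (auto simp: R_def)
    \<comment> \<open>The comparison point is the projection of the old multiplier; the new
      multiplier is at least as close to its own projection.\<close>
    have md: "(multdist l')\<^sup>2 \<le> (norm (\<mu> - (s * \<beta>) *\<^sub>R r'))\<^sup>2"
    proof (rule power_mono)
      have "l' - lb = \<mu> - (s * \<beta>) *\<^sub>R r'" by (simp add: l' \<mu>_def)
      then show "multdist l' \<le> norm (\<mu> - (s * \<beta>) *\<^sub>R r')" using multdist_le[OF lb, of l'] by simp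
    qed (simp add: multdist_def)
    have Phi': "lyap D x' y' l' = p' \<bullet> (D *v p') + \<alpha> * (norm u')\<^sup>2 + \<beta> * (norm (B *v u'))\<^sup>2 + (multdist l')\<^sup>2 / (s * \<beta>) + \<omega> * \<beta> * (norm r')\<^sup>2"
      by (simp add: lyap_def p'_def u'_def r'_def)
    have Phi: "lyap D x y l = p \<bullet> (D *v p) + \<alpha> * (norm u)\<^sup>2 + \<beta> * (norm (B *v u))\<^sup>2 + (norm \<mu>)\<^sup>2 / (s * \<beta>) + \<omega> * \<beta> * (norm r)\<^sup>2"
      by (simp add: lyap_def p_def u_def r_def multdist_def \<mu>_def lb_def)
    have dec: "lyap D x' y' l' + \<kappa> * R \<le> lyap D x y l + w2 / \<alpha>"
    proof -
      have "(multdist l')\<^sup>2 / (s * \<beta>) \<le> (norm (\<mu> - (s * \<beta>) *\<^sub>R r'))\<^sup>2 / (s * \<beta>)"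
        using md s \<beta> by (intro divide_right_mono) auto
      moreover have "\<kappa> * R = \<kappa> * (norm p')\<^sup>2 + \<kappa> * (norm u')\<^sup>2 + \<kappa> * \<Delta> + \<kappa> * (norm z)\<^sup>2 + \<kappa> * (norm r')\<^sup>2"
        by (simp add: R_def algebra_simps)
      moreover have "\<kappa> * (norm p')\<^sup>2 \<le> \<alpha> * (norm p')\<^sup>2" "\<kappa> * (norm u')\<^sup>2 \<le> \<alpha> * (norm u')\<^sup>2"
        "\<kappa> * \<Delta> \<le> 1 * \<Delta>" "\<kappa> * (norm z)\<^sup>2 \<le> \<beta> * (1 - \<rho>) * (norm z)\<^sup>2"
        "\<kappa> * (norm r')\<^sup>2 \<le> \<beta> * (2 - s - \<omega>) * (norm r')\<^sup>2"
        using \<kappa> \<Delta>0 by (intro mult_right_mono; simp)+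
      moreover have "\<beta> * (2 - s - \<omega>) * (norm r')\<^sup>2 = \<beta> * (2 - s) * (norm r')\<^sup>2 - \<omega> * \<beta> * (norm r')\<^sup>2"
        by (simp add: algebra_simps)
      moreover have "0 \<le> \<alpha> * (norm u)\<^sup>2" using \<alpha> by simp
      ultimately show ?thesis using en unfolding Phi Phi' z_def[symmetric] \<Delta>_def[symmetric] w2_def[symmetric]
        by linarith
    qed
    \<comment> \<open>Inserting the x-condition and the multiplier update leaves five terms: s
      \<noteq> 1 contributes \<open>r'\<close>, the old \<open>y\<close> used in the x-step
      contributes \<open>z\<close>, the proximal term contributes \<open>D *v (p' - p)\<close>, and
      the gradient difference and \<open>w\<close> remain.\<close>
    have e1: "transpose A *v l' - Gf xs = (Gf x' - Gf xs) + ((\<beta> * (1 - s)) *\<^sub>R (transpose A *v r') + (- \<beta> *\<^sub>R (transpose A *v z) + (D *v (p' - p) + - w)))"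
      unfolding Gfx l' by (simp add: matrix_vector_mult_diff_distrib matrix_vector_right_distrib
          matrix_vector_mult_scaleR algebra_simps del: transpose_matrix_vector)
    have "(norm (transpose A *v l' - Gf xs))\<^sup>2 \<le> 16 * ((norm (Gf x' - Gf xs))\<^sup>2 + (norm ((\<beta> * (1 - s)) *\<^sub>R (transpose A *v r')))\<^sup>2
        + (norm (- \<beta> *\<^sub>R (transpose A *v z)))\<^sup>2 + (norm (D *v (p' - p)))\<^sup>2 + (norm (- w))\<^sup>2)"
      unfolding e1 by (rule norm_sum5_sq_le)
    also have "\<dots> \<le> 16 * (\<nu>\<^sup>2 * R + (\<beta> * (1 - s) * kA)\<^sup>2 * R + (\<beta> * kA)\<^sup>2 * R + c2 * R + w2)"
    proof (intro mult_left_mono add_mono)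
      have "(norm (Gf x' - Gf xs))\<^sup>2 \<le> (\<nu> * norm p')\<^sup>2" unfolding p'_def by (intro power_mono lip_f) auto
      also have "\<dots> \<le> \<nu>\<^sup>2 * R" unfolding power_mult_distrib using Rparts by (intro mult_left_mono) auto
      finally show "(norm (Gf x' - Gf xs))\<^sup>2 \<le> \<nu>\<^sup>2 * R" .
      have "(norm ((\<beta> * (1 - s)) *\<^sub>R (transpose A *v r')))\<^sup>2 = (\<beta> * (1 - s))\<^sup>2 * (norm (transpose A *v r'))\<^sup>2"
        by (simp add: power_mult_distrib del: transpose_matrix_vector)
      also have "\<dots> \<le> (\<beta> * (1 - s))\<^sup>2 * (kA * norm r')\<^sup>2" by (intro mult_left_mono power_mono kA) auto
      also have "\<dots> = (\<beta> * (1 - s) * kA)\<^sup>2 * (norm r')\<^sup>2" by (simp add: power_mult_distrib)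
      also have "\<dots> \<le> (\<beta> * (1 - s) * kA)\<^sup>2 * R" using Rparts by (intro mult_left_mono) auto
      finally show "(norm ((\<beta> * (1 - s)) *\<^sub>R (transpose A *v r')))\<^sup>2 \<le> (\<beta> * (1 - s) * kA)\<^sup>2 * R" .
      have "(norm (- \<beta> *\<^sub>R (transpose A *v z)))\<^sup>2 = \<beta>\<^sup>2 * (norm (transpose A *v z))\<^sup>2"
        by (simp add: power_mult_distrib del: transpose_matrix_vector)
      also have "\<dots> \<le> \<beta>\<^sup>2 * (kA * norm z)\<^sup>2" by (intro mult_left_mono power_mono kA) auto
      also have "\<dots> = (\<beta> * kA)\<^sup>2 * (norm z)\<^sup>2" by (simp add: power_mult_distrib)
      also have "\<dots> \<le> (\<beta> * kA)\<^sup>2 * R" using Rparts by (intro mult_left_mono) auto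
      finally show "(norm (- \<beta> *\<^sub>R (transpose A *v z)))\<^sup>2 \<le> (\<beta> * kA)\<^sup>2 * R" .
      have "(norm (D *v (p' - p)))\<^sup>2 \<le> c2 * \<Delta>" unfolding \<Delta>_def by (rule admissibleD(5)[OF D])
      also have "\<dots> \<le> c2 * R" using Rparts c by (intro mult_left_mono) auto
      finally show "(norm (D *v (p' - p)))\<^sup>2 \<le> c2 * R" .
    qed (simp_all add: w2_def)
    finally have dA: "(norm (transpose A *v l' - Gf xs))\<^sup>2 \<le> 16 * (\<nu>\<^sup>2 * R + (\<beta> * (1 - s) * kA)\<^sup>2 * R + (\<beta> * kA)\<^sup>2 * R + c2 * R + w2)" .
    have e2: "transpose B *v l' - Gg ys = (Gg y' - Gg ys) + (\<beta> * (1 - s)) *\<^sub>R (transpose B *v r')"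
      unfolding Ggy l' by (simp add: matrix_vector_mult_diff_distrib
          matrix_vector_mult_scaleR algebra_simps del: transpose_matrix_vector)
    have "(norm (transpose B *v l' - Gg ys))\<^sup>2 \<le> 2 * (norm (Gg y' - Gg ys))\<^sup>2 + 2 * (norm ((\<beta> * (1 - s)) *\<^sub>R (transpose B *v r')))\<^sup>2"
      unfolding e2 by (rule norm_add_sq_le)
    also have "\<dots> \<le> 2 * (\<nu>\<^sup>2 * R) + 2 * ((\<beta> * (1 - s) * kB)\<^sup>2 * R)"
    proof (intro mult_left_mono add_mono)
      have "(norm (Gg y' - Gg ys))\<^sup>2 \<le> (\<nu> * norm u')\<^sup>2" unfolding u'_def by (intro power_mono lip_g) auto
      also have "\<dots> \<le> \<nu>\<^sup>2 * R" unfolding power_mult_distrib using Rparts by (intro mult_left_mono) auto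
      finally show "(norm (Gg y' - Gg ys))\<^sup>2 \<le> \<nu>\<^sup>2 * R" .
      have "(norm ((\<beta> * (1 - s)) *\<^sub>R (transpose B *v r')))\<^sup>2 = (\<beta> * (1 - s))\<^sup>2 * (norm (transpose B *v r'))\<^sup>2"
        by (simp add: power_mult_distrib del: transpose_matrix_vector)
      also have "\<dots> \<le> (\<beta> * (1 - s))\<^sup>2 * (kB * norm r')\<^sup>2" by (intro mult_left_mono power_mono kB) auto
      also have "\<dots> = (\<beta> * (1 - s) * kB)\<^sup>2 * (norm r')\<^sup>2" by (simp add: power_mult_distrib)
      also have "\<dots> \<le> (\<beta> * (1 - s) * kB)\<^sup>2 * R" using Rparts by (intro mult_left_mono) auto
      finally show "(norm ((\<beta> * (1 - s)) *\<^sub>R (transpose B *v r')))\<^sup>2 \<le> (\<beta> * (1 - s) * kB)\<^sup>2 * R" .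
    qed auto
    finally have dB: "(norm (transpose B *v l' - Gg ys))\<^sup>2 \<le> 2 * (\<nu>\<^sup>2 * R) + 2 * ((\<beta> * (1 - s) * kB)\<^sup>2 * R)" .
    have "16 * (\<nu>\<^sup>2 * R + (\<beta> * (1 - s) * kA)\<^sup>2 * R + (\<beta> * kA)\<^sup>2 * R + c2 * R + w2) + (2 * (\<nu>\<^sup>2 * R) + 2 * ((\<beta> * (1 - s) * kB)\<^sup>2 * R))
      = h * R + 16 * w2 - 16 * R" by (simp add: h_def algebra_simps)
    also have "\<dots> \<le> h * (R + w2)"
    proof -
      have "16 \<le> h" using c by (simp add: h_def)
      then show ?thesis using w0 R0 mult_right_mono[of 16 h w2] by (simp add: distrib_left)
    qed
    finally have "(norm (transpose A *v l' - Gf xs))\<^sup>2 + (norm (transpose B *v l' - Gg ys))\<^sup>2 \<le> h * (R + w2)"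
      using dA dB by linarith
    then have "(multdist l')\<^sup>2 \<le> Cd * (h * (R + w2))"
      using Cd(2)[of l'] Cd(1) by (meson mult_left_mono less_imp_le order_trans)
    then have "(multdist l')\<^sup>2 / (s * \<beta>) \<le> Cd * (h * (R + w2)) / (s * \<beta>)"
      using s \<beta> by (intro divide_right_mono) auto
    moreover have "p' \<bullet> (D *v p') \<le> c2 * (R + w2)"
      using admissibleD(3)[OF D, of p'] mult_left_mono[of "(norm p')\<^sup>2" "R + w2" c2] Rparts w0 c by linarith
    moreover have "\<alpha> * (norm u')\<^sup>2 \<le> \<alpha> * (R + w2)"
      using Rparts w0 \<alpha> by (intro mult_left_mono) auto
    moreover have "\<beta> * (norm (B *v u'))\<^sup>2 \<le> \<beta> * kb\<^sup>2 * (R + w2)"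
    proof -
      have "(norm (B *v u'))\<^sup>2 \<le> (kb * norm u')\<^sup>2" by (intro power_mono kb) auto
      also have "\<dots> \<le> kb\<^sup>2 * (R + w2)" unfolding power_mult_distrib using Rparts w0 by (intro mult_left_mono) auto
      finally show ?thesis using \<beta> by (simp add: mult.assoc mult_left_mono)
    qed
    moreover have "\<omega> * \<beta> * (norm r')\<^sup>2 \<le> \<omega> * \<beta> * (R + w2)"
      using Rparts w0 \<omega> \<beta> by (intro mult_left_mono) auto
    moreover have "K * (R + w2) = c2 * (R + w2) + \<alpha> * (R + w2) + \<beta> * kb\<^sup>2 * (R + w2) + Cd * (h * (R + w2)) / (s * \<beta>) + \<omega> * \<beta> * (R + w2)"
      by (simp add: K_def distrib_right)
    ultimately have "lyap D x' y' l' \<le> K * (R + w2)" unfolding Phi' by linarith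
    also have "\<dots> = K * R + K * w2" by (rule distrib_left)
    also have "K * R \<le> K * ((lyap D x y l + w2 / \<alpha> - lyap D x' y' l') / \<kappa>)"
      using dec \<kappa>(1) K by (intro mult_left_mono) (auto simp: field_simps)
    also have "\<dots> = (K / \<kappa>) * lyap D x y l + K / (\<kappa> * \<alpha>) * w2 - (K / \<kappa>) * lyap D x' y' l'"
      using \<kappa>(1) \<alpha> by (simp add: field_simps)
    finally have "(1 + K / \<kappa>) * lyap D x' y' l' \<le> (K / \<kappa>) * lyap D x y l + C * w2"
      by (simp add: C_def distrib_right)
    then have "lyap D x' y' l' \<le> ((K / \<kappa>) * lyap D x y l + C * w2) / (1 + K / \<kappa>)"
      using K \<kappa> by (simp add: pos_le_divide_eq add_pos_pos mult.commute)
    also have "\<dots> = q * lyap D x y l + (C * w2) / (1 + K / \<kappa>)"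
      by (simp add: q_def add_divide_distrib)
    also have "(C * w2) / (1 + K / \<kappa>) \<le> (C * w2) / 1"
      using K \<kappa> C w0 by (intro divide_left_mono) (auto intro!: add_pos_pos)
    finally show ?thesis by (simp add: w2_def)
  qed
  then show ?thesis using q C by blast
qed

end

section \<open>The exact proximal point and the step perturbed by the inner loop\<close>

lemma sum3_sq_le:
  fixes a b c :: real
  shows "(a + b + c)\<^sup>2 \<le> 3 * (a\<^sup>2 + b\<^sup>2 + c\<^sup>2)"
  using sum_squares_bound[of a b] sum_squares_bound[of b c] sum_squares_bound[of a c]
  by (simp add: power2_eq_square algebra_simps)

context admm
begin

text \<open>The matrix of the proximal term that the algorithm actually chooses. The second summand
  moves the residual in the x-condition from the old \<open>x\<close> to the new one.\<close>

definition xmat :: "real^'p^'p \<Rightarrow> real^'p^'p" where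
  "xmat D = D + \<beta> *\<^sub>R (transpose A ** A)"

lemma xmat_apply: "xmat D *v v = D *v v + \<beta> *\<^sub>R (transpose A *v (A *v v))"
  by (simp add: xmat_def matrix_vector_mult_add_rdistrib scaleR_matrix_vector_assoc[symmetric]
      matrix_vector_mul_assoc del: transpose_matrix_vector)

definition "prox_point D x y l u \<longleftrightarrow>
  Gf u + xmat D *v (u - x) + - (transpose A *v (l - \<beta> *\<^sub>R res x y)) = 0"

lemma xmat_inner: "v \<bullet> (xmat D *v v) = v \<bullet> (D *v v) + \<beta> * (norm (A *v v))\<^sup>2"
  by (simp add: xmat_apply inner_add_right matrix_inner_transpose power2_norm_eq_inner
      del: transpose_matrix_vector)

lemma xmat_coercive: "admissible D \<Longrightarrow> c1 * (norm v)\<^sup>2 \<le> v \<bullet> (xmat D *v v)"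
  unfolding xmat_inner using admissibleD(2)[of D v] \<beta> by (simp add: add_increasing2)

lemma admissible_norm_le:
  assumes "admissible D" shows "norm (D *v v) \<le> c2 * norm v"
proof -
  have "(norm (D *v v))\<^sup>2 \<le> c2 * (v \<bullet> (D *v v))" by (rule admissibleD(5)[OF assms])
  also have "\<dots> \<le> c2 * (c2 * (norm v)\<^sup>2)" using admissibleD(3)[OF assms, of v] c by (intro mult_left_mono) auto
  also have "\<dots> = (c2 * norm v)\<^sup>2" by (simp add: power2_eq_square)
  finally show ?thesis using c by (simp add: power2_le_iff_abs_le)
qed

lemma xmat_bound: "\<exists>K>0. \<forall>D v. admissible D \<longrightarrow> norm (xmat D *v v) \<le> K * norm v"
proof -
  obtain k where k: "k > 0" "\<And>v. norm (transpose A ** A *v v) \<le> k * norm v"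
    using matrix_norm_bound[of "transpose A ** A"] by blast
  have "norm (xmat D *v v) \<le> (c2 + \<beta> * k) * norm v" if D: "admissible D" for D v
  proof -
    have "norm (xmat D *v v) \<le> norm (D *v v) + norm (\<beta> *\<^sub>R (transpose A ** A *v v))"
      unfolding xmat_apply matrix_vector_mul_assoc by (rule norm_triangle_ineq)
    also have "\<dots> \<le> c2 * norm v + \<beta> * (k * norm v)"
      using admissible_norm_le[OF D, of v] k(2)[of v] \<beta> by (intro add_mono) (auto intro: mult_left_mono)
    finally show ?thesis by (simp add: algebra_simps)
  qed
  moreover have "c2 + \<beta> * k > 0" using c \<beta> k by (simp add: add_pos_pos)
  ultimately show ?thesis by blast
qed

lemma prox_point_exists:
  assumes D: "admissible D"
  shows "\<exists>u. prox_point D x y l u"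
proof -
  define T where "T u = Gf u + xmat D *v (u - x) + - (transpose A *v (l - \<beta> *\<^sub>R res x y))" for u
  obtain K where K: "K > 0" "\<And>v. norm (xmat D *v v) \<le> K * norm v" using xmat_bound D by blast
  have T: "T u - T v = (Gf u - Gf v) + xmat D *v (u - v)" for u v
    by (simp add: T_def matrix_vector_mult_diff_distrib)
  obtain u where "T u = 0"
  proof (rule strongly_monotone_surj[OF \<alpha>, of T "\<nu> + K"])
    fix u v
    have "0 \<le> (u - v) \<bullet> (xmat D *v (u - v))"
      using xmat_coercive[OF D, of "u - v"] c by (meson mult_nonneg_nonneg less_imp_le order_trans zero_le_power2)
    then show "\<alpha> * (norm (u - v))\<^sup>2 \<le> (T u - T v) \<bullet> (u - v)"
      using mono_f[of u v] unfolding T by (simp add: inner_add_left inner_add_right inner_commute)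
    show "norm (T u - T v) \<le> (\<nu> + K) * norm (u - v)"
      unfolding T using norm_triangle_ineq[of "Gf u - Gf v" "xmat D *v (u - v)"] lip_f[of u v] K(2)[of "u - v"]
      by (simp add: distrib_right)
  qed
  then show ?thesis by (auto simp: prox_point_def T_def)
qed

text \<open>The bound for the inner loop contains |xb - u|^2 and hence |u|^2, which must be
  expressed by the outer state. Subtracting the stationarity of \<open>xs\<close>, taken with the
  projected multiplier, from the equation of \<open>u\<close> and testing with u - xs bounds it by
  the current errors.\<close>

lemma prox_point_error:
  "\<exists>C>0. \<forall>D x y l u. admissible D \<longrightarrow> prox_point D x y l u \<longrightarrow> (norm (u - xs))\<^sup>2 \<le> C * lyap D x y l"
proof -
  obtain K where K: "K > 0" "\<And>D v. admissible D \<Longrightarrow> norm (xmat D *v v) \<le> K * norm v" using xmat_bound by blast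
  obtain k where k: "k > 0" "\<And>v. norm (transpose A *v v) \<le> k * norm v" using matrix_norm_bound[of "transpose A"] by blast
  obtain C0 where C0: "C0 > 0" "\<And>D x y l. admissible D \<Longrightarrow>
     (norm (x - xs))\<^sup>2 + (norm (y - ys))\<^sup>2 + (multdist l)\<^sup>2 + (norm (res x y))\<^sup>2 \<le> C0 * lyap D x y l"
    using lyap_lower by blast
  define k0 where "k0 = max K (max k (\<beta> * k)) / \<alpha>"
  have k0: "k0 > 0" "K \<le> \<alpha> * k0" "k \<le> \<alpha> * k0" "\<beta> * k \<le> \<alpha> * k0" using K k \<alpha> by (auto simp: k0_def less_max_iff_disj)
  have "(norm (u - xs))\<^sup>2 \<le> 3 * k0\<^sup>2 * C0 * lyap D x y l" if D: "admissible D" and u: "prox_point D x y l u" for D x y l u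
  proof -
    define lb where "lb = closest_point \<Lambda> l"
    have lbA: "transpose A *v lb = Gf xs" using closest_multiplier[of l] \<Lambda>(1) by (auto simp: lb_def)
    define v where "v = xmat D *v (x - xs) + (transpose A *v (l - lb) - \<beta> *\<^sub>R (transpose A *v res x y))"
    have e: "Gf u - Gf xs + xmat D *v (u - xs) = v"
    proof -
      have "Gf u = transpose A *v (l - \<beta> *\<^sub>R res x y) - xmat D *v (u - x)"
        using u by (simp add: prox_point_def eq_diff_eq add_eq_0_iff2)
      then show ?thesis unfolding v_def lbA[symmetric]
        by (simp add: matrix_vector_mult_diff_distrib matrix_vector_mult_scaleR del: transpose_matrix_vector)
    qed
    have nx: "0 \<le> (u - xs) \<bullet> (xmat D *v (u - xs))"
      using xmat_coercive[OF D, of "u - xs"] c by (meson mult_nonneg_nonneg less_imp_le order_trans zero_le_power2)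
    have "\<alpha> * (norm (u - xs))\<^sup>2 \<le> (Gf u - Gf xs + xmat D *v (u - xs)) \<bullet> (u - xs)"
      using mono_f[of u xs] nx by (simp add: inner_add_left inner_add_right inner_commute)
    also have "\<dots> \<le> norm v * norm (u - xs)" unfolding e by (rule norm_cauchy_schwarz)
    finally have "\<alpha> * norm (u - xs) * norm (u - xs) \<le> norm v * norm (u - xs)" by (simp add: power2_eq_square mult.assoc)
    then have av: "\<alpha> * norm (u - xs) \<le> norm v" by (cases "u = xs") auto
    have "norm v \<le> norm (xmat D *v (x - xs)) + (norm (transpose A *v (l - lb)) + norm (\<beta> *\<^sub>R (transpose A *v res x y)))"
      unfolding v_def by (intro norm_triangle_le add_left_mono norm_triangle_ineq4)
    also have "\<dots> \<le> K * norm (x - xs) + (k * multdist l + (\<beta> * k) * norm (res x y))"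
      using K(2)[OF D, of "x - xs"] k(2)[of "l - lb"] k(2)[of "res x y"] \<beta>
      by (auto simp: multdist_def lb_def[symmetric] mult.assoc simp del: transpose_matrix_vector
          intro!: add_mono mult_left_mono)
    also have "\<dots> \<le> (\<alpha> * k0) * norm (x - xs) + ((\<alpha> * k0) * multdist l + (\<alpha> * k0) * norm (res x y))"
      using k0 by (intro add_mono mult_right_mono) (auto simp: multdist_def)
    finally have "\<alpha> * norm (u - xs) \<le> \<alpha> * (k0 * (norm (x - xs) + multdist l + norm (res x y)))"
      using av by (simp add: algebra_simps)
    then have "norm (u - xs) \<le> k0 * (norm (x - xs) + multdist l + norm (res x y))" using \<alpha> by simp
    then have "(norm (u - xs))\<^sup>2 \<le> (k0 * (norm (x - xs) + multdist l + norm (res x y)))\<^sup>2"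
      by (intro power_mono) auto
    also have "\<dots> \<le> k0\<^sup>2 * (3 * ((norm (x - xs))\<^sup>2 + (multdist l)\<^sup>2 + (norm (res x y))\<^sup>2))"
      unfolding power_mult_distrib by (intro mult_left_mono sum3_sq_le) auto
    also have "\<dots> \<le> k0\<^sup>2 * (3 * (C0 * lyap D x y l))"
    proof -
      have "(norm (x - xs))\<^sup>2 + (multdist l)\<^sup>2 + (norm (res x y))\<^sup>2 \<le> C0 * lyap D x y l"
        using C0(2)[OF D, of x y l] zero_le_power2[of "norm (y - ys)"] by linarith
      then show ?thesis by (intro mult_left_mono) auto
    qed
    finally show ?thesis by (simp add: mult_ac)
  qed
  moreover have "3 * k0\<^sup>2 * C0 > 0" using k0 C0 by simp
  ultimately show ?thesis by blast
qed

text \<open>Bounded growth without stationarity of the old \<open>y\<close>, which an arbitrary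
  \<open>y0\<close> lacks. Strong monotonicity of \<open>Gg\<close> bounds the new y-error by the
  x-error and the old distance to \<Lambda>; the residual and the new multiplier distance
  follow.\<close>

lemma lyap_step_crude:
  "\<exists>C>0. \<forall>D x y l u x' y' l'. admissible D \<longrightarrow> prox_point D x y l u \<longrightarrow>
     Gg y' = transpose B *v (l - \<beta> *\<^sub>R res x' y') \<longrightarrow> l' = l - (s * \<beta>) *\<^sub>R res x' y' \<longrightarrow>
     lyap D x' y' l' \<le> C * (lyap D x y l + (norm (x' - u))\<^sup>2)"
proof -
  obtain k where k: "k > 0" "\<And>v. norm (A *v v) \<le> k * norm v" using matrix_norm_bound[of A] by blast
  obtain kb where kb: "kb > 0" "\<And>v. norm (B *v v) \<le> kb * norm v" using matrix_norm_bound[of B] by blast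
  obtain C0 where C0: "C0 > 0" "\<And>D x y l. admissible D \<Longrightarrow>
     (norm (x - xs))\<^sup>2 + (norm (y - ys))\<^sup>2 + (multdist l)\<^sup>2 + (norm (res x y))\<^sup>2 \<le> C0 * lyap D x y l"
    using lyap_lower by blast
  obtain C1 where C1: "C1 > 0" "\<And>D x y l u. admissible D \<Longrightarrow> prox_point D x y l u \<Longrightarrow> (norm (u - xs))\<^sup>2 \<le> C1 * lyap D x y l"
    using prox_point_error by blast
  define a1 where "a1 = kb / \<alpha> * (1 + \<beta> * k)"
  define a2 where "a2 = k + kb * a1"
  define a3 where "a3 = 1 + s * \<beta> * a2"
  have a1: "a1 > 0" unfolding a1_def using k kb \<alpha> \<beta>
    by (intro mult_pos_pos divide_pos_pos add_pos_pos) auto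
  have a2: "a2 > 0" unfolding a2_def using k kb a1 by (intro mult_pos_pos add_pos_pos) auto
  have a: "a1 > 0" "a2 > 0" "a3 > 0" using a1 a2 s \<beta> by (auto simp: a3_def intro!: add_pos_pos mult_pos_pos)
  define E where "E = c2 + \<alpha> * a1\<^sup>2 + \<beta> * (kb * a1)\<^sup>2 + a3\<^sup>2 / (s * \<beta>) + \<omega> * \<beta> * a2\<^sup>2"
  have E: "E > 0" unfolding E_def using c \<alpha> \<beta> s \<omega> by (intro add_pos_nonneg) auto
  define C where "C = 3 * E * (C1 + C0 + 1)"
  have "lyap D x' y' l' \<le> C * (lyap D x y l + (norm (x' - u))\<^sup>2)"
    if D: "admissible D" and u: "prox_point D x y l u" and y': "Gg y' = transpose B *v (l - \<beta> *\<^sub>R res x' y')"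
      and l': "l' = l - (s * \<beta>) *\<^sub>R res x' y'" for D x y l u x' y' l'
  proof -
    define lb where "lb = closest_point \<Lambda> l"
    have lb: "lb \<in> \<Lambda>" unfolding lb_def by (rule closest_multiplier)
    then have lbB: "transpose B *v lb = Gg ys" using \<Lambda>(1) by auto
    define p' where "p' = x' - xs"
    define u' where "u' = y' - ys"
    define m where "m = multdist l"
    define N where "N = norm p' + m"
    have m: "m \<ge> 0" "norm (l - lb) = m" by (auto simp: m_def multdist_def lb_def)
    have N: "N \<ge> 0" "norm p' \<le> N" "m \<le> N" using m by (auto simp: N_def)
    have "\<alpha> * (norm u')\<^sup>2 \<le> (Gg y' - Gg ys) \<bullet> u'" unfolding u'_def by (rule mono_g)
    also have "Gg y' - Gg ys = transpose B *v (l - lb - \<beta> *\<^sub>R res x' y')"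
      unfolding y' lbB[symmetric] by (simp add: matrix_vector_mult_diff_distrib del: transpose_matrix_vector)
    also have "\<dots> \<bullet> u' = (l - lb - \<beta> *\<^sub>R (A *v p')) \<bullet> (B *v u') - \<beta> * (norm (B *v u'))\<^sup>2"
      unfolding matrix_inner_transpose[symmetric] res_errors p'_def[symmetric] u'_def[symmetric]
      by (simp add: inner_diff_left inner_add_left scaleR_add_right power2_norm_eq_inner)
    also have "\<dots> \<le> norm (l - lb - \<beta> *\<^sub>R (A *v p')) * norm (B *v u')"
      using norm_cauchy_schwarz[of "l - lb - \<beta> *\<^sub>R (A *v p')" "B *v u'"] \<beta> by (smt (verit) mult_nonneg_nonneg zero_le_power2)
    also have "\<dots> \<le> (m + \<beta> * (k * norm p')) * (kb * norm u')"
    proof (intro mult_mono kb(2))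
      have "norm (l - lb - \<beta> *\<^sub>R (A *v p')) \<le> norm (l - lb) + norm (\<beta> *\<^sub>R (A *v p'))" by (rule norm_triangle_ineq4)
      also have "\<dots> \<le> m + \<beta> * (k * norm p')" using m k(2)[of p'] \<beta> by simp
      finally show "norm (l - lb - \<beta> *\<^sub>R (A *v p')) \<le> m + \<beta> * (k * norm p')" .
    qed (use m \<beta> k in auto)
    finally have "norm u' * (\<alpha> * norm u') \<le> norm u' * (kb * (m + \<beta> * (k * norm p')))"
      by (simp add: power2_eq_square mult_ac)
    then have "\<alpha> * norm u' \<le> kb * (m + \<beta> * (k * norm p'))"
      using m \<beta> k kb by (cases "u' = 0") auto
    also have "\<dots> \<le> kb * (N + \<beta> * (k * N))" using N kb \<beta> k by (intro mult_left_mono add_mono) auto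
    also have "\<dots> = \<alpha> * (a1 * N)" using \<alpha> by (simp add: a1_def field_simps)
    finally have nu: "norm u' \<le> a1 * N" using \<alpha> by simp
    have nBu: "norm (B *v u') \<le> kb * a1 * N"
      using order_trans[OF kb(2)[of u'] mult_left_mono[OF nu, of kb]] kb by (simp add: mult.assoc)
    have nr: "norm (res x' y') \<le> a2 * N"
    proof -
      have "norm (res x' y') \<le> norm (A *v p') + norm (B *v u')"
        unfolding res_errors p'_def u'_def by (rule norm_triangle_ineq)
      also have "\<dots> \<le> k * N + kb * a1 * N"
        using k(2)[of p'] mult_left_mono[OF N(2), of k] k nBu by linarith
      finally show ?thesis by (simp add: a2_def distrib_right)
    qed
    have nl: "multdist l' \<le> a3 * N"
    proof -
      have "multdist l' \<le> norm (l' - lb)" by (rule multdist_le[OF lb])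
      also have "l' - lb = (l - lb) - (s * \<beta>) *\<^sub>R res x' y'" by (simp add: l')
      also have "norm \<dots> \<le> norm (l - lb) + norm ((s * \<beta>) *\<^sub>R res x' y')" by (rule norm_triangle_ineq4)
      also have "\<dots> \<le> N + s * \<beta> * (a2 * N)" using m N nr s(1) \<beta> by (auto intro!: add_mono mult_left_mono)
      finally show ?thesis by (simp add: a3_def distrib_right)
    qed
    have b: "p' \<bullet> (D *v p') \<le> c2 * N\<^sup>2"
      using c by (intro order_trans[OF admissibleD(3)[OF D, of p'] mult_left_mono[OF power_mono[OF N(2)]]]) auto
    have sq: "0 \<le> v \<Longrightarrow> v \<le> a * N \<Longrightarrow> v\<^sup>2 \<le> a\<^sup>2 * N\<^sup>2" for v a
      using power_mono[of v "a * N" 2] by (simp add: power_mult_distrib)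
    have "lyap D x' y' l' = p' \<bullet> (D *v p') + \<alpha> * (norm u')\<^sup>2 + \<beta> * (norm (B *v u'))\<^sup>2 + (multdist l')\<^sup>2 / (s * \<beta>) + \<omega> * \<beta> * (norm (res x' y'))\<^sup>2"
      by (simp add: lyap_def p'_def u'_def)
    also have "\<dots> \<le> c2 * N\<^sup>2 + \<alpha> * (a1\<^sup>2 * N\<^sup>2) + \<beta> * ((kb * a1)\<^sup>2 * N\<^sup>2) + (a3\<^sup>2 * N\<^sup>2) / (s * \<beta>) + \<omega> * \<beta> * (a2\<^sup>2 * N\<^sup>2)"
      using \<alpha> \<beta> s \<omega> b nu nBu nr nl
      by (intro add_mono mult_left_mono divide_right_mono sq) (auto simp: multdist_def)
    also have "\<dots> = E * N\<^sup>2" by (simp add: E_def distrib_right)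
    also have "N\<^sup>2 \<le> 3 * ((norm (x' - u))\<^sup>2 + (norm (u - xs))\<^sup>2 + m\<^sup>2)"
    proof -
      have "N \<le> norm (x' - u) + norm (u - xs) + m"
        unfolding N_def p'_def using norm_triangle_ineq[of "x' - u" "u - xs"] by simp
      then have "N\<^sup>2 \<le> (norm (x' - u) + norm (u - xs) + m)\<^sup>2" using N by (intro power_mono) auto
      also have "\<dots> \<le> 3 * ((norm (x' - u))\<^sup>2 + (norm (u - xs))\<^sup>2 + m\<^sup>2)" by (rule sum3_sq_le)
      finally show ?thesis .
    qed
    also have "m\<^sup>2 \<le> C0 * lyap D x y l"
      using C0(2)[OF D, of x y l] zero_le_power2[of "norm (y - ys)"] zero_le_power2[of "norm (x - xs)"]
        zero_le_power2[of "norm (res x y)"] unfolding m_def by linarith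
    also have "(norm (u - xs))\<^sup>2 \<le> C1 * lyap D x y l" by (rule C1(2)[OF D u])
    finally have "lyap D x' y' l' \<le> E * (3 * ((norm (x' - u))\<^sup>2 + C1 * lyap D x y l + C0 * lyap D x y l))"
      using E by simp
    also have "\<dots> \<le> E * (3 * ((C1 + C0 + 1) * (norm (x' - u))\<^sup>2 + (C1 + C0 + 1) * lyap D x y l))"
      using E C0(1) C1(1) lyap_nonneg[OF D, of x y l]
      by (intro mult_left_mono) (auto simp: distrib_right intro!: add_nonneg_nonneg)
    finally show ?thesis by (simp add: C_def algebra_simps)
  qed
  moreover have "C > 0" using E C0 C1 by (simp add: C_def)
  ultimately show ?thesis by blast
qed

text \<open>The residual \<open>w\<close> of the x-condition vanishes at the exact proximal point,
  so it is bounded by a Lipschitz constant times |x' - u|.\<close>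

lemma lyap_step:
  "\<exists>q C. 0 \<le> q \<and> q < 1 \<and> C > 0 \<and> (\<forall>D x y l u x' y' l'. admissible D \<longrightarrow> prox_point D x y l u \<longrightarrow>
     Gg y' = transpose B *v (l - \<beta> *\<^sub>R res x' y') \<longrightarrow> l' = l - (s * \<beta>) *\<^sub>R res x' y' \<longrightarrow>
     Gg y = transpose B *v (l + ((s - 1) * \<beta>) *\<^sub>R res x y) \<longrightarrow>
     lyap D x' y' l' \<le> q * lyap D x y l + C * (norm (x' - u))\<^sup>2)"
proof -
  obtain q C where qC: "0 \<le> q" "q < 1" "C > 0" "\<And>D x y l x' y' l' w. admissible D \<Longrightarrow>
     inexact_step D x y l x' y' l' w \<Longrightarrow> Gg y = transpose B *v (l + ((s - 1) * \<beta>) *\<^sub>R res x y) \<Longrightarrow>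
     lyap D x' y' l' \<le> q * lyap D x y l + C * (norm w)\<^sup>2"
    using lyap_contraction by blast
  obtain K where K: "K > 0" "\<And>D v. admissible D \<Longrightarrow> norm (xmat D *v v) \<le> K * norm v" using xmat_bound by blast
  have "lyap D x' y' l' \<le> q * lyap D x y l + (C * (\<nu> + K)\<^sup>2) * (norm (x' - u))\<^sup>2"
    if D: "admissible D" and u: "prox_point D x y l u" and y': "Gg y' = transpose B *v (l - \<beta> *\<^sub>R res x' y')"
      and l': "l' = l - (s * \<beta>) *\<^sub>R res x' y'" and y: "Gg y = transpose B *v (l + ((s - 1) * \<beta>) *\<^sub>R res x y)"
    for D x y l u x' y' l'
  proof -
    define w where "w = Gf x' + xmat D *v (x' - x) + - (transpose A *v (l - \<beta> *\<^sub>R res x y))"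
    have "inexact_step D x y l x' y' l' w"
      unfolding inexact_step_def
    proof (intro conjI y' l')
      have Ax: "A *v x' + B *v y - b = res x y + A *v (x' - x)"
        by (simp add: res_def matrix_vector_mult_diff_distrib)
      show "Gf x' = transpose A *v (l - \<beta> *\<^sub>R (A *v x' + B *v y - b)) - D *v (x' - x) + w"
        unfolding Ax by (simp add: w_def xmat_apply matrix_vector_mult_diff_distrib matrix_vector_right_distrib
            matrix_vector_mult_scaleR scaleR_add_right algebra_simps del: transpose_matrix_vector)
    qed
    then have "lyap D x' y' l' \<le> q * lyap D x y l + C * (norm w)\<^sup>2" by (rule qC(4)[OF D _ y])
    also have "(norm w)\<^sup>2 \<le> ((\<nu> + K) * norm (x' - u))\<^sup>2"
    proof (rule power_mono)
      have "w = w - (Gf u + xmat D *v (u - x) + - (transpose A *v (l - \<beta> *\<^sub>R res x y)))"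
        using u by (simp add: prox_point_def)
      also have "\<dots> = (Gf x' - Gf u) + xmat D *v (x' - u)"
        by (simp add: w_def matrix_vector_mult_diff_distrib)
      also have "norm \<dots> \<le> norm (Gf x' - Gf u) + norm (xmat D *v (x' - u))" by (rule norm_triangle_ineq)
      also have "\<dots> \<le> (\<nu> + K) * norm (x' - u)" using lip_f[of x' u] K(2)[OF D, of "x' - u"] by (simp add: distrib_right)
      finally show "norm w \<le> (\<nu> + K) * norm (x' - u)" .
    qed simp
    finally show ?thesis using qC(3) by (simp add: power_mult_distrib mult.assoc)
  qed
  moreover have "C * (\<nu> + K)\<^sup>2 > 0" using qC(3) K \<nu> by simp
  ultimately show ?thesis using qC(1,2) by blast
qed

end

section \<open>The noise of the inner loop\<close>

lemma integral_mult_of_cond_exp_const: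
  assumes "prob_space P" "subalgebra P G" "integrable P f" "AE w in P. real_cond_exp P G f w = c"
    and \<phi>: "\<phi> \<in> borel_measurable G" and int: "integrable P (\<lambda>w. \<phi> w * f w)"
  shows "(LINT w|P. \<phi> w * f w) = (LINT w|P. \<phi> w * c)"
proof -
  interpret prob_space P by fact
  interpret finite_measure_subalgebra P G by standard fact
  have [measurable]: "\<phi> \<in> borel_measurable P" by (rule measurable_from_subalg[OF assms(2) \<phi>])
  have [measurable]: "f \<in> borel_measurable P" using assms(3) by simp
  have "(LINT w|P. \<phi> w * f w) = (LINT w|P. \<phi> w * real_cond_exp P G f w)"
    by (rule real_cond_exp_intg(2)[OF int \<phi>, symmetric]) simp
  also have "\<dots> = (LINT w|P. \<phi> w * c)"
    by (rule integral_cong_AE) (use assms(4) in auto)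
  finally show ?thesis .
qed

lemma cond_exp_indicator_indep:
  assumes "prob_space P" "subalgebra P G" "E \<in> sets P"
    and "\<And>A. A \<in> sets G \<Longrightarrow> measure P (A \<inter> E) = measure P A * measure P E"
  shows "AE w in P. real_cond_exp P G (indicator E) w = measure P E"
proof -
  interpret prob_space P by fact
  interpret finite_measure_subalgebra P G by standard fact
  show ?thesis
  proof (rule real_cond_exp_charact)
    fix A assume A: "A \<in> sets G"
    then have [measurable]: "A \<in> sets P" using assms(2) by (auto simp: subalgebra_def)
    have "(LINT w:A|P. indicator E w) = (LINT w|P. indicator (A \<inter> E) w)"
      unfolding set_lebesgue_integral_def by (rule Bochner_Integration.integral_cong) (auto simp: indicator_def)
    also have "\<dots> = measure P (A \<inter> E)" using assms(3) sets.sets_into_space[of A P]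
      by (simp add: Int_absorb2 sets.Int)
    also have "\<dots> = (LINT w:A|P. measure P E)"
      using assms(4)[OF A] sets.sets_into_space[of A P]
      by (simp add: set_lebesgue_integral_def Int_absorb2)
    finally show "(LINT w:A|P. indicator E w) = (LINT w:A|P. measure P E)" .
  qed (use assms(3) in \<open>auto intro!: integrable_real_indicator simp: less_top[symmetric]\<close>)
qed

text \<open>Sample and error are treated separately, since the error may depend on the sample of its
  own step. Splitting by the value of the sample, each term is a bounded \<open>G\<close>-measurable
  function times the indicator of an event that is independent of \<open>G\<close> and has
  probability 1 / N. The gradients are bounded where \<open>Q\<close> is nonzero because they are
  continuous and \<open>xh\<close> lies in a ball there.\<close>

lemma oracle_mean_zero_bounded:
  fixes e Q xh :: "'w \<Rightarrow> real^'n" and gj :: "nat \<Rightarrow> real^'n \<Rightarrow> real^'n"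
  assumes P: "prob_space P" "subalgebra P G" and N: "N > 0"
    and \<xi>: "\<xi> \<in> P \<rightarrow>\<^sub>M count_space {1..N}" "\<And>j. j \<in> {1..N} \<Longrightarrow> measure P {w \<in> space P. \<xi> w = j} = 1 / real N"
      "prob_space.indep_set P (sets G) {\<xi> -` J \<inter> space P | J. J \<subseteq> {1..N}}"
    and e: "integrable P e" "\<And>i. AE w in P. real_cond_exp P G (\<lambda>w. e w $ i) w = 0"
    and gj: "\<And>j. j \<in> {1..N} \<Longrightarrow> continuous_on UNIV (gj j)"
    and xh: "xh \<in> borel_measurable G"
    and Q: "Q \<in> borel_measurable G" "\<And>w. norm (Q w) \<le> R" "\<And>w. Q w \<noteq> 0 \<Longrightarrow> norm (xh w) \<le> R"
  shows "(LINT w|P. Q w \<bullet> ((1 / real N) *\<^sub>R (\<Sum>j=1..N. gj j (xh w)) - gj (\<xi> w) (xh w) - e w)) = 0"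
proof -
  interpret prob_space P by fact
  have R: "R \<ge> 0" using Q(2)[of undefined] norm_ge_zero order_trans by blast
  define \<phi> where "\<phi> j w = Q w \<bullet> gj j (xh w)" for j w
  define E where "E j = {w \<in> space P. \<xi> w = j}" for j
  have E: "E j \<in> sets P" "measure P (E j) = 1 / real N" if "j \<in> {1..N}" for j
  proof -
    have "E j = \<xi> -` {j} \<inter> space P" by (auto simp: E_def)
    then show "E j \<in> sets P" using measurable_sets[OF \<xi>(1), of "{j}"] that by simp
    show "measure P (E j) = 1 / real N" unfolding E_def by (rule \<xi>(2)[OF that])
  qed
  have \<phi>G: "\<phi> j \<in> borel_measurable G" if j: "j \<in> {1..N}" for j
  proof -
    have "(\<lambda>w. gj j (xh w)) \<in> borel_measurable G"
      by (rule borel_measurable_continuous_on[OF gj[OF j] xh])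
    then show ?thesis unfolding \<phi>_def using Q(1) by measurable
  qed
  have \<phi>b: "\<exists>K. \<forall>w. \<bar>\<phi> j w\<bar> \<le> K" if j: "j \<in> {1..N}" for j
  proof -
    have "compact (gj j ` cball 0 R)"
      using gj[OF j] by (intro compact_continuous_image) (auto intro: continuous_on_subset)
    then obtain K where K: "\<And>v. norm v \<le> R \<Longrightarrow> norm (gj j v) \<le> K"
      by (force dest: compact_imp_bounded simp: bounded_iff)
    have "\<bar>\<phi> j w\<bar> \<le> R * max K 0" for w
    proof (cases "Q w = 0")
      case False
      have "\<bar>\<phi> j w\<bar> \<le> norm (Q w) * norm (gj j (xh w))" unfolding \<phi>_def by (rule Cauchy_Schwarz_ineq2)
      also have "\<dots> \<le> R * max K 0" using Q(2)[of w] K[OF Q(3)[OF False]] R by (intro mult_mono) auto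
      finally show ?thesis .
    qed (use R in \<open>simp add: \<phi>_def\<close>)
    then show ?thesis by blast
  qed
  have \<phi>i: "integrable P (\<phi> j)" if j: "j \<in> {1..N}" for j
  proof -
    obtain K where "\<bar>\<phi> j w\<bar> \<le> K" for w using \<phi>b[OF j] by blast
    then show ?thesis using measurable_from_subalg[OF P(2) \<phi>G[OF j]]
      by (intro integrable_const_bound[of _ K]) auto
  qed
  have \<phi>Ei: "integrable P (\<lambda>w. \<phi> j w * indicator (E j) w)" if j: "j \<in> {1..N}" for j
    using \<phi>i[OF j] E(1)[OF j] by (intro integrable_real_mult_indicator) auto
  have \<phi>E: "(LINT w|P. \<phi> j w * indicator (E j) w) = (LINT w|P. \<phi> j w) / real N" if j: "j \<in> {1..N}" for j
  proof -
    have "AE w in P. real_cond_exp P G (indicator (E j)) w = measure P (E j)"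
    proof (rule cond_exp_indicator_indep[OF P E(1)[OF j]])
      fix A assume A: "A \<in> sets G"
      have "E j = \<xi> -` {j} \<inter> space P" by (auto simp: E_def)
      then have "E j \<in> {\<xi> -` J \<inter> space P | J. J \<subseteq> {1..N}}" using j by blast
      then show "prob (A \<inter> E j) = prob A * prob (E j)" by (rule indep_setD[OF \<xi>(3) A])
    qed
    then have "(LINT w|P. \<phi> j w * indicator (E j) w) = (LINT w|P. \<phi> j w * measure P (E j))"
      using E(1)[OF j]
      by (intro integral_mult_of_cond_exp_const[OF P _ _ \<phi>G[OF j] \<phi>Ei[OF j]] integrable_real_indicator)
         (auto simp: less_top[symmetric])
    then show ?thesis using E(2)[OF j] by simp
  qed
  have Qi: "(\<lambda>w. Q w $ i) \<in> borel_measurable G" for i using Q(1) by measurable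
  have ei: "integrable P (\<lambda>w. e w $ i)" for i
    using integrable_inner_left[of "axis i 1" P e] e(1) by (simp add: inner_axis)
  have Qei: "integrable P (\<lambda>w. Q w $ i * e w $ i)" for i
  proof (rule Bochner_Integration.integrable_bound[where f = "\<lambda>w. R * (e w $ i)"])
    show "(\<lambda>w. Q w $ i * e w $ i) \<in> borel_measurable P"
      using measurable_from_subalg[OF P(2) Qi[of i]] borel_measurable_integrable[OF ei[of i]] by measurable
    show "AE w in P. norm (Q w $ i * e w $ i) \<le> norm (R * e w $ i)"
    proof (rule AE_I2)
      fix w
      have "\<bar>Q w $ i\<bar> \<le> R" using component_le_norm_cart[of "Q w" i] Q(2)[of w] by linarith
      then show "norm (Q w $ i * e w $ i) \<le> norm (R * e w $ i)"
        using R by (simp add: abs_mult mult_right_mono)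
    qed
  qed (use ei in simp)
  have Qe: "(LINT w|P. Q w \<bullet> e w) = 0" and Qe_int: "integrable P (\<lambda>w. Q w \<bullet> e w)"
  proof -
    have "(LINT w|P. Q w \<bullet> e w) = (\<Sum>i\<in>UNIV. LINT w|P. Q w $ i * e w $ i)"
      unfolding inner_vec_def using Qei by (subst Bochner_Integration.integral_sum[symmetric]) auto
    also have "\<dots> = 0"
      using integral_mult_of_cond_exp_const[OF P ei e(2) Qi Qei] by simp
    finally show "(LINT w|P. Q w \<bullet> e w) = 0" .
    show "integrable P (\<lambda>w. Q w \<bullet> e w)"
      unfolding inner_vec_def using Qei by auto
  qed
  have "(LINT w|P. Q w \<bullet> ((1 / real N) *\<^sub>R (\<Sum>j=1..N. gj j (xh w)) - gj (\<xi> w) (xh w) - e w))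
    = (LINT w|P. (\<Sum>j=1..N. \<phi> j w / real N - \<phi> j w * indicator (E j) w) - Q w \<bullet> e w)"
  proof (rule Bochner_Integration.integral_cong[OF refl])
    fix w assume w: "w \<in> space P"
    then have xw: "\<xi> w \<in> {1..N}" using measurable_space[OF \<xi>(1)] by auto
    have "(\<Sum>j=1..N. \<phi> j w * indicator (E j) w) = (\<Sum>j=1..N. if j = \<xi> w then \<phi> j w else 0)"
      using w by (intro sum.cong) (auto simp: E_def)
    also have "\<dots> = \<phi> (\<xi> w) w" using xw by simp
    finally have "(\<Sum>j=1..N. \<phi> j w * indicator (E j) w) = \<phi> (\<xi> w) w" .
    then show "Q w \<bullet> ((1 / real N) *\<^sub>R (\<Sum>j=1..N. gj j (xh w)) - gj (\<xi> w) (xh w) - e w)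
      = (\<Sum>j=1..N. \<phi> j w / real N - \<phi> j w * indicator (E j) w) - Q w \<bullet> e w"
      by (simp add: inner_diff_right inner_sum_right sum_subtractf sum_divide_distrib \<phi>_def)
  qed
  also have "\<dots> = (\<Sum>j=1..N. (LINT w|P. \<phi> j w) / real N - (LINT w|P. \<phi> j w * indicator (E j) w)) - (LINT w|P. Q w \<bullet> e w)"
    using \<phi>i \<phi>Ei Qe_int by (subst Bochner_Integration.integral_diff) auto
  also have "\<dots> = 0" using \<phi>E Qe by simp
  finally show ?thesis .
qed

text \<open>The gradients at \<open>xh\<close> may fail to be integrable one by one; only their
  combination with \<open>Q\<close> is. Cutting \<open>Q\<close> off where \<open>Q\<close> or
  \<open>xh\<close> is large is a decision known before the sample, so the bounded case applies to
  each truncation, and the absolute value of the full product dominates the limit.\<close>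

lemma oracle_mean_zero:
  fixes e Q xh :: "'w \<Rightarrow> real^'n" and gj :: "nat \<Rightarrow> real^'n \<Rightarrow> real^'n"
  assumes P: "prob_space P" "subalgebra P G" and N: "N > 0"
    and \<xi>: "\<xi> \<in> P \<rightarrow>\<^sub>M count_space {1..N}" "\<And>j. j \<in> {1..N} \<Longrightarrow> measure P {w \<in> space P. \<xi> w = j} = 1 / real N"
      "prob_space.indep_set P (sets G) {\<xi> -` J \<inter> space P | J. J \<subseteq> {1..N}}"
    and e: "integrable P e" "\<And>i. AE w in P. real_cond_exp P G (\<lambda>w. e w $ i) w = 0"
    and gj: "\<And>j. j \<in> {1..N} \<Longrightarrow> continuous_on UNIV (gj j)"
    and xh: "xh \<in> borel_measurable G" and E: "E \<in> sets G"
    and dl: "\<And>w. w \<in> space P \<Longrightarrow> dl w = indicator E w *\<^sub>R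
        ((1 / real N) *\<^sub>R (\<Sum>j=1..N. gj j (xh w)) - gj (\<xi> w) (xh w) - e w)"
    and dlm: "dl \<in> borel_measurable P"
    and Q: "Q \<in> borel_measurable G" "integrable P (\<lambda>w. Q w \<bullet> dl w)"
  shows "(LINT w|P. Q w \<bullet> dl w) = 0"
proof -
  interpret prob_space P by fact
  define Qn where "Qn n w = (if norm (Q w) \<le> real n \<and> norm (xh w) \<le> real n then indicator E w *\<^sub>R Q w else 0)" for n w
  note [measurable] = xh Q(1) E
  have QnG: "Qn n \<in> borel_measurable G" for n unfolding Qn_def by measurable
  have QnP: "Qn n \<in> borel_measurable P" for n by (rule measurable_from_subalg[OF P(2) QnG])
  have zero: "(LINT w|P. Qn n w \<bullet> dl w) = 0" for n
  proof -
    have "(LINT w|P. Qn n w \<bullet> dl w)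
      = (LINT w|P. Qn n w \<bullet> ((1 / real N) *\<^sub>R (\<Sum>j=1..N. gj j (xh w)) - gj (\<xi> w) (xh w) - e w))"
      by (rule Bochner_Integration.integral_cong[OF refl]) (auto simp: dl Qn_def indicator_def)
    also have "\<dots> = 0"
      by (rule oracle_mean_zero_bounded[OF P N \<xi> e gj xh QnG, where R = "real n"])
         (auto simp: Qn_def indicator_def split: if_splits)
    finally show ?thesis .
  qed
  have "(\<lambda>n. LINT w|P. Qn n w \<bullet> dl w) \<longlonglongrightarrow> (LINT w|P. Q w \<bullet> dl w)"
  proof (rule integral_dominated_convergence[where w = "\<lambda>w. \<bar>Q w \<bullet> dl w\<bar>"])
    show "(\<lambda>w. Q w \<bullet> dl w) \<in> borel_measurable P" using Q(2) by simp
    show "(\<lambda>w. Qn n w \<bullet> dl w) \<in> borel_measurable P" for n using QnP[of n] dlm by measurable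
    show "integrable P (\<lambda>w. \<bar>Q w \<bullet> dl w\<bar>)" using Q(2) by simp
    show "AE w in P. (\<lambda>n. Qn n w \<bullet> dl w) \<longlonglongrightarrow> Q w \<bullet> dl w"
    proof (rule AE_I2)
      fix w assume w: "w \<in> space P"
      obtain m where m: "max (norm (Q w)) (norm (xh w)) \<le> real m" using real_arch_simple by blast
      have "\<forall>\<^sub>F n in sequentially. Qn n w \<bullet> dl w = Q w \<bullet> dl w"
        unfolding eventually_sequentially
      proof (intro exI[of _ m] allI impI)
        fix n assume "m \<le> n"
        then have "real m \<le> real n" by simp
        then show "Qn n w \<bullet> dl w = Q w \<bullet> dl w" using m w by (auto simp: Qn_def dl indicator_def)
      qed
      then show "(\<lambda>n. Qn n w \<bullet> dl w) \<longlonglongrightarrow> Q w \<bullet> dl w" by (rule tendsto_eventually)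
    qed
    show "AE w in P. norm (Qn n w \<bullet> dl w) \<le> \<bar>Q w \<bullet> dl w\<bar>" for n
      by (rule AE_I2) (auto simp: Qn_def dl indicator_def)
  qed
  then show ?thesis unfolding zero using LIMSEQ_unique tendsto_const by blast
qed

text \<open>After exchanging sums, \<open>v j\<close> has the weight j^2 times a tail of t^-3, which
  stays bounded. The extra term with (m + 1)^-2 is the reserve of the induction: 1 / (n + 1)^3 + 1 /
  (n + 1)^2 \<le> 1 / n^2. It also covers the noise left in the final average.\<close>

lemma weighted_partial_sums_le:
  fixes v :: "nat \<Rightarrow> real"
  assumes v: "\<And>t. v t \<ge> 0"
  defines "T \<equiv> \<lambda>t. \<Sum>j=1..<t. (real j)\<^sup>2 * v j"
  shows "(\<Sum>t=1..Suc m. T t / real t ^ 3) + T (Suc (Suc m)) / (real (Suc m))\<^sup>2 \<le> (\<Sum>t=1..Suc m. v t)"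
proof (induction m)
  case 0
  then show ?case by (simp add: T_def)
next
  case (Suc m)
  define n where "n = real (Suc m)"
  have n: "n > 0" by (simp add: n_def)
  have T0: "T t \<ge> 0" for t unfolding T_def by (intro sum_nonneg mult_nonneg_nonneg) (auto simp: v)
  have TS: "T (Suc (Suc (Suc m))) = T (Suc (Suc m)) + (n + 1)\<^sup>2 * v (Suc (Suc m))"
    by (simp add: T_def n_def add.commute)
  have "1 / (n + 1) ^ 3 + 1 / (n + 1)\<^sup>2 \<le> 1 / n\<^sup>2"
  proof -
    have "1 / (n + 1) ^ 3 + 1 / (n + 1)\<^sup>2 = (n + 2) / (n + 1) ^ 3"
      using n by (simp add: power2_eq_square power3_eq_cube divide_simps)
    also have "\<dots> \<le> 1 / n\<^sup>2"
    proof -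
      have "n\<^sup>2 * (n + 2) \<le> (n + 1) ^ 3"
        using n by (simp add: power2_eq_square power3_eq_cube algebra_simps)
      then show ?thesis using n by (simp add: divide_simps mult.commute)
    qed
    finally show ?thesis .
  qed
  from mult_left_mono[OF this T0[of "Suc (Suc m)"]]
  have k: "T (Suc (Suc m)) / (n + 1) ^ 3 + T (Suc (Suc m)) / (n + 1)\<^sup>2 \<le> T (Suc (Suc m)) / n\<^sup>2"
    by (simp add: distrib_left)
  have "(\<Sum>t=1..Suc (Suc m). T t / real t ^ 3) + T (Suc (Suc (Suc m))) / (real (Suc (Suc m)))\<^sup>2
     = (\<Sum>t=1..Suc m. T t / real t ^ 3) + T (Suc (Suc m)) / (n + 1) ^ 3
       + (T (Suc (Suc m)) + (n + 1)\<^sup>2 * v (Suc (Suc m))) / (n + 1)\<^sup>2"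
    unfolding TS[symmetric] by (simp add: n_def add.commute)
  also have "\<dots> = (\<Sum>t=1..Suc m. T t / real t ^ 3) + (T (Suc (Suc m)) / (n + 1) ^ 3 + T (Suc (Suc m)) / (n + 1)\<^sup>2) + v (Suc (Suc m))"
    using n by (simp add: add_divide_distrib)
  also have "\<dots> \<le> (\<Sum>t=1..Suc m. T t / real t ^ 3) + T (Suc (Suc m)) / n\<^sup>2 + v (Suc (Suc m))"
    using k by simp
  also have "\<dots> \<le> (\<Sum>t=1..Suc m. v t) + v (Suc (Suc m))" using Suc by (simp add: n_def)
  finally show ?case by simp
qed

text \<open>A single outer iteration: \<open>M\<close>, \<eta> and \<open>Q\<close> are random but
  known at time 1 of the filtration \<open>G\<close>. \<open>dl_zero\<close> is the martingale
  property in weak form, as orthogonality to every field of the past whose product with the noise is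
  integrable.\<close>

locale inner_noise =
  fixes P :: "'w measure" and G :: "nat \<Rightarrow> 'w measure" and M :: "'w \<Rightarrow> nat" and \<eta> :: "'w \<Rightarrow> real"
    and Q :: "'w \<Rightarrow> real^'n^'n" and H :: "real^'n^'n" and dl :: "nat \<Rightarrow> 'w \<Rightarrow> real^'n" and hmin \<sigma>2 :: real
  assumes P: "prob_space P"
    and subP: "\<And>t. t \<ge> 1 \<Longrightarrow> subalgebra P (G t)"
    and subG: "\<And>t. t \<ge> 1 \<Longrightarrow> subalgebra (G (Suc t)) (G t)"
    and M: "M \<in> G 1 \<rightarrow>\<^sub>M count_space UNIV" and \<eta>: "\<eta> \<in> borel_measurable (G 1)" and Q: "Q \<in> borel_measurable (G 1)"
    and H: "transpose H = H" "hmin > 0" "\<And>v. hmin * (norm v)\<^sup>2 \<le> v \<bullet> (H *v v)"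
    and Qpos: "\<And>w v. w \<in> space P \<Longrightarrow> 0 \<le> v \<bullet> (Q w *v v)"
    and \<eta>pos: "\<And>w. w \<in> space P \<Longrightarrow> \<eta> w > 0" and Mpos: "\<And>w. w \<in> space P \<Longrightarrow> M w > 0"
    and dl: "\<And>t. t \<ge> 1 \<Longrightarrow> dl t \<in> borel_measurable (G (Suc t))"
    and dl_sq: "\<And>t. t \<ge> 1 \<Longrightarrow> integrable P (\<lambda>w. (norm (dl t w))\<^sup>2)"
      "\<And>t. t \<ge> 1 \<Longrightarrow> (LINT w|P. (norm (dl t w))\<^sup>2) \<le> \<sigma>2"
    and dl_zero: "\<And>t q. t \<ge> 1 \<Longrightarrow> q \<in> borel_measurable (G t) \<Longrightarrow> integrable P (\<lambda>w. q w \<bullet> dl t w)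
      \<Longrightarrow> (LINT w|P. q w \<bullet> dl t w) = 0"
begin

sublocale prob_space P by (rule P)

text \<open>Both recursions start one index before the loop. The weight \<open>real 0\<close>
  removes the unspecified value \<open>dl 0\<close>, so both sequences vanish at index 1.\<close>

primrec S :: "nat \<Rightarrow> 'w \<Rightarrow> real^'n" where
  "S 0 w = 0"
| "S (Suc t) w = S t w + real t *\<^sub>R dl t w"

primrec U :: "nat \<Rightarrow> 'w \<Rightarrow> real^'n" where
  "U 0 w = 0"
| "U (Suc t) w = cramer_solve (2 *\<^sub>R H + (real t * \<eta> w) *\<^sub>R Q w) (2 *\<^sub>R (H *v U t w) + real t *\<^sub>R dl t w)"

lemma system_pos:
  assumes "w \<in> space P" "v \<noteq> 0"
  shows "0 < v \<bullet> ((2 *\<^sub>R H + (real t * \<eta> w) *\<^sub>R Q w) *v v)"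
proof -
  have "0 < hmin * (norm v)\<^sup>2" using assms H by simp
  also have "\<dots> \<le> v \<bullet> (H *v v)" by (rule H(3))
  finally have "0 < v \<bullet> (H *v v)" .
  moreover have "0 \<le> (real t * \<eta> w) * (v \<bullet> (Q w *v v))"
    using Qpos[OF assms(1)] \<eta>pos[OF assms(1)] by simp
  ultimately show ?thesis
    by (simp add: matrix_vector_mult_add_rdistrib scaleR_matrix_vector_assoc[symmetric] inner_add_right add_pos_nonneg)
qed

lemma U_eq:
  assumes "w \<in> space P"
  shows "2 *\<^sub>R (H *v U (Suc t) w) + (real t * \<eta> w) *\<^sub>R (Q w *v U (Suc t) w) = 2 *\<^sub>R (H *v U t w) + real t *\<^sub>R dl t w"
  using cramer_solve(1)[OF system_pos[OF assms], of t "2 *\<^sub>R (H *v U t w) + real t *\<^sub>R dl t w"]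
  by (simp add: matrix_vector_mult_add_rdistrib scaleR_matrix_vector_assoc[symmetric])

lemma S_1: "S 1 w = 0" by simp

lemma U_1:
  assumes "w \<in> space P"
  shows "U 1 w = 0"
  using cramer_solve(2)[OF system_pos[OF assms, where t = 0], where z = 0 and r = 0, symmetric] by simp

lemma sub_mono:
  assumes t: "1 \<le> t" and tu: "t \<le> u"
  shows "subalgebra (G u) (G t)"
  using tu
proof (induction u rule: dec_induct)
  case base then show ?case by (simp add: subalgebra_def)
next
  case (step n)
  then show ?case using subG[of n] t by (auto simp: subalgebra_def)
qed

lemma meas_mono: "1 \<le> t \<Longrightarrow> t \<le> u \<Longrightarrow> g \<in> G t \<rightarrow>\<^sub>M N \<Longrightarrow> g \<in> G u \<rightarrow>\<^sub>M N"
  using measurable_from_subalg[OF sub_mono] by blast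

lemma measP: "1 \<le> t \<Longrightarrow> g \<in> G t \<rightarrow>\<^sub>M N \<Longrightarrow> g \<in> P \<rightarrow>\<^sub>M N"
  using measurable_from_subalg[OF subP] by blast

lemma S_adapted: "t \<ge> 1 \<Longrightarrow> S t \<in> borel_measurable (G t)"
proof (induction t rule: nat_induct_at_least)
  case base then show ?case by simp
next
  case (Suc t)
  have [measurable]: "S t \<in> borel_measurable (G (Suc t))" by (rule meas_mono[OF Suc(1) _ Suc(2)]) simp
  have [measurable]: "dl t \<in> borel_measurable (G (Suc t))" by (rule dl[OF Suc(1)])
  have "(\<lambda>w. S (Suc t) w) \<in> borel_measurable (G (Suc t))" unfolding S.simps by measurable
  then show ?case .
qed

lemma U_adapted: "t \<ge> 1 \<Longrightarrow> U t \<in> borel_measurable (G t)"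
proof (induction t rule: nat_induct_at_least)
  case base
  have "space (G 1) = space P" using subP[of 1] by (simp add: subalgebra_def)
  then show ?case using U_1 by (subst measurable_cong[where g = "\<lambda>_. 0"]) auto
next
  case (Suc t)
  have [measurable]: "U t \<in> borel_measurable (G (Suc t))" by (rule meas_mono[OF Suc(1) _ Suc(2)]) simp
  have [measurable]: "\<eta> \<in> borel_measurable (G (Suc t))" "Q \<in> borel_measurable (G (Suc t))"
    by (rule meas_mono[OF _ _ \<eta>], simp_all) (rule meas_mono[OF _ _ Q], simp_all)
  have [measurable]: "dl t \<in> borel_measurable (G (Suc t))" by (rule dl[OF Suc(1)])
  have "(\<lambda>w. U (Suc t) w) \<in> borel_measurable (G (Suc t))" unfolding U.simps by measurable
  then show ?case .
qed

text \<open>The cross term in the step of \<open>V\<close> is linear in \<open>dl t\<close>, so it vanishes in expectation, also on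
  the events \<open>M = m\<close>, which are known before the inner loop starts.\<close>

definition "V t w = (norm (S t w))\<^sup>2 + U t w \<bullet> (H *v U t w)"

definition "W t w = (norm (S t w))\<^sup>2 + (norm (U t w))\<^sup>2"

definition "K1 = 1 + 1 / (4 * hmin)"

lemma K1: "K1 > 0" using H by (simp add: K1_def add_pos_pos)

lemma H_nonneg: "0 \<le> x \<bullet> (H *v x)"
proof -
  have "0 \<le> hmin * (norm x)\<^sup>2" using H(2) by simp
  also have "\<dots> \<le> x \<bullet> (H *v x)" by (rule H(3))
  finally show ?thesis .
qed

lemma V_nonneg: "0 \<le> V t w"
  using H_nonneg[of "U t w"] by (simp add: V_def)

lemma W_le_V: "W t w \<le> (1 + 1 / hmin) * V t w"
proof -
  have "(norm (U t w))\<^sup>2 \<le> (U t w \<bullet> (H *v U t w)) / hmin" using H(2) H(3)[of "U t w"] by (simp add: field_simps)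
  moreover have "0 \<le> (norm (S t w))\<^sup>2 / hmin" "0 \<le> U t w \<bullet> (H *v U t w)"
    using H(2) H_nonneg[of "U t w"] by auto
  ultimately show ?thesis by (simp add: W_def V_def distrib_left distrib_right add_divide_distrib)
qed

lemma W_nonneg: "0 \<le> W t w" by (simp add: W_def)

text \<open>Testing the equation of \<open>U\<close> with its new value yields a noise product at
  the new value. It is moved to the old value, which belongs to the past, and the difference is
  absorbed by the \<open>H\<close>-form of the increment; this costs the 1 / (4 hmin) in
  \<open>K1\<close>.\<close>

lemma V_step:
  assumes w: "w \<in> space P"
  shows "V (Suc t) w \<le> V t w + real t * ((2 *\<^sub>R S t w + U t w) \<bullet> dl t w) + K1 * ((real t)\<^sup>2 * (norm (dl t w))\<^sup>2)"
proof -
  define u where "u = U t w"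
  define u' where "u' = U (Suc t) w"
  define d where "d = dl t w"
  have "u' \<bullet> (2 *\<^sub>R (H *v u') + (real t * \<eta> w) *\<^sub>R (Q w *v u')) = u' \<bullet> (2 *\<^sub>R (H *v u) + real t *\<^sub>R d)"
    unfolding u_def u'_def d_def U_eq[OF w] ..
  then have e: "2 * (u' \<bullet> (H *v u')) + (real t * \<eta> w) * (u' \<bullet> (Q w *v u')) = 2 * (u' \<bullet> (H *v u)) + real t * (u' \<bullet> d)"
    by (simp add: inner_add_right)
  have nn: "0 \<le> (real t * \<eta> w) * (u' \<bullet> (Q w *v u'))"
    using Qpos[OF w] \<eta>pos[OF w] by simp
  have sym: "u \<bullet> (H *v u') = u' \<bullet> (H *v u)"
    using matrix_inner_transpose[of u H u'] H(1) by (simp add: inner_commute)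
  have q: "(u' - u) \<bullet> (H *v (u' - u)) = u' \<bullet> (H *v u') - 2 * (u' \<bullet> (H *v u)) + u \<bullet> (H *v u)"
    by (simp add: matrix_vector_mult_diff_distrib inner_diff_left inner_diff_right sym)
  have "real t * ((u' - u) \<bullet> d) \<le> norm (u' - u) * (real t * norm d)"
    using mult_left_mono[OF norm_cauchy_schwarz[of "u' - u" d], of "real t"] by (simp add: mult_ac)
  also have "\<dots> \<le> hmin * (norm (u' - u))\<^sup>2 + (real t * norm d)\<^sup>2 / (4 * hmin)"
    using two_mult_le_weighted[of "2 * hmin" "norm (u' - u)" "real t * norm d"] H(2) by simp
  also have "\<dots> \<le> (u' - u) \<bullet> (H *v (u' - u)) + (real t * norm d)\<^sup>2 / (4 * hmin)"
    using H(3)[of "u' - u"] by simp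
  finally have 1: "u' \<bullet> (H *v u') \<le> u \<bullet> (H *v u) + real t * (u \<bullet> d) + (real t * norm d)\<^sup>2 / (4 * hmin)"
    using e nn q by (simp add: inner_diff_left right_diff_distrib)
  have 2: "(norm (S (Suc t) w))\<^sup>2 = (norm (S t w))\<^sup>2 + real t * (2 * (S t w \<bullet> d)) + (real t)\<^sup>2 * (norm d)\<^sup>2"
    unfolding power2_norm_eq_inner
    by (simp add: d_def inner_add_left inner_add_right inner_commute power2_eq_square algebra_simps)
  have 3: "K1 * ((real t)\<^sup>2 * (norm d)\<^sup>2) = (real t)\<^sup>2 * (norm d)\<^sup>2 + (real t * norm d)\<^sup>2 / (4 * hmin)"
    by (simp add: K1_def distrib_right power_mult_distrib)
  show ?thesis unfolding V_def 2 d_def[symmetric] u_def[symmetric] u'_def[symmetric] 3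
    using 1 by (simp add: inner_add_left distrib_left)
qed

lemma V_meas [measurable]: "t \<ge> 1 \<Longrightarrow> V t \<in> borel_measurable P"
  unfolding V_def using measP[OF _ S_adapted, of t] measP[OF _ U_adapted, of t] by simp

lemma W_meas: "t \<ge> 1 \<Longrightarrow> W t \<in> borel_measurable P"
  unfolding W_def using measP[OF _ S_adapted, of t] measP[OF _ U_adapted, of t] by simp

lemma dl_measP: "t \<ge> 1 \<Longrightarrow> dl t \<in> borel_measurable P"
  using measP[OF _ dl, of t] by simp

lemma cross_integrable:
  assumes t: "t \<ge> 1" and V: "integrable P (V t)"
  shows "integrable P (\<lambda>w. (2 *\<^sub>R S t w + U t w) \<bullet> dl t w)"
proof (rule Bochner_Integration.integrable_bound)
  let ?C = "8 * (1 + 1 / hmin)"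
  show "integrable P (\<lambda>w. ?C * V t w + (norm (dl t w))\<^sup>2)" using V dl_sq(1)[OF t] by auto
  show "(\<lambda>w. (2 *\<^sub>R S t w + U t w) \<bullet> dl t w) \<in> borel_measurable P"
    using measP[OF t S_adapted[OF t]] measP[OF t U_adapted[OF t]] dl_measP[OF t] by measurable
  show "AE w in P. norm ((2 *\<^sub>R S t w + U t w) \<bullet> dl t w) \<le> norm (?C * V t w + (norm (dl t w))\<^sup>2)"
  proof (rule AE_I2)
    fix w
    have "\<bar>(2 *\<^sub>R S t w + U t w) \<bullet> dl t w\<bar> \<le> norm (2 *\<^sub>R S t w + U t w) * norm (dl t w)"
      by (rule Cauchy_Schwarz_ineq2)
    also have "\<dots> \<le> (norm (2 *\<^sub>R S t w + U t w))\<^sup>2 + (norm (dl t w))\<^sup>2"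
      using sum_squares_bound[of "norm (2 *\<^sub>R S t w + U t w)" "norm (dl t w)"]
        mult_nonneg_nonneg[OF norm_ge_zero[of "2 *\<^sub>R S t w + U t w"] norm_ge_zero[of "dl t w"]] by linarith
    also have "(norm (2 *\<^sub>R S t w + U t w))\<^sup>2 \<le> 2 * (norm (2 *\<^sub>R S t w))\<^sup>2 + 2 * (norm (U t w))\<^sup>2"
      by (rule norm_add_sq_le)
    also have "\<dots> \<le> 8 * W t w" by (simp add: W_def)
    also have "\<dots> \<le> ?C * V t w" using W_le_V[of t w] unfolding mult.assoc by (intro mult_left_mono) auto
    finally show "norm ((2 *\<^sub>R S t w + U t w) \<bullet> dl t w) \<le> norm (?C * V t w + (norm (dl t w))\<^sup>2)"
      using H(2) V_nonneg[of t w] by (simp add: mult_nonneg_nonneg)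
  qed
qed

lemma V_integrable: "t \<ge> 1 \<Longrightarrow> integrable P (V t)"
proof (induction t rule: nat_induct_at_least)
  case base
  have "integrable P (V 1) \<longleftrightarrow> integrable P (\<lambda>w. 0 :: real)"
    by (intro Bochner_Integration.integrable_cong) (auto simp: V_def U_1[simplified])
  then show ?case by simp
next
  case (Suc t)
  show ?case
  proof (rule Bochner_Integration.integrable_bound)
    show "integrable P (\<lambda>w. V t w + real t * ((2 *\<^sub>R S t w + U t w) \<bullet> dl t w) + K1 * ((real t)\<^sup>2 * (norm (dl t w))\<^sup>2))"
      using Suc cross_integrable[OF Suc] dl_sq(1)[OF Suc(1)] by auto
    show "AE w in P. norm (V (Suc t) w) \<le> norm (V t w + real t * ((2 *\<^sub>R S t w + U t w) \<bullet> dl t w) + K1 * ((real t)\<^sup>2 * (norm (dl t w))\<^sup>2))"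
    proof (rule AE_I2)
      fix w assume "w \<in> space P"
      from V_step[OF this, of t] show "norm (V (Suc t) w) \<le> norm (V t w + real t * ((2 *\<^sub>R S t w + U t w) \<bullet> dl t w) + K1 * ((real t)\<^sup>2 * (norm (dl t w))\<^sup>2))"
        using V_nonneg[of "Suc t" w] unfolding real_norm_def by linarith
    qed
  qed (simp add: V_meas)
qed

definition "I m w = (indicator {m} (M w) :: real)"

lemma I_meas: "t \<ge> 1 \<Longrightarrow> I m \<in> borel_measurable (G t)"
proof -
  assume t: "t \<ge> 1"
  have "M \<in> G t \<rightarrow>\<^sub>M count_space UNIV" by (rule meas_mono[OF _ t M]) simp
  then show ?thesis unfolding I_def[abs_def] by (rule measurable_compose) simp
qed

lemma I_int: "integrable P f \<Longrightarrow> integrable P (\<lambda>w. I m w * f w :: real)"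
proof (rule Bochner_Integration.integrable_bound)
  assume f: "integrable P f"
  then show "(\<lambda>w. I m w * f w) \<in> borel_measurable P"
    using measP[OF _ I_meas[of 1 m]] borel_measurable_integrable[OF f] by measurable
qed (auto simp: I_def indicator_def)

definition "v m t = (LINT w|P. I m w * (norm (dl t w))\<^sup>2)"

lemma v_nonneg: "0 \<le> v m t"
  unfolding v_def by (rule Bochner_Integration.integral_nonneg) (simp add: I_def)

lemma V_expect:
  "t \<ge> 1 \<Longrightarrow> (LINT w|P. I m w * V t w) \<le> K1 * (\<Sum>j=1..<t. (real j)\<^sup>2 * v m j)"
proof (induction t rule: nat_induct_at_least)
  case base
  have "(LINT w|P. I m w * V 1 w) = (LINT w|P. 0)"
    by (intro Bochner_Integration.integral_cong) (auto simp: V_def U_1[simplified])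
  then show ?case by simp
next
  case (Suc t)
  let ?q = "\<lambda>w. I m w *\<^sub>R (2 *\<^sub>R S t w + U t w)"
  have qi: "integrable P (\<lambda>w. I m w * ((2 *\<^sub>R S t w + U t w) \<bullet> dl t w))"
    by (rule I_int[OF cross_integrable[OF Suc(1) V_integrable[OF Suc(1)]]])
  have "(LINT w|P. ?q w \<bullet> dl t w) = 0"
  proof (rule dl_zero[OF Suc(1)])
    show "?q \<in> borel_measurable (G t)"
      using I_meas[OF Suc(1)] S_adapted[OF Suc(1)] U_adapted[OF Suc(1)] by measurable
  qed (use qi in simp)
  then have z: "(LINT w|P. I m w * ((2 *\<^sub>R S t w + U t w) \<bullet> dl t w)) = 0" by simp
  have i1: "integrable P (\<lambda>w. I m w * V t w)" by (rule I_int[OF V_integrable[OF Suc(1)]])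
  have i3: "integrable P (\<lambda>w. I m w * (norm (dl t w))\<^sup>2)" by (rule I_int[OF dl_sq(1)[OF Suc(1)]])
  have "(LINT w|P. I m w * V (Suc t) w)
     \<le> (LINT w|P. I m w * V t w + real t * (I m w * ((2 *\<^sub>R S t w + U t w) \<bullet> dl t w)) + K1 * ((real t)\<^sup>2 * (I m w * (norm (dl t w))\<^sup>2)))"
  proof (rule integral_mono)
    show "integrable P (\<lambda>w. I m w * V (Suc t) w)" by (rule I_int[OF V_integrable]) simp
    show "integrable P (\<lambda>w. I m w * V t w + real t * (I m w * ((2 *\<^sub>R S t w + U t w) \<bullet> dl t w)) + K1 * ((real t)\<^sup>2 * (I m w * (norm (dl t w))\<^sup>2)))"
      using i1 qi i3 by auto
    fix w assume w: "w \<in> space P"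
    have "0 \<le> I m w" by (simp add: I_def)
    from mult_left_mono[OF V_step[OF w, of t] this]
    show "I m w * V (Suc t) w \<le> I m w * V t w + real t * (I m w * ((2 *\<^sub>R S t w + U t w) \<bullet> dl t w)) + K1 * ((real t)\<^sup>2 * (I m w * (norm (dl t w))\<^sup>2))"
      by (simp add: distrib_left mult_ac)
  qed
  also have "\<dots> = (LINT w|P. I m w * V t w) + K1 * ((real t)\<^sup>2 * v m t)"
    using i1 qi i3 z by (simp add: v_def)
  also have "\<dots> \<le> K1 * (\<Sum>j=1..<t. (real j)\<^sup>2 * v m j) + K1 * ((real t)\<^sup>2 * v m t)" using Suc by simp
  also have "\<dots> = K1 * (\<Sum>j=1..<Suc t. (real j)\<^sup>2 * v m j)" using Suc(1) by (simp add: distrib_left)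
  finally show ?case .
qed

text \<open>The noise contribution to the error of the inner loop, at the random length.
  \<open>Rm\<close> below is its version at a fixed length, for which expectations can be computed
  on one event M = m at a time.\<close>

definition "R w = (\<Sum>t=1..M w. W t w / real t ^ 3) / (real (M w))\<^sup>2 + W (Suc (M w)) w / real (M w) ^ 4"

definition "Rm m w = (\<Sum>t=1..m. W t w / real t ^ 3) / (real m)\<^sup>2 + W (Suc m) w / real m ^ 4"

definition "K2 = (1 + 1 / hmin) * K1"

lemma K2: "K2 > 0" using K1 H by (simp add: K2_def add_pos_pos)

lemma W_integrable:
  assumes t: "t \<ge> 1"
  shows "integrable P (W t)"
proof (rule Bochner_Integration.integrable_bound)
  show "integrable P (\<lambda>w. (1 + 1 / hmin) * V t w)" using V_integrable[OF t] by simp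
  show "AE w in P. norm (W t w) \<le> norm ((1 + 1 / hmin) * V t w)"
  proof (rule AE_I2)
    fix w
    show "norm (W t w) \<le> norm ((1 + 1 / hmin) * V t w)"
      using W_le_V[of t w] W_nonneg[of t w] unfolding real_norm_def by linarith
  qed
qed (rule W_meas[OF t])

lemma Rm_integrable: "integrable P (Rm m)"
proof -
  have "integrable P (\<lambda>w. \<Sum>t=1..m. W t w / real t ^ 3)"
    by (rule Bochner_Integration.integrable_sum) (auto intro!: W_integrable)
  moreover have "integrable P (W (Suc m))" by (rule W_integrable) simp
  ultimately show ?thesis unfolding Rm_def[abs_def] by auto
qed

lemma W_expect: "t \<ge> 1 \<Longrightarrow> (LINT w|P. I m w * W t w) \<le> K2 * (\<Sum>j=1..<t. (real j)\<^sup>2 * v m j)"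
proof -
  assume t: "t \<ge> 1"
  have "(LINT w|P. I m w * W t w) \<le> (LINT w|P. (1 + 1 / hmin) * (I m w * V t w))"
  proof (rule integral_mono)
    show "integrable P (\<lambda>w. (1 + 1 / hmin) * (I m w * V t w))" using I_int[OF V_integrable[OF t]] by simp
    fix w
    have "0 \<le> I m w" by (simp add: I_def)
    from mult_left_mono[OF W_le_V[of t w] this]
    show "I m w * W t w \<le> (1 + 1 / hmin) * (I m w * V t w)" by (simp add: mult_ac)
  qed (rule I_int[OF W_integrable[OF t]])
  also have "\<dots> \<le> (1 + 1 / hmin) * (K1 * (\<Sum>j=1..<t. (real j)\<^sup>2 * v m j))"
    using mult_left_mono[OF V_expect[OF t, of m], of "1 + 1 / hmin"] H(2) by simp
  finally show ?thesis by (simp add: K2_def)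
qed

text \<open>The weights j^2 from the growth of \<open>V\<close> meet the weights t^-3 and m^-2, and
  everything collapses to the plain sum of the second moments on the event M = m, divided by
  m^2.\<close>

lemma Rm_expect:
  assumes m: "m > 0"
  shows "(LINT w|P. I m w * Rm m w) \<le> K2 * (\<Sum>t=1..m. v m t) / (real m)\<^sup>2"
proof -
  define T where "T t = (\<Sum>j=1..<t. (real j)\<^sup>2 * v m j)" for t
  obtain n where n: "m = Suc n" using m by (cases m) auto
  have i: "integrable P (\<lambda>w. I m w * W t w)" if "t \<ge> 1" for t by (rule I_int[OF W_integrable[OF that]])
  have "(LINT w|P. I m w * Rm m w)
     = (LINT w|P. (\<Sum>t=1..m. (I m w * W t w) / real t ^ 3) / (real m)\<^sup>2 + (I m w * W (Suc m) w) / real m ^ 4)"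
    by (simp add: Rm_def distrib_left sum_distrib_left)
  also have "\<dots> = (\<Sum>t=1..m. (LINT w|P. I m w * W t w) / real t ^ 3) / (real m)\<^sup>2 + (LINT w|P. I m w * W (Suc m) w) / real m ^ 4"
    using i by (subst Bochner_Integration.integral_add)
      (auto intro!: Bochner_Integration.integrable_divide Bochner_Integration.integrable_sum
        simp: Bochner_Integration.integral_sum)
  also have "\<dots> \<le> (\<Sum>t=1..m. (K2 * T t) / real t ^ 3) / (real m)\<^sup>2 + (K2 * T (Suc m)) / real m ^ 4"
    unfolding T_def by (intro add_mono divide_right_mono sum_mono W_expect) auto
  also have "\<dots> = K2 * ((\<Sum>t=1..m. T t / real t ^ 3) + T (Suc m) / (real m)\<^sup>2) / (real m)\<^sup>2"
  proof -
    define X where "X = (\<Sum>t=1..m. T t / real t ^ 3)"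
    have "(\<Sum>t=1..m. (K2 * T t) / real t ^ 3) = K2 * X" by (simp add: X_def sum_distrib_left)
    moreover have "real m ^ 4 = (real m)\<^sup>2 * (real m)\<^sup>2" by (simp flip: power_add)
    ultimately show ?thesis unfolding X_def[symmetric] by (simp add: distrib_left add_divide_distrib)
  qed
  also have "\<dots> \<le> K2 * (\<Sum>t=1..m. v m t) / (real m)\<^sup>2"
    using weighted_partial_sums_le[of "v m" n] K2 v_nonneg unfolding n T_def
    by (intro divide_right_mono mult_left_mono) auto
  finally show ?thesis .
qed

end

section \<open>Summation over the random length of the inner loop\<close>

definition "zeta32 = (\<Sum>n. real (Suc n) powr (- (3/2)))"

lemma zeta32: "summable (\<lambda>n. real (Suc n) powr (- (3/2)))" "zeta32 \<ge> 0"
proof -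
  have "summable (\<lambda>n. real n powr (- (3/2)))" by (simp add: summable_real_powr_iff)
  then show s: "summable (\<lambda>n. real (Suc n) powr (- (3/2)))" by (subst summable_Suc_iff)
  show "zeta32 \<ge> 0" unfolding zeta32_def by (rule suminf_nonneg[OF s]) simp
qed

text \<open>Split m^-2 into m^(-3/2) and m^(-1/2). The first factor is bounded by m \<ge> t and is
  summable in t; the second is bounded by m \<ge> m0 and supplies the rate.\<close>

lemma inverse_square_le:
  fixes m m0 :: real
  assumes "0 < m0" "m0 \<le> m" "0 < t" "t \<le> m"
  shows "1 / m\<^sup>2 \<le> t powr (- (3/2)) / sqrt m0"
proof -
  have m: "m > 0" using assms by linarith
  have "1 / m\<^sup>2 = m powr (- 2)" using m by (simp only: powr_minus_divide powr_numeral)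
  also have "\<dots> = m powr (- (3/2)) * m powr (- (1/2))" unfolding powr_add[symmetric] by simp
  also have "\<dots> \<le> t powr (- (3/2)) * m0 powr (- (1/2))"
    using assms by (intro mult_mono powr_mono2') auto
  also have "m0 powr (- (1/2)) = 1 / sqrt m0"
    using assms by (simp only: powr_minus_divide powr_half_sqrt less_imp_le)
  finally show ?thesis by simp
qed

context inner_noise
begin

lemma R_eq: "R w = Rm (M w) w" by (simp add: R_def Rm_def)

lemma M_meas: "M \<in> P \<rightarrow>\<^sub>M count_space UNIV" by (rule measP[OF _ M]) simp

lemma R_meas: "R \<in> borel_measurable P"
  unfolding R_eq[abs_def]
  by (rule measurable_compose_countable[OF _ M_meas]) (rule borel_measurable_integrable[OF Rm_integrable])

lemma Rm_nonneg: "0 \<le> Rm m w"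
  unfolding Rm_def by (intro add_nonneg_nonneg divide_nonneg_nonneg sum_nonneg W_nonneg) auto

lemma R_nonneg: "0 \<le> R w" unfolding R_eq by (rule Rm_nonneg)

lemma suminf_I: "(\<Sum>m. ennreal (I m w) * f m) = f (M w)"
proof -
  have "(\<Sum>m. ennreal (I m w) * f m) = (\<Sum>m\<in>{M w}. ennreal (I m w) * f m)"
    by (rule suminf_finite) (auto simp: I_def)
  then show ?thesis by (simp add: I_def)
qed

lemma I_measP: "I m \<in> borel_measurable P"
  by (rule measP[OF _ I_meas[of 1]]) simp_all

text \<open>On each event M = m the noise is dominated in expectation by one series \<open>g\<close>
  that does not depend on m. Summing over m removes the indicators, so that only unconditional
  second moments remain. Extended nonnegative integrals allow all exchanges of sum and integral and
  give integrability at the end.\<close>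

lemma R_bound:
  assumes m0: "m0 > 0" "\<And>w. w \<in> space P \<Longrightarrow> m0 \<le> real (M w)"
  shows "integrable P R" "(LINT w|P. R w) \<le> K2 * \<sigma>2 * zeta32 / sqrt m0"
proof -
  define c where "c n = K2 / sqrt m0 * real (Suc n) powr (- (3/2))" for n
  have c0: "c n \<ge> 0" for n using K2 m0 by (simp add: c_def)
  define g where "g w = (\<Sum>n. ennreal (c n * (norm (dl (Suc n) w))\<^sup>2))" for w
  have dlS: "dl (Suc n) \<in> borel_measurable P" for n by (rule dl_measP) simp
  note [measurable] = I_measP dlS
  have gm [measurable]: "g \<in> borel_measurable P" unfolding g_def[abs_def] by measurable
  have step: "(\<integral>\<^sup>+ w. ennreal (I m w) * ennreal (Rm m w) \<partial>P) \<le> (\<integral>\<^sup>+ w. ennreal (I m w) * g w \<partial>P)" for m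
  \<comment> \<open>Other lengths do not occur, so their indicator is zero.\<close>
  proof (cases "m > 0 \<and> m0 \<le> real m")
    case False
    have "(\<integral>\<^sup>+ w. ennreal (I m w) * ennreal (Rm m w) \<partial>P) = (\<integral>\<^sup>+ w. 0 \<partial>P)"
    proof (rule nn_integral_cong)
      fix w assume "w \<in> space P"
      then have "M w \<noteq> m" using False Mpos[of w] m0(2)[of w] by auto
      then show "ennreal (I m w) * ennreal (Rm m w) = 0" by (simp add: I_def)
    qed
    then show ?thesis by simp
  next
    case True
    define h where "h w = (K2 / (real m)\<^sup>2) * (\<Sum>t=1..m. (norm (dl t w))\<^sup>2)" for w
    have h0: "0 \<le> h w" for w using K2 unfolding h_def by (intro mult_nonneg_nonneg sum_nonneg) auto
    have hi: "integrable P h" unfolding h_def[abs_def]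
      by (intro integrable_mult_right Bochner_Integration.integrable_sum dl_sq(1)) simp
    have hI: "(LINT w|P. I m w * h w) = K2 * (\<Sum>t=1..m. v m t) / (real m)\<^sup>2"
    proof -
      have "(LINT w|P. I m w * h w) = (LINT w|P. (K2 / (real m)\<^sup>2) * (\<Sum>t=1..m. I m w * (norm (dl t w))\<^sup>2))"
        by (rule Bochner_Integration.integral_cong) (auto simp: h_def sum_distrib_left mult_ac)
      also have "\<dots> = (K2 / (real m)\<^sup>2) * (\<Sum>t=1..m. v m t)"
      proof -
        have "integrable P (\<lambda>w. I m w * (norm (dl t w))\<^sup>2)" if "t \<in> {1..m}" for t
          using that by (intro I_int dl_sq(1)) auto
        then show ?thesis unfolding v_def
          by (subst integral_mult_right_zero) (subst Bochner_Integration.integral_sum, simp_all)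
      qed
      finally show ?thesis by simp
    qed
    have "(\<integral>\<^sup>+ w. ennreal (I m w) * ennreal (Rm m w) \<partial>P) = (\<integral>\<^sup>+ w. ennreal (I m w * Rm m w) \<partial>P)"
      by (rule nn_integral_cong) (simp add: ennreal_mult' I_def)
    also have "\<dots> = ennreal (LINT w|P. I m w * Rm m w)"
      by (rule nn_integral_eq_integral[OF I_int[OF Rm_integrable]]) (auto simp: I_def Rm_nonneg)
    also have "\<dots> \<le> ennreal (LINT w|P. I m w * h w)"
      unfolding hI using Rm_expect[of m] True by (intro ennreal_leI) auto
    also have "\<dots> = (\<integral>\<^sup>+ w. ennreal (I m w * h w) \<partial>P)"
      by (rule nn_integral_eq_integral[OF I_int[OF hi], symmetric]) (auto simp: I_def h0)
    also have "\<dots> \<le> (\<integral>\<^sup>+ w. ennreal (I m w) * g w \<partial>P)"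
    proof (rule nn_integral_mono)
      fix w
      have "h w = (\<Sum>n<m. (K2 / (real m)\<^sup>2) * (norm (dl (Suc n) w))\<^sup>2)"
        by (simp add: h_def sum_distrib_left sum.atLeast1_atMost_eq)
      also have "\<dots> \<le> (\<Sum>n<m. c n * (norm (dl (Suc n) w))\<^sup>2)"
      proof (intro sum_mono mult_right_mono)
        fix n assume "n \<in> {..<m}"
        then have "1 / (real m)\<^sup>2 \<le> real (Suc n) powr (- (3/2)) / sqrt m0"
          using True m0(1) by (intro inverse_square_le) auto
        from mult_left_mono[OF this, of K2] show "K2 / (real m)\<^sup>2 \<le> c n" using K2 by (simp add: c_def)
      qed auto
      finally have "ennreal (h w) \<le> ennreal (\<Sum>n<m. c n * (norm (dl (Suc n) w))\<^sup>2)" by (rule ennreal_leI)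
      also have "\<dots> = (\<Sum>n<m. ennreal (c n * (norm (dl (Suc n) w))\<^sup>2))"
        using c0 by (subst sum_ennreal) auto
      also have "\<dots> \<le> g w" unfolding g_def by (rule sum_le_suminf) auto
      finally show "ennreal (I m w * h w) \<le> ennreal (I m w) * g w"
        by (simp add: ennreal_mult' I_def mult_left_mono)
    qed
    finally show ?thesis .
  qed
  have "(\<integral>\<^sup>+ w. ennreal (R w) \<partial>P) = (\<integral>\<^sup>+ w. (\<Sum>m. ennreal (I m w) * ennreal (Rm m w)) \<partial>P)"
    by (simp add: suminf_I R_eq)
  also have "\<dots> = (\<Sum>m. \<integral>\<^sup>+ w. ennreal (I m w) * ennreal (Rm m w) \<partial>P)"
    using borel_measurable_integrable[OF Rm_integrable] by (intro nn_integral_suminf) measurable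
  also have "\<dots> \<le> (\<Sum>m. \<integral>\<^sup>+ w. ennreal (I m w) * g w \<partial>P)"
    by (intro suminf_le step) auto
  also have "\<dots> = (\<integral>\<^sup>+ w. (\<Sum>m. ennreal (I m w) * g w) \<partial>P)"
    by (intro nn_integral_suminf[symmetric]) measurable
  also have "\<dots> = (\<integral>\<^sup>+ w. g w \<partial>P)" by (rule nn_integral_cong) (rule suminf_I)
  also have "\<dots> = (\<Sum>n. \<integral>\<^sup>+ w. ennreal (c n * (norm (dl (Suc n) w))\<^sup>2) \<partial>P)"
    unfolding g_def by (intro nn_integral_suminf) measurable
  also have "\<dots> \<le> (\<Sum>n. ennreal (c n * \<sigma>2))"
  proof (intro suminf_le)
    fix n
    have "(\<integral>\<^sup>+ w. ennreal (c n * (norm (dl (Suc n) w))\<^sup>2) \<partial>P) = ennreal (LINT w|P. c n * (norm (dl (Suc n) w))\<^sup>2)"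
      using dl_sq(1)[of "Suc n"] c0 by (intro nn_integral_eq_integral) auto
    also have "\<dots> \<le> ennreal (c n * \<sigma>2)"
      using dl_sq(2)[of "Suc n"] c0 by (intro ennreal_leI) (simp add: mult_left_mono)
    finally show "(\<integral>\<^sup>+ w. ennreal (c n * (norm (dl (Suc n) w))\<^sup>2) \<partial>P) \<le> ennreal (c n * \<sigma>2)" .
  qed auto
  also have "\<dots> = ennreal (\<Sum>n. c n * \<sigma>2)"
  proof (rule suminf_ennreal2)
    have "0 \<le> (LINT w|P. (norm (dl 1 w))\<^sup>2)" by simp
    then have "0 \<le> \<sigma>2" using dl_sq(2)[of 1] by linarith
    then show "0 \<le> c n * \<sigma>2" for n using c0[of n] by simp
    show "summable (\<lambda>n. c n * \<sigma>2)" unfolding c_def using zeta32(1) by (intro summable_mult2 summable_mult)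
  qed
  also have "(\<Sum>n. c n * \<sigma>2) = K2 * \<sigma>2 * zeta32 / sqrt m0"
  proof -
    have "(\<Sum>n. c n * \<sigma>2) = (\<Sum>n. (K2 * \<sigma>2 / sqrt m0) * real (Suc n) powr (- (3/2)))"
      by (simp add: c_def mult_ac)
    also have "\<dots> = (K2 * \<sigma>2 / sqrt m0) * zeta32"
      unfolding zeta32_def by (rule suminf_mult[OF zeta32(1)])
    finally show ?thesis by simp
  qed
  finally have b: "(\<integral>\<^sup>+ w. ennreal (R w) \<partial>P) \<le> ennreal (K2 * \<sigma>2 * zeta32 / sqrt m0)" .
  show i: "integrable P R"
    using R_meas R_nonneg le_less_trans[OF b ennreal_less_top] by (intro integrableI_nonneg) auto
  have "0 \<le> (LINT w|P. (norm (dl 1 w))\<^sup>2)" by simp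
  then have \<sigma>: "0 \<le> \<sigma>2" using dl_sq(2)[of 1] by linarith
  have "ennreal (LINT w|P. R w) \<le> ennreal (K2 * \<sigma>2 * zeta32 / sqrt m0)"
    using nn_integral_eq_integral[OF i] R_nonneg b by simp
  then show "(LINT w|P. R w) \<le> K2 * \<sigma>2 * zeta32 / sqrt m0"
    using \<sigma> K2 zeta32 m0 by (subst (asm) ennreal_le_iff) auto
qed

end

section \<open>Expected linear convergence\<close>

text \<open>As soon as C \<rho>^k < q1 - q, the factor is at most q1, and \<tau> is chosen strictly
  above q1 and \<rho>. The induction closes because C \<le> c (\<tau> - q1); the sum in
  \<open>c\<close> takes care of the finitely many earlier terms.\<close>

lemma perturbed_contraction_rate:
  fixes a :: "nat \<Rightarrow> real"
  assumes a: "\<And>k. a k \<ge> 0" and q: "0 \<le> q" "q < 1" and \<rho>: "0 < \<rho>" "\<rho> < 1" and C: "C \<ge> 0"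
    and rec: "\<And>k. k \<ge> 1 \<Longrightarrow> a (Suc k) \<le> (q + C * \<rho> ^ k) * a k + C * \<rho> ^ k"
  shows "\<exists>c \<tau>. c > 0 \<and> 0 < \<tau> \<and> \<tau> < 1 \<and> (\<forall>k. a k \<le> c * \<tau> ^ k)"
proof -
  define q1 where "q1 = (q + 1) / 2"
  have q1: "q < q1" "q1 < 1" "q1 > 0" using q by (auto simp: q1_def)
  define \<tau> where "\<tau> = (1 + max q1 \<rho>) / 2"
  have \<tau>: "q1 < \<tau>" "\<rho> < \<tau>" "\<tau> < 1" "0 < \<tau>" using q1 \<rho> by (auto simp: \<tau>_def)
  have "(\<lambda>k. C * \<rho> ^ k) \<longlonglongrightarrow> C * 0"
    using \<rho> by (intro tendsto_intros LIMSEQ_realpow_zero) auto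
  then have "\<forall>\<^sub>F k in sequentially. C * \<rho> ^ k < q1 - q"
    using q1 by (intro order_tendstoD(2)) auto
  then obtain k1 where k1: "\<And>k. k \<ge> k1 \<Longrightarrow> C * \<rho> ^ k < q1 - q" by (auto simp: eventually_sequentially)
  define k0 where "k0 = max 1 k1"
  define c where "c = C / (\<tau> - q1) + (\<Sum>k\<le>k0. a k / \<tau> ^ k) + 1"
  have s0: "0 \<le> (\<Sum>k\<le>k0. a k / \<tau> ^ k)" using a \<tau> by (intro sum_nonneg) auto
  have C0: "0 \<le> C / (\<tau> - q1)" using C \<tau> by simp
  have c: "c > 0" using s0 C0 by (simp add: c_def)
  have early: "a k \<le> c * \<tau> ^ k" if k: "k \<le> k0" for k
  proof -
    have "a k / \<tau> ^ k \<le> (\<Sum>k\<le>k0. a k / \<tau> ^ k)"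
      using a \<tau> k by (intro member_le_sum) auto
    also have "\<dots> \<le> c" using C0 by (simp add: c_def)
    finally show ?thesis using \<tau> by (simp add: divide_le_eq)
  qed
  have Cc: "C \<le> c * (\<tau> - q1)"
  proof -
    have "C = C / (\<tau> - q1) * (\<tau> - q1)" using \<tau> by simp
    also have "\<dots> \<le> c * (\<tau> - q1)" using \<tau> s0 by (intro mult_right_mono) (auto simp: c_def)
    finally show ?thesis .
  qed
  have late: "a k \<le> c * \<tau> ^ k" if k: "k \<ge> k0" for k
    using k
  proof (induction k rule: nat_induct_at_least)
    case base
    then show ?case by (rule early) simp
  next
    case (Suc k)
    have "a (Suc k) \<le> (q + C * \<rho> ^ k) * a k + C * \<rho> ^ k" using Suc(1) by (intro rec) (simp add: k0_def)
    also have "\<dots> \<le> q1 * (c * \<tau> ^ k) + (c * (\<tau> - q1)) * \<tau> ^ k"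
    proof (intro add_mono mult_mono)
      show "q + C * \<rho> ^ k \<le> q1" using k1[of k] Suc(1) by (simp add: k0_def)
      show "\<rho> ^ k \<le> \<tau> ^ k" using \<rho> \<tau> by (intro power_mono) auto
    qed (use q1 a c \<tau> Cc Suc \<rho> in auto)
    also have "\<dots> = c * \<tau> ^ Suc k" by (simp add: algebra_simps)
    finally show ?case .
  qed
  show ?thesis using c \<tau> early late by (metis nat_le_linear)
qed

text \<open>The algorithm with its minimizations replaced by optimality equations and the ceiling
  rule for \<open>M\<close> by the inequality it implies. \<phi> stands for the squared norm induced
  by the inverse of \<open>H\<close>, and \<open>gj\<close> for the component gradients.
  Measurability is required of \<open>xmat (D k w)\<close>, the matrix that the algorithm
  selects.\<close>

locale as_admm = admm A B b Gf Gg xs ys \<alpha> \<nu> \<beta> s c1 c2 \<Lambda>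
  for A :: "real^'p^'n" and B :: "real^'q^'n" and b :: "real^'n"
    and Gf :: "real^'p \<Rightarrow> real^'p" and Gg :: "real^'q \<Rightarrow> real^'q"
    and xs :: "real^'p" and ys :: "real^'q" and \<alpha> \<nu> \<beta> s c1 c2 :: real and \<Lambda> :: "(real^'n) set" +
  fixes P :: "'w measure" and F :: "nat \<Rightarrow> nat \<Rightarrow> 'w measure" and N :: nat
    and f :: "real^'p \<Rightarrow> real" and gj :: "nat \<Rightarrow> real^'p \<Rightarrow> real^'p" and H :: "real^'p^'p"
    and hmin hmax :: real and \<phi> :: "real^'p \<Rightarrow> real" and K\<phi> \<sigma>2 \<theta> :: real
    and M :: "nat \<Rightarrow> 'w \<Rightarrow> nat" and \<eta> :: "nat \<Rightarrow> 'w \<Rightarrow> real" and D :: "nat \<Rightarrow> 'w \<Rightarrow> real^'p^'p"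
    and \<xi> :: "nat \<Rightarrow> nat \<Rightarrow> 'w \<Rightarrow> nat" and e :: "nat \<Rightarrow> nat \<Rightarrow> 'w \<Rightarrow> real^'p"
    and x0 :: "real^'p" and y0 :: "real^'q" and lam0 :: "real^'n"
    and x xb :: "nat \<Rightarrow> 'w \<Rightarrow> real^'p" and y :: "nat \<Rightarrow> 'w \<Rightarrow> real^'q" and lam :: "nat \<Rightarrow> 'w \<Rightarrow> real^'n"
    and xin xbin xhat \<delta> :: "nat \<Rightarrow> nat \<Rightarrow> 'w \<Rightarrow> real^'p"
  assumes noise: "stochastic_oracle P F N \<xi> e" and N: "N > 0"
    and f: "\<And>v. GDERIV f v :> Gf v" "\<And>v w. f v + Gf v \<bullet> (w - v) \<le> f w"
    and gj: "\<And>j. j \<in> {1..N} \<Longrightarrow> continuous_on UNIV (gj j)"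
    and Gf_avg: "\<And>u. Gf u = (1 / real N) *\<^sub>R (\<Sum>j=1..N. gj j u)"
    and H: "transpose H = H" "hmin > 0" "\<And>v. hmin * (norm v)\<^sup>2 \<le> v \<bullet> (H *v v)"
      "hmax > 0" "\<And>v. norm (H *v v) \<le> hmax * norm v"
    and \<phi>: "K\<phi> > 0" "\<And>v. (norm v)\<^sup>2 \<le> K\<phi> * \<phi> v"
    and M_adapted: "\<And>k. M k \<in> F k 1 \<rightarrow>\<^sub>M count_space UNIV"
    and \<eta>_adapted: "\<And>k. \<eta> k \<in> borel_measurable (F k 1)"
    and MM_adapted: "\<And>k. (\<lambda>w. xmat (D k w)) \<in> borel_measurable (F k 1)"
    and y_adapted: "\<And>k. y k \<in> borel_measurable (F k 1)"
    and init: "\<And>w. w \<in> space P \<Longrightarrow> x 0 w = x0 \<and> y 0 w = y0 \<and> lam 0 w = lam0 \<and> xb 0 w = x0"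
    and D_admissible: "\<And>k w. w \<in> space P \<Longrightarrow> admissible (D k w)"
    and D_decreasing: "\<And>k w v. w \<in> space P \<Longrightarrow> v \<bullet> (D (Suc k) w *v v) \<le> v \<bullet> (D k w *v v)"
    and inner_start: "\<And>k w. w \<in> space P \<Longrightarrow> xin k 1 w = x k w \<and> xbin k 1 w = xb k w"
    and xhat: "\<And>k t w. w \<in> space P \<Longrightarrow> t \<in> {1..M k w} \<Longrightarrow>
        xhat k t w = (2 / (real t + 1)) *\<^sub>R xbin k t w + (1 - 2 / (real t + 1)) *\<^sub>R xin k t w"
    and inner_xb: "\<And>k t w. w \<in> space P \<Longrightarrow> t \<in> {1..M k w} \<Longrightarrow>
        (2 / (real t * \<eta> k w)) *\<^sub>R (H *v (xbin k (Suc t) w - xbin k t w)) + xmat (D k w) *v (xbin k (Suc t) w - x k w)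
        + - (transpose A *v (lam k w - \<beta> *\<^sub>R res (x k w) (y k w))) + (Gf (xhat k t w) - \<delta> k t w) = 0"
    and inner_x: "\<And>k t w. w \<in> space P \<Longrightarrow> t \<in> {1..M k w} \<Longrightarrow>
        xin k (Suc t) w = (2 / (real t + 1)) *\<^sub>R xbin k (Suc t) w + (1 - 2 / (real t + 1)) *\<^sub>R xin k t w"
    and \<delta>: "\<And>k t w. w \<in> space P \<Longrightarrow> t \<in> {1..M k w} \<Longrightarrow>
        \<delta> k t w = Gf (xhat k t w) - gj (\<xi> k t w) (xhat k t w) - e k t w"
    and outer_x: "\<And>k w. w \<in> space P \<Longrightarrow> x (Suc k) w = xin k (Suc (M k w)) w \<and> xb (Suc k) w = xbin k (Suc (M k w)) w"
    and outer_y: "\<And>k w. w \<in> space P \<Longrightarrow>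
        Gg (y (Suc k) w) = transpose B *v (lam k w - \<beta> *\<^sub>R res (x (Suc k) w) (y (Suc k) w))"
    and outer_lam: "\<And>k w. w \<in> space P \<Longrightarrow>
        lam (Suc k) w = lam k w - (s * \<beta>) *\<^sub>R res (x (Suc k) w) (y (Suc k) w)"
    and \<delta>_sq: "\<And>k t. t \<ge> 1 \<Longrightarrow> set_integrable P {w \<in> space P. t \<le> M k w} (\<lambda>w. \<phi> (\<delta> k t w)) \<and>
          (LINT w:{w \<in> space P. t \<le> M k w}|P. \<phi> (\<delta> k t w)) \<le> \<sigma>2"
    and \<theta>: "\<theta> > 0" and M_pos: "\<And>k w. w \<in> space P \<Longrightarrow> M k w > 0"
    and M_growth: "\<And>k w. w \<in> space P \<Longrightarrow>
          (1 + \<theta>)\<^sup>2 * real (M k w) * ((norm (xb (Suc k) w))\<^sup>2 + 1) \<le> real (M (Suc k) w)"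
    and \<eta>_eq: "\<And>k w. w \<in> space P \<Longrightarrow> \<eta> k w = (1 / (1 + \<theta>)) ^ k / real (M k w)"
begin

section \<open>Adaptedness of the inner and outer iterates\<close>

sublocale prob_space P using noise by (simp add: stochastic_oracle_def)

definition "\<rho> = 1 / (1 + \<theta>)"

lemma \<rho>: "0 < \<rho>" "\<rho> < 1" using \<theta> by (auto simp: \<rho>_def)

lemma F_sub:
  "t \<ge> 1 \<Longrightarrow> subalgebra P (F k t)" "t \<ge> 1 \<Longrightarrow> subalgebra (F k (Suc t)) (F k t)"
  "t \<ge> 1 \<Longrightarrow> subalgebra (F (Suc k) 1) (F k t)"
  using noise by (auto simp: stochastic_oracle_def)

lemma F_space: "t \<ge> 1 \<Longrightarrow> space (F k t) = space P"
  using F_sub(1) by (simp add: subalgebra_def)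

lemma F_mono:
  assumes "1 \<le> t" "t \<le> u" "g \<in> F k t \<rightarrow>\<^sub>M L"
  shows "g \<in> F k u \<rightarrow>\<^sub>M L"
  using assms(2,3)
proof (induction u rule: dec_induct)
  case (step n)
  then show ?case using assms(1) measurable_from_subalg[OF F_sub(2)[of n k]] by simp
qed

lemma F_next: "1 \<le> t \<Longrightarrow> g \<in> F k t \<rightarrow>\<^sub>M L \<Longrightarrow> g \<in> F (Suc k) 1 \<rightarrow>\<^sub>M L"
  using measurable_from_subalg[OF F_sub(3)] by blast

lemma F_P: "1 \<le> t \<Longrightarrow> g \<in> F k t \<rightarrow>\<^sub>M L \<Longrightarrow> g \<in> P \<rightarrow>\<^sub>M L"
  using measurable_from_subalg[OF F_sub(1)] by blast

lemma oracle_D: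
  assumes "t \<ge> 1"
  shows "\<xi> k t \<in> F k (Suc t) \<rightarrow>\<^sub>M count_space {1..N}"
    "\<And>j. j \<in> {1..N} \<Longrightarrow> measure P {w \<in> space P. \<xi> k t w = j} = 1 / real N"
    "indep_set (sets (F k t)) {\<xi> k t -` J \<inter> space P | J. J \<subseteq> {1..N}}"
    "e k t \<in> borel_measurable (F k (Suc t))" "integrable P (e k t)"
    "\<And>i. AE w in P. real_cond_exp P (F k t) (\<lambda>w. e k t w $ i) w = 0"
proof -
  have 1: "\<xi> k t \<in> F k (t + 1) \<rightarrow>\<^sub>M count_space {1..N} \<and>
      (\<forall>j\<in>{1..N}. measure P {w \<in> space P. \<xi> k t w = j} = 1 / real N) \<and>
      indep_set (sets (F k t)) {\<xi> k t -` J \<inter> space P | J. J \<subseteq> {1..N}}"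
    using noise[unfolded stochastic_oracle_def, THEN conjunct2, THEN conjunct2, THEN conjunct1, THEN spec[of _ k], THEN spec[of _ t], THEN mp, OF assms] .
  have 2: "e k t \<in> borel_measurable (F k (t + 1)) \<and> integrable P (e k t) \<and>
      (\<forall>i. AE w in P. real_cond_exp P (F k t) (\<lambda>w. e k t w $ i) w = 0)"
    using noise[unfolded stochastic_oracle_def, THEN conjunct2, THEN conjunct2, THEN conjunct2, THEN spec[of _ k], THEN spec[of _ t], THEN mp, OF assms] .
  show "\<xi> k t \<in> F k (Suc t) \<rightarrow>\<^sub>M count_space {1..N}" using 1 unfolding Suc_eq_plus1 by (rule conjunct1)
  show "measure P {w \<in> space P. \<xi> k t w = j} = 1 / real N" if "j \<in> {1..N}" for j
    using 1 that by (elim conjE) (drule (1) bspec)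
  show "indep_set (sets (F k t)) {\<xi> k t -` J \<inter> space P | J. J \<subseteq> {1..N}}" using 1 by (elim conjE)
  show "e k t \<in> borel_measurable (F k (Suc t))" using 2 unfolding Suc_eq_plus1 by (rule conjunct1)
  show "integrable P (e k t)" using 2 by (elim conjE)
  show "AE w in P. real_cond_exp P (F k t) (\<lambda>w. e k t w $ i) w = 0" for i using 2 by (elim conjE) (erule spec)
qed

text \<open>The inner sequences are specified only up to the random length \<open>M k w\<close> of the inner loop;
  the following versions vanish beyond it.\<close>

definition "dl k t w = (if t \<le> M k w then \<delta> k t w else 0)"
definition "xb' k t w = (if t \<le> Suc (M k w) then xbin k t w else 0)"
definition "xi' k t w = (if t \<le> Suc (M k w) then xin k t w else 0)"
definition "xh' k t w = (if t \<le> M k w then xhat k t w else 0)"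

lemma Gf_cont: "continuous_on UNIV Gf"
proof -
  have "\<nu>-lipschitz_on UNIV Gf" using lip_f \<nu> by (intro lipschitz_onI) (auto simp: dist_norm)
  then show ?thesis by (rule lipschitz_on_continuous_on)
qed

lemma xh'_meas:
  assumes t: "t \<ge> 1" and i: "xb' k t \<in> borel_measurable (F k t)" "xi' k t \<in> borel_measurable (F k t)"
  shows "xh' k t \<in> borel_measurable (F k t)"
proof -
  have [measurable]: "M k \<in> F k t \<rightarrow>\<^sub>M count_space UNIV" by (rule F_mono[OF _ t M_adapted]) simp
  note [measurable] = i
  have "(\<lambda>w. if t \<le> M k w then (2 / (real t + 1)) *\<^sub>R xb' k t w + (1 - 2 / (real t + 1)) *\<^sub>R xi' k t w else 0)
      \<in> borel_measurable (F k t)" by measurable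
  also have "?this \<longleftrightarrow> xh' k t \<in> borel_measurable (F k t)"
    using t by (intro measurable_cong) (auto simp: xh'_def xb'_def xi'_def xhat F_space)
  finally show ?thesis .
qed

lemma dl_eq:
  assumes t: "t \<ge> 1" and w: "w \<in> space P"
  shows "dl k t w = indicator {w \<in> space P. t \<le> M k w} w *\<^sub>R
    ((1 / real N) *\<^sub>R (\<Sum>j=1..N. gj j (xh' k t w)) - gj (\<xi> k t w) (xh' k t w) - e k t w)"
  using \<delta>[OF w, of t k] t w by (auto simp: dl_def xh'_def Gf_avg)

lemma gxi_meas:
  assumes t: "t \<ge> 1" and h: "xh' k t \<in> borel_measurable (F k t)"
  shows "(\<lambda>w. gj (\<xi> k t w) (xh' k t w)) \<in> borel_measurable (F k (Suc t))"
proof (rule measurable_compose_countable'[OF _ oracle_D(1)[OF t]])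
  fix j assume j: "j \<in> {1..N}"
  have "xh' k t \<in> borel_measurable (F k (Suc t))" by (rule F_mono[OF t _ h]) simp
  then show "(\<lambda>w. gj j (xh' k t w)) \<in> borel_measurable (F k (Suc t))"
    by (rule borel_measurable_continuous_on[OF gj[OF j]])
qed simp

lemma dl_meas:
  assumes t: "t \<ge> 1" and h: "xh' k t \<in> borel_measurable (F k t)"
  shows "dl k t \<in> borel_measurable (F k (Suc t))"
proof -
  have [measurable]: "M k \<in> F k (Suc t) \<rightarrow>\<^sub>M count_space UNIV" by (rule F_mono[OF _ _ M_adapted]) (use t in auto)
  have xh: "xh' k t \<in> borel_measurable (F k (Suc t))" by (rule F_mono[OF t _ h]) simp
  have [measurable]: "(\<lambda>w. Gf (xh' k t w)) \<in> borel_measurable (F k (Suc t))"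
    by (rule borel_measurable_continuous_on[OF Gf_cont xh])
  note [measurable] = gxi_meas[OF t h] oracle_D(4)[OF t]
  have "(\<lambda>w. if t \<le> M k w then Gf (xh' k t w) - gj (\<xi> k t w) (xh' k t w) - e k t w else 0)
      \<in> borel_measurable (F k (Suc t))" by measurable
  also have "?this \<longleftrightarrow> dl k t \<in> borel_measurable (F k (Suc t))"
    using t by (intro measurable_cong) (auto simp: dl_def xh'_def \<delta> F_space)
  finally show ?thesis .
qed

text \<open>The coefficient is written as a square so that positivity holds for every real
  \<open>r\<close>.\<close>

lemma inner_system_pos:
  assumes w: "w \<in> space P" and v: "v \<noteq> 0"
  shows "0 < v \<bullet> ((r\<^sup>2 *\<^sub>R H + xmat (D k w)) *v v)"
proof -
  have "0 < c1 * (norm v)\<^sup>2" using c v by simp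
  also have "\<dots> \<le> v \<bullet> (xmat (D k w) *v v)" by (rule xmat_coercive[OF D_admissible[OF w]])
  finally have 1: "0 < v \<bullet> (xmat (D k w) *v v)" .
  have "0 \<le> hmin * (norm v)\<^sup>2" using H(2) by simp
  also have "\<dots> \<le> v \<bullet> (H *v v)" by (rule H(3))
  finally have "0 \<le> r\<^sup>2 * (v \<bullet> (H *v v))" by simp
  with 1 show ?thesis
    by (simp add: matrix_vector_mult_add_rdistrib scaleR_matrix_vector_assoc[symmetric] inner_add_right add_nonneg_pos)
qed

lemma \<eta>_pos: "w \<in> space P \<Longrightarrow> \<eta> k w > 0"
  using \<eta>_eq M_pos \<theta> by simp

text \<open>A prox step solves a linear system with adapted data, so Cramer's formula yields an
  adapted iterate. The extension by zero beyond the loop keeps this, as the event t \<le> M k is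
  known when the loop starts.\<close>

lemma inner_meas:
  assumes meas: "x k \<in> borel_measurable (F k 1)" "xb k \<in> borel_measurable (F k 1)" "lam k \<in> borel_measurable (F k 1)"
    and t: "t \<ge> 1"
  shows "xb' k t \<in> borel_measurable (F k t) \<and> xi' k t \<in> borel_measurable (F k t)"
  using t
proof (induction t rule: nat_induct_at_least)
  case base
  have "xb' k 1 \<in> borel_measurable (F k 1) \<longleftrightarrow> xb k \<in> borel_measurable (F k 1)"
    "xi' k 1 \<in> borel_measurable (F k 1) \<longleftrightarrow> x k \<in> borel_measurable (F k 1)"
    using inner_start by (intro measurable_cong; auto simp: xb'_def xi'_def F_space)+
  then show ?case using meas by blast
next
  case (Suc t)
  define d where "d w = (if t \<le> M k w then gj (\<xi> k t w) (xh' k t w) + e k t w else 0)" for w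
  define hh where "hh w = - (transpose A *v (lam k w - \<beta> *\<^sub>R res (x k w) (y k w)))" for w
  define r where "r w = sqrt (2 / (real t * \<eta> k w))" for w
  define rhs where "rhs w = (r w)\<^sup>2 *\<^sub>R (H *v xb' k t w) + xmat (D k w) *v x k w - hh w - d w" for w
  have xh: "xh' k t \<in> borel_measurable (F k t)" using Suc by (intro xh'_meas) auto
  have M' [measurable]: "M k \<in> F k (Suc t) \<rightarrow>\<^sub>M count_space UNIV" by (rule F_mono[OF _ _ M_adapted]) auto
  have \<eta>' [measurable]: "\<eta> k \<in> borel_measurable (F k (Suc t))" by (rule F_mono[OF _ _ \<eta>_adapted]) auto
  have MM' [measurable]: "(\<lambda>w. xmat (D k w)) \<in> borel_measurable (F k (Suc t))" by (rule F_mono[OF _ _ MM_adapted]) auto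
  have y' [measurable]: "y k \<in> borel_measurable (F k (Suc t))" by (rule F_mono[OF _ _ y_adapted]) auto
  have x' [measurable]: "x k \<in> borel_measurable (F k (Suc t))" by (rule F_mono[OF _ _ meas(1)]) auto
  have l' [measurable]: "lam k \<in> borel_measurable (F k (Suc t))" by (rule F_mono[OF _ _ meas(3)]) auto
  have xb'' [measurable]: "xb' k t \<in> borel_measurable (F k (Suc t))" by (rule F_mono[OF Suc(1)]) (use Suc in auto)
  have xi'' [measurable]: "xi' k t \<in> borel_measurable (F k (Suc t))" by (rule F_mono[OF Suc(1)]) (use Suc in auto)
  note [measurable] = gxi_meas[OF Suc(1) xh] oracle_D(4)[OF Suc(1)]
  have [measurable]: "d \<in> borel_measurable (F k (Suc t))" unfolding d_def[abs_def] by measurable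
  have [measurable]: "hh \<in> borel_measurable (F k (Suc t))" unfolding hh_def[abs_def] res_def by measurable
  have [measurable]: "r \<in> borel_measurable (F k (Suc t))" unfolding r_def[abs_def] by measurable
  have [measurable]: "rhs \<in> borel_measurable (F k (Suc t))" unfolding rhs_def[abs_def] by measurable
  define nx where "nx w = (if t \<le> M k w then cramer_solve ((r w)\<^sup>2 *\<^sub>R H + xmat (D k w)) (rhs w) else 0)" for w
  have nxm [measurable]: "nx \<in> borel_measurable (F k (Suc t))" unfolding nx_def[abs_def] by measurable
  have nx: "xb' k (Suc t) w = nx w" if w: "w \<in> space P" for w
  proof (cases "t \<le> M k w")
    case True
    then have tM: "t \<in> {1..M k w}" using Suc(1) by simp
    have r2: "(r w)\<^sup>2 = 2 / (real t * \<eta> k w)" using \<eta>_pos[OF w, of k] by (simp add: r_def)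
    have dd: "Gf (xhat k t w) - \<delta> k t w = d w" using True by (simp add: d_def xh'_def \<delta>[OF w tM])
    have "(2 / (real t * \<eta> k w)) *\<^sub>R (H *v (xbin k (Suc t) w - xbin k t w)) + xmat (D k w) *v (xbin k (Suc t) w - x k w)
        + hh w + d w = 0"
      using inner_xb[OF w tM] unfolding dd hh_def .
    then have "((r w)\<^sup>2 *\<^sub>R H + xmat (D k w)) *v xbin k (Suc t) w = rhs w"
      using True unfolding r2[symmetric] rhs_def xb'_def
      by (simp add: matrix_vector_mult_add_rdistrib scaleR_matrix_vector_assoc[symmetric] matrix_vector_mult_diff_distrib
          scaleR_diff_right algebra_simps eq_diff_eq add_eq_0_iff2 del: transpose_matrix_vector)
    moreover have "\<And>v. v \<noteq> 0 \<Longrightarrow> 0 < v \<bullet> (((r w)\<^sup>2 *\<^sub>R H + xmat (D k w)) *v v)"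
      by (rule inner_system_pos[OF w])
    ultimately have "xbin k (Suc t) w = cramer_solve ((r w)\<^sup>2 *\<^sub>R H + xmat (D k w)) (rhs w)"
      using cramer_solve(2) by blast
    then show ?thesis using True by (simp add: nx_def xb'_def)
  qed (simp add: nx_def xb'_def)
  have m1: "xb' k (Suc t) \<in> borel_measurable (F k (Suc t))"
  proof -
    have "xb' k (Suc t) \<in> borel_measurable (F k (Suc t)) \<longleftrightarrow> nx \<in> borel_measurable (F k (Suc t))"
      using nx by (intro measurable_cong) (simp add: F_space)
    then show ?thesis using nxm by simp
  qed
  note [measurable] = m1
  have "(\<lambda>w. if t \<le> M k w then (2 / (real t + 1)) *\<^sub>R xb' k (Suc t) w + (1 - 2 / (real t + 1)) *\<^sub>R xi' k t w else 0)
      \<in> borel_measurable (F k (Suc t))" by measurable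
  also have "?this \<longleftrightarrow> xi' k (Suc t) \<in> borel_measurable (F k (Suc t))"
    using Suc(1) by (intro measurable_cong) (auto simp: xb'_def xi'_def inner_x F_space)
  finally show ?case using m1 by simp
qed

text \<open>The next outer iterate is an inner iterate at a random index. Countably many index
  values suffice for measurability, and \<open>F (Suc k) 1\<close> contains every
  \<open>F k t\<close>.\<close>

lemma outer_meas:
  "x k \<in> borel_measurable (F k 1) \<and> xb k \<in> borel_measurable (F k 1) \<and> lam k \<in> borel_measurable (F k 1)"
proof (induction k)
  case 0
  have "x 0 \<in> borel_measurable (F 0 1) \<longleftrightarrow> (\<lambda>_. x0) \<in> borel_measurable (F 0 1)"
    "xb 0 \<in> borel_measurable (F 0 1) \<longleftrightarrow> (\<lambda>_. x0) \<in> borel_measurable (F 0 1)"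
    "lam 0 \<in> borel_measurable (F 0 1) \<longleftrightarrow> (\<lambda>_. lam0) \<in> borel_measurable (F 0 1)"
    using init by (intro measurable_cong; simp add: F_space)+
  then show ?case by simp
next
  case (Suc k)
  have i: "xb' k t \<in> borel_measurable (F (Suc k) 1)" "xi' k t \<in> borel_measurable (F (Suc k) 1)" if "t \<ge> 1" for t
    using inner_meas[of k t] Suc that by (auto intro: F_next[OF that] simp del: One_nat_def)
  have M': "M k \<in> F (Suc k) 1 \<rightarrow>\<^sub>M count_space UNIV" by (rule F_next[OF _ M_adapted]) simp
  have "(\<lambda>w. xi' k (Suc (M k w)) w) \<in> borel_measurable (F (Suc k) 1)"
    by (rule measurable_compose_countable[OF _ M']) (rule i, simp)
  also have "?this \<longleftrightarrow> x (Suc k) \<in> borel_measurable (F (Suc k) 1)"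
    by (intro measurable_cong) (simp add: F_space xi'_def outer_x)
  finally have xm: "x (Suc k) \<in> borel_measurable (F (Suc k) 1)" .
  have "(\<lambda>w. xb' k (Suc (M k w)) w) \<in> borel_measurable (F (Suc k) 1)"
    by (rule measurable_compose_countable[OF _ M']) (rule i, simp)
  also have "?this \<longleftrightarrow> xb (Suc k) \<in> borel_measurable (F (Suc k) 1)"
    by (intro measurable_cong) (simp add: F_space xb'_def outer_x)
  finally have xbm: "xb (Suc k) \<in> borel_measurable (F (Suc k) 1)" .
  have "lam k \<in> borel_measurable (F (Suc k) 1)" using Suc by (intro F_next[of 1]) auto
  note [measurable] = this xm y_adapted[of "Suc k"]
  have "(\<lambda>w. lam k w - (s * \<beta>) *\<^sub>R res (x (Suc k) w) (y (Suc k) w)) \<in> borel_measurable (F (Suc k) 1)"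
    unfolding res_def by measurable
  also have "?this \<longleftrightarrow> lam (Suc k) \<in> borel_measurable (F (Suc k) 1)"
    by (intro measurable_cong) (simp add: F_space outer_lam)
  finally show ?case using xm xbm by simp
qed

end

section \<open>Error of the inner loop and the recursion in expectation\<close>

context as_admm
begin

lemma xh'_adapted: "t \<ge> 1 \<Longrightarrow> xh' k t \<in> borel_measurable (F k t)"
  using inner_meas[of k t] outer_meas[of k] by (intro xh'_meas) auto

lemma dl_adapted: "t \<ge> 1 \<Longrightarrow> dl k t \<in> borel_measurable (F k (Suc t))"
  by (rule dl_meas) (auto intro: xh'_adapted)

lemma dl_sq_bound:
  assumes t: "t \<ge> 1"
  shows "integrable P (\<lambda>w. (norm (dl k t w))\<^sup>2)" "(LINT w|P. (norm (dl k t w))\<^sup>2) \<le> K\<phi> * \<sigma>2"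
proof -
  define z where "z w = indicator {w \<in> space P. t \<le> M k w} w * \<phi> (\<delta> k t w)" for w
  have z: "integrable P z" "(LINT w|P. z w) \<le> \<sigma>2"
    using \<delta>_sq[OF t, of k] by (auto simp: set_integrable_def set_lebesgue_integral_def z_def[abs_def])
  have le: "(norm (dl k t w))\<^sup>2 \<le> K\<phi> * z w" if "w \<in> space P" for w
    using that \<phi>(2)[of "\<delta> k t w"] by (auto simp: dl_def z_def)
  have m: "dl k t \<in> borel_measurable P" by (rule F_P[OF _ dl_adapted[OF t]]) simp
  show i: "integrable P (\<lambda>w. (norm (dl k t w))\<^sup>2)"
  proof (rule Bochner_Integration.integrable_bound)
    show "integrable P (\<lambda>w. K\<phi> * z w)" using z by simp
    show "(\<lambda>w. (norm (dl k t w))\<^sup>2) \<in> borel_measurable P" using m by measurable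
    show "AE w in P. norm ((norm (dl k t w))\<^sup>2) \<le> norm (K\<phi> * z w)"
      using le by (intro AE_I2) (auto intro: order_trans[OF _ abs_ge_self])
  qed
  have "(LINT w|P. (norm (dl k t w))\<^sup>2) \<le> (LINT w|P. K\<phi> * z w)"
    using i z le by (intro integral_mono) auto
  also have "\<dots> \<le> K\<phi> * \<sigma>2" using z \<phi> by (simp add: mult_left_mono)
  finally show "(LINT w|P. (norm (dl k t w))\<^sup>2) \<le> K\<phi> * \<sigma>2" .
qed

lemma dl_mean_zero:
  assumes t: "t \<ge> 1" and q: "q \<in> borel_measurable (F k t)" "integrable P (\<lambda>w. q w \<bullet> dl k t w)"
  shows "(LINT w|P. q w \<bullet> dl k t w) = 0"
proof (rule oracle_mean_zero[OF prob_space_axioms F_sub(1)[OF t] N _ oracle_D(2,3,5,6)[OF t] gj xh'_adapted[OF t] _ dl_eq[OF t]])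
  show "\<xi> k t \<in> P \<rightarrow>\<^sub>M count_space {1..N}" by (rule F_P[OF _ oracle_D(1)[OF t]]) simp
  have "M k \<in> F k t \<rightarrow>\<^sub>M count_space UNIV" by (rule F_mono[OF _ t M_adapted]) simp
  then have "M k -` {t..} \<inter> space (F k t) \<in> sets (F k t)" by (rule measurable_sets) simp
  also have "M k -` {t..} \<inter> space (F k t) = {w \<in> space P. t \<le> M k w}" using F_space[OF t] by auto
  finally show "{w \<in> space P. t \<le> M k w} \<in> sets (F k t)" .
  show "dl k t \<in> borel_measurable P" by (rule F_P[OF _ dl_adapted[OF t]]) simp
qed (use q in auto)

lemma M_lower:
  assumes w: "w \<in> space P"
  shows "(1 + \<theta>) ^ (2 * k) \<le> real (M k w)"
proof (induction k)
  case 0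
  then show ?case using M_pos[OF w, of 0] by simp
next
  case (Suc k)
  have "(1 + \<theta>) ^ (2 * Suc k) = (1 + \<theta>)\<^sup>2 * (1 + \<theta>) ^ (2 * k) * (0 + 1)" by (simp add: power_add power2_eq_square)
  also have "\<dots> \<le> (1 + \<theta>)\<^sup>2 * real (M k w) * ((norm (xb (Suc k) w))\<^sup>2 + 1)"
    using Suc \<theta> by (intro mult_mono mult_left_mono) auto
  also have "\<dots> \<le> real (M (Suc k) w)" by (rule M_growth[OF w])
  finally show ?case .
qed

lemma noise_term:
  "\<exists>C0 K. C0 > 0 \<and> K \<ge> 0 \<and> (\<forall>k. \<exists>R. integrable P R \<and> (\<forall>w. 0 \<le> R w) \<and> (LINT w|P. R w) \<le> K * \<rho> ^ k \<and>
     (\<forall>w\<in>space P. \<forall>u. prox_point (D k w) (x k w) (y k w) (lam k w) u \<longrightarrow>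
        (norm (x (Suc k) w - u))\<^sup>2 \<le> C0 * ((norm (xb k w - u))\<^sup>2 / (\<eta> k w * real (M k w) * (real (M k w) + 1)) + R w)))"
proof -
  obtain C0 where C0: "C0 > 0" "\<And>Q M \<eta> xb xin xhat \<delta> xk h u S U.
      inner_run H Gf c1 Q M \<eta> xb xin xhat \<delta> xk h \<Longrightarrow> noise_run H Q M \<eta> \<delta> S U \<Longrightarrow>
      Gf u + Q *v (u - xk) + h = 0 \<Longrightarrow>
      (norm (xin (Suc M) - u))\<^sup>2 \<le> C0 * ((norm (xb 1 - u))\<^sup>2 / (\<eta> * real M * (real M + 1))
         + (\<Sum>t=1..M. ((norm (S t))\<^sup>2 + (norm (U t))\<^sup>2) / real t ^ 3) / (real M)\<^sup>2
         + ((norm (S (Suc M)))\<^sup>2 + (norm (U (Suc M)))\<^sup>2) / real M ^ 4)"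
    using inner_loop_error[OF H c(1) f lip_f \<nu>] by blast
  define K where "K = (1 + 1 / hmin) * (1 + 1 / (4 * hmin)) * (K\<phi> * \<sigma>2) * zeta32"
  have "0 \<le> (LINT w|P. (norm (dl 0 1 w))\<^sup>2)" by simp
  then have s2: "0 \<le> K\<phi> * \<sigma>2" using dl_sq_bound(2)[of 1 0] by linarith
  have K: "K \<ge> 0" unfolding K_def using H(2) by (intro mult_nonneg_nonneg[OF mult_nonneg_nonneg[OF _ s2] zeta32(2)]) simp
  have "\<exists>R. integrable P R \<and> (\<forall>w. 0 \<le> R w) \<and> (LINT w|P. R w) \<le> K * \<rho> ^ k \<and>
     (\<forall>w\<in>space P. \<forall>u. prox_point (D k w) (x k w) (y k w) (lam k w) u \<longrightarrow>
        (norm (x (Suc k) w - u))\<^sup>2 \<le> C0 * ((norm (xb k w - u))\<^sup>2 / (\<eta> k w * real (M k w) * (real (M k w) + 1)) + R w))" for k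
  proof -
    have coer: "c1 * (norm v)\<^sup>2 \<le> v \<bullet> (xmat (D k w) *v v)" if "w \<in> space P" for w v
      by (rule xmat_coercive[OF D_admissible[OF that]])
    interpret I: inner_noise P "F k" "M k" "\<eta> k" "\<lambda>w. xmat (D k w)" H "dl k" hmin "K\<phi> * \<sigma>2"
    proof
      show "0 \<le> v \<bullet> (xmat (D k w) *v v)" if "w \<in> space P" for w v
        using coer[OF that, of v] c by (meson mult_nonneg_nonneg less_imp_le order_trans zero_le_power2)
    qed (fact prob_space_axioms F_sub M_adapted \<eta>_adapted MM_adapted H \<eta>_pos M_pos dl_adapted dl_sq_bound dl_mean_zero)+
    have m0: "(1 + \<theta>) ^ (2 * k) > 0" using \<theta> by simp
    \<comment> \<open>With m0 = (1 + \<theta>)^(2 k), the factor 1 / sqrt m0 of the noise bound is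
      exactly \<rho>^k.\<close>
    have sq: "sqrt ((1 + \<theta>) ^ (2 * k)) = (1 + \<theta>) ^ k"
      using \<theta> by (intro real_sqrt_unique power_even_eq[symmetric] zero_le_power) simp
    have RI: "integrable P I.R" by (rule I.R_bound(1)[OF m0 M_lower])
    have RE: "(LINT w|P. I.R w) \<le> K * \<rho> ^ k"
    proof -
      have "\<rho> ^ k = 1 / (1 + \<theta>) ^ k" by (simp add: \<rho>_def power_one_over)
      then have "K * \<rho> ^ k = I.K2 * (K\<phi> * \<sigma>2) * zeta32 / (1 + \<theta>) ^ k"
        by (simp only: K_def I.K2_def I.K1_def times_divide_eq_right mult_1_right)
      then show ?thesis using I.R_bound(2)[OF m0 M_lower] unfolding sq by (simp only:)
    qed
    have "(norm (x (Suc k) w - u))\<^sup>2 \<le> C0 * ((norm (xb k w - u))\<^sup>2 / (\<eta> k w * real (M k w) * (real (M k w) + 1)) + I.R w)"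
      if w: "w \<in> space P" and u: "prox_point (D k w) (x k w) (y k w) (lam k w) u" for w u
    proof -
      have Meta: "real (M k w) * \<eta> k w \<le> 1"
        using M_pos[OF w, of k] \<rho> unfolding \<eta>_eq[OF w] \<rho>_def[symmetric] by (simp add: power_le_one)
      have run: "inner_run H Gf c1 (xmat (D k w)) (M k w) (\<eta> k w) (\<lambda>t. xbin k t w) (\<lambda>t. xin k t w) (\<lambda>t. xhat k t w)
         (\<lambda>t. dl k t w) (x k w) (- (transpose A *v (lam k w - \<beta> *\<^sub>R res (x k w) (y k w))))"
        unfolding inner_run_def
      proof (intro conjI ballI allI)
        fix t assume t: "t \<in> {1..M k w}"
        have "dl k t w = \<delta> k t w" using t by (simp add: dl_def)
        then show "(2 / (real t * \<eta> k w)) *\<^sub>R (H *v (xbin k (Suc t) w - xbin k t w)) + xmat (D k w) *v (xbin k (Suc t) w - x k w)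
          + - (transpose A *v (lam k w - \<beta> *\<^sub>R res (x k w) (y k w))) + (Gf (xhat k t w) - dl k t w) = 0"
          using inner_xb[OF w t] by simp
      qed (use coer[OF w] M_pos[OF w] \<eta>_pos[OF w] Meta xhat[OF w] inner_x[OF w] in auto)
      have noise: "noise_run H (xmat (D k w)) (M k w) (\<eta> k w) (\<lambda>t. dl k t w) (\<lambda>t. I.S t w) (\<lambda>t. I.U t w)"
        unfolding noise_run_def
      proof (intro conjI ballI)
        show "I.S 1 w = 0" by (rule I.S_1)
        show "I.U 1 w = 0" by (rule I.U_1[OF w])
        fix t
        show "I.S (Suc t) w = I.S t w + real t *\<^sub>R dl k t w" by (rule I.S.simps(2))
        show "2 *\<^sub>R (H *v I.U (Suc t) w) + (real t * \<eta> k w) *\<^sub>R (xmat (D k w) *v I.U (Suc t) w) = 2 *\<^sub>R (H *v I.U t w) + real t *\<^sub>R dl k t w"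
          by (rule I.U_eq[OF w])
      qed
      have e1: "xin k (Suc (M k w)) w = x (Suc k) w" using outer_x[OF w, of k] by simp
      have e2: "xbin k 1 w = xb k w" using inner_start[OF w, of k] by simp
      show ?thesis
        using C0(2)[OF run noise u[unfolded prox_point_def]] unfolding e1 e2 I.R_def I.W_def add.assoc .
    qed
    then show ?thesis using RI RE I.R_nonneg by blast
  qed
  then show ?thesis using C0(1) K by blast
qed

text \<open>Since \<eta> M = \<rho>^k, the gap is of order X (1 + |u|^2) / (\<rho>^k M), where X =
  |xb|^2 + 1 has no a priori bound. The growth rule contains the same X and gives M \<ge> (1 +
  \<theta>)^(2 k) X, so X cancels and \<rho>^(2 k) / \<rho>^k remains. At k = 0 the start is the
  deterministic \<open>x0\<close>, which explains the constant.\<close>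

lemma start_gap:
  assumes w: "w \<in> space P"
  shows "(norm (xb k w - u))\<^sup>2 / (\<eta> k w * real (M k w) * (real (M k w) + 1))
    \<le> 2 * ((norm x0)\<^sup>2 + 1) * (1 + (norm u)\<^sup>2) * \<rho> ^ k"
proof -
  define m where "m = real (M k w)"
  have m: "m > 0" using M_pos[OF w] by (simp add: m_def)
  define X where "X = (norm (xb k w))\<^sup>2 + 1"
  have X: "X \<ge> 1" by (simp add: X_def)
  have em: "\<eta> k w * m = \<rho> ^ k" using m \<eta>_eq[OF w, of k] by (simp add: m_def \<rho>_def)
  have n: "(norm (xb k w - u))\<^sup>2 \<le> 2 * X * (1 + (norm u)\<^sup>2)"
  proof -
    have "(norm (xb k w - u))\<^sup>2 \<le> 2 * (norm (xb k w))\<^sup>2 + 2 * (norm u)\<^sup>2"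
      using norm_add_sq_le[of "xb k w" "- u"] by simp
    also have "\<dots> \<le> 2 * X * (1 + (norm u)\<^sup>2)" by (simp add: X_def algebra_simps)
    finally show ?thesis .
  qed
  have lb: "X \<le> ((norm x0)\<^sup>2 + 1) * (\<rho> ^ k * \<rho> ^ k) * (m + 1)"
  proof (cases k)
    case 0
    have "X * 1 \<le> ((norm x0)\<^sup>2 + 1) * (m + 1)"
      using m init[OF w] 0 X by (intro mult_mono) (auto simp: X_def)
    then show ?thesis using 0 by simp
  next
    case (Suc j)
    have "(1 + \<theta>) ^ k * (1 + \<theta>) ^ k * X = (1 + \<theta>)\<^sup>2 * (1 + \<theta>) ^ (2 * j) * X"
      by (simp add: Suc power2_eq_square mult_2 power_add)
    also have "\<dots> \<le> (1 + \<theta>)\<^sup>2 * real (M j w) * X"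
      using M_lower[OF w, of j] \<theta> X by (intro mult_right_mono mult_left_mono) auto
    also have "\<dots> \<le> m" using M_growth[OF w, of j] by (simp add: m_def X_def Suc)
    finally have "(1 + \<theta>) ^ k * (1 + \<theta>) ^ k * X \<le> m" .
    then have "(\<rho> ^ k * \<rho> ^ k) * ((1 + \<theta>) ^ k * (1 + \<theta>) ^ k * X) \<le> (\<rho> ^ k * \<rho> ^ k) * m"
      using \<rho> by (intro mult_left_mono) auto
    also have "(\<rho> ^ k * \<rho> ^ k) * ((1 + \<theta>) ^ k * (1 + \<theta>) ^ k * X) = X"
      using \<theta> by (simp add: \<rho>_def power_one_over field_simps)
    finally have "X \<le> (\<rho> ^ k * \<rho> ^ k) * m" .
    also have "(\<rho> ^ k * \<rho> ^ k) * m \<le> (((norm x0)\<^sup>2 + 1) * (\<rho> ^ k * \<rho> ^ k)) * (m + 1)"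
    proof (rule mult_mono)
      show "\<rho> ^ k * \<rho> ^ k \<le> ((norm x0)\<^sup>2 + 1) * (\<rho> ^ k * \<rho> ^ k)"
        using mult_right_mono[of 1 "(norm x0)\<^sup>2 + 1" "\<rho> ^ k * \<rho> ^ k"] \<rho> by simp
    qed (use m \<rho> in auto)
    finally show ?thesis .
  qed
  have r0: "\<rho> ^ k > 0" using \<rho> by simp
  have "(norm (xb k w - u))\<^sup>2 / (\<rho> ^ k * (m + 1)) \<le> 2 * ((norm x0)\<^sup>2 + 1) * (1 + (norm u)\<^sup>2) * \<rho> ^ k"
  proof -
    define Y where "Y = 1 + (norm u)\<^sup>2"
    define Z where "Z = (norm x0)\<^sup>2 + 1"
    have "(norm (xb k w - u))\<^sup>2 \<le> (2 * Y) * X" using n by (simp only: Y_def mult_ac)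
    also have "\<dots> \<le> (2 * Y) * (Z * (\<rho> ^ k * \<rho> ^ k) * (m + 1))"
      unfolding Z_def by (rule mult_left_mono[OF lb]) (simp add: Y_def)
    also have "\<dots> = (2 * Z * Y * \<rho> ^ k) * (\<rho> ^ k * (m + 1))" by (simp only: mult_ac)
    finally have "(norm (xb k w - u))\<^sup>2 \<le> (2 * ((norm x0)\<^sup>2 + 1) * (1 + (norm u)\<^sup>2) * \<rho> ^ k) * (\<rho> ^ k * (m + 1))"
      by (simp only: Y_def Z_def)
    then show ?thesis using r0 m by (subst pos_divide_le_eq) auto
  qed
  then show ?thesis unfolding m_def[symmetric] em .
qed

definition "Phi k w = lyap (D k w) (x k w) (y k w) (lam k w)"

lemma Phi_nonneg: "w \<in> space P \<Longrightarrow> 0 \<le> Phi k w"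
  unfolding Phi_def by (rule lyap_nonneg[OF D_admissible])

lemma y_stationary:
  assumes w: "w \<in> space P" and k: "k \<ge> 1"
  shows "Gg (y k w) = transpose B *v (lam k w + ((s - 1) * \<beta>) *\<^sub>R res (x k w) (y k w))"
proof -
  obtain j where j: "k = Suc j" using k by (cases k) auto
  have "lam k w + ((s - 1) * \<beta>) *\<^sub>R res (x k w) (y k w) = lam j w - \<beta> *\<^sub>R res (x k w) (y k w)"
    unfolding j outer_lam[OF w] by (simp add: algebra_simps)
  then show ?thesis using outer_y[OF w, of j] j by simp
qed

text \<open>Expressing |u|^2 by the Lyapunov function makes the squared inner error a multiple of
  \<rho>^k (Phi + 1) plus noise. The first inequality holds for all k and propagates integrability;
  the contraction relies on stationarity of the old \<open>y\<close>, hence k \<ge> 1.\<close>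

lemma Phi_recursion:
  "\<exists>q C R. 0 \<le> q \<and> q < 1 \<and> C > 0 \<and>
     (\<forall>k. integrable P (R k) \<and> (\<forall>w. 0 \<le> R k w) \<and> (LINT w|P. R k w) \<le> C * \<rho> ^ k \<and>
       (\<forall>w\<in>space P. Phi (Suc k) w \<le> C * Phi k w + C * \<rho> ^ k + R k w \<and>
         (k \<ge> 1 \<longrightarrow> Phi (Suc k) w \<le> (q + C * \<rho> ^ k) * Phi k w + C * \<rho> ^ k + R k w)))"
proof -
  obtain C0 K R where C0: "C0 > 0" "K \<ge> 0" and R: "\<And>k. integrable P (R k)" "\<And>k w. 0 \<le> R k w"
    "\<And>k. (LINT w|P. R k w) \<le> K * \<rho> ^ k" and err: "\<And>k w u. w \<in> space P \<Longrightarrow> prox_point (D k w) (x k w) (y k w) (lam k w) u \<Longrightarrow>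
        (norm (x (Suc k) w - u))\<^sup>2 \<le> C0 * ((norm (xb k w - u))\<^sup>2 / (\<eta> k w * real (M k w) * (real (M k w) + 1)) + R k w)"
    using noise_term by metis
  obtain C1 where C1: "C1 > 0" "\<And>D x y l u. admissible D \<Longrightarrow> prox_point D x y l u \<Longrightarrow> (norm (u - xs))\<^sup>2 \<le> C1 * lyap D x y l"
    using prox_point_error by blast
  obtain C2 where C2: "C2 > 0" "\<And>D x y l u x' y' l'. admissible D \<Longrightarrow> prox_point D x y l u \<Longrightarrow>
     Gg y' = transpose B *v (l - \<beta> *\<^sub>R res x' y') \<Longrightarrow> l' = l - (s * \<beta>) *\<^sub>R res x' y' \<Longrightarrow>
     lyap D x' y' l' \<le> C2 * (lyap D x y l + (norm (x' - u))\<^sup>2)"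
    using lyap_step_crude by blast
  obtain q C3 where C3: "0 \<le> q" "q < 1" "C3 > 0" "\<And>D x y l u x' y' l'. admissible D \<Longrightarrow> prox_point D x y l u \<Longrightarrow>
     Gg y' = transpose B *v (l - \<beta> *\<^sub>R res x' y') \<Longrightarrow> l' = l - (s * \<beta>) *\<^sub>R res x' y' \<Longrightarrow>
     Gg y = transpose B *v (l + ((s - 1) * \<beta>) *\<^sub>R res x y) \<Longrightarrow>
     lyap D x' y' l' \<le> q * lyap D x y l + C3 * (norm (x' - u))\<^sup>2"
    using lyap_step by blast
  define E where "E = C0 * (2 * ((norm x0)\<^sup>2 + 1)) * (1 + 2 * (norm xs)\<^sup>2 + 2 * C1)"
  have E: "E > 0" unfolding E_def using C0 C1
    by (intro mult_pos_pos add_pos_nonneg add_nonneg_pos) (auto intro: add_nonneg_pos)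
  have err2: "(norm (x (Suc k) w - u))\<^sup>2 \<le> E * \<rho> ^ k * Phi k w + E * \<rho> ^ k + C0 * R k w"
    if w: "w \<in> space P" and u: "prox_point (D k w) (x k w) (y k w) (lam k w) u" for k w u
  proof -
    have "(norm u)\<^sup>2 \<le> 2 * (norm (u - xs))\<^sup>2 + 2 * (norm xs)\<^sup>2" using norm_add_sq_le[of "u - xs" xs] by simp
    also have "\<dots> \<le> 2 * (C1 * Phi k w) + 2 * (norm xs)\<^sup>2"
      using C1(2)[OF D_admissible[OF w] u] by (simp add: Phi_def)
    finally have "1 + (norm u)\<^sup>2 \<le> (1 + 2 * (norm xs)\<^sup>2) * 1 + 2 * C1 * Phi k w" by simp
    also have "\<dots> \<le> (1 + 2 * (norm xs)\<^sup>2) * (Phi k w + 1) + 2 * C1 * (Phi k w + 1)"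
      using Phi_nonneg[OF w, of k] C1 by (intro add_mono mult_left_mono) auto
    also have "\<dots> = (1 + 2 * (norm xs)\<^sup>2 + 2 * C1) * (Phi k w + 1)" by (simp add: algebra_simps)
    finally have nu: "1 + (norm u)\<^sup>2 \<le> (1 + 2 * (norm xs)\<^sup>2 + 2 * C1) * (Phi k w + 1)" .
    have "(norm (x (Suc k) w - u))\<^sup>2 \<le> C0 * (2 * ((norm x0)\<^sup>2 + 1) * (1 + (norm u)\<^sup>2) * \<rho> ^ k + R k w)"
      using err[OF w u] start_gap[OF w, of k u] C0(1) by (smt (verit) mult_left_mono)
    also have "\<dots> = C0 * (2 * ((norm x0)\<^sup>2 + 1)) * \<rho> ^ k * (1 + (norm u)\<^sup>2) + C0 * R k w"
      by (simp add: distrib_left mult_ac)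
    also have "C0 * (2 * ((norm x0)\<^sup>2 + 1)) * \<rho> ^ k * (1 + (norm u)\<^sup>2)
       \<le> C0 * (2 * ((norm x0)\<^sup>2 + 1)) * \<rho> ^ k * ((1 + 2 * (norm xs)\<^sup>2 + 2 * C1) * (Phi k w + 1))"
      using nu C0(1) \<rho> by (intro mult_left_mono) auto
    also have "\<dots> = E * \<rho> ^ k * Phi k w + E * \<rho> ^ k" by (simp add: E_def algebra_simps)
    finally show ?thesis by simp
  qed
  define Cm where "Cm = max C2 C3"
  have Cm: "C2 \<le> Cm" "C3 \<le> Cm" "Cm > 0" using C2(1) by (auto simp: Cm_def)
  define C where "C = C2 + Cm * E + Cm * C0 * K"
  have C: "C > 0" "Cm * E \<le> C" "Cm * C0 * K \<le> C" "C2 + Cm * E \<le> C"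
    using C2(1) Cm E C0 by (auto simp: C_def intro!: add_pos_nonneg)
  define R' where "R' k w = Cm * C0 * R k w" for k w
  have rk: "0 < \<rho> ^ k" "\<rho> ^ k \<le> 1" for k using \<rho> by (auto simp: power_le_one)
  have main: "Phi (Suc k) w \<le> C * Phi k w + C * \<rho> ^ k + R' k w \<and>
         (k \<ge> 1 \<longrightarrow> Phi (Suc k) w \<le> (q + C * \<rho> ^ k) * Phi k w + C * \<rho> ^ k + R' k w)" if w: "w \<in> space P" for k w
  proof -
    obtain u where u: "prox_point (D k w) (x k w) (y k w) (lam k w) u"
      using prox_point_exists[OF D_admissible[OF w]] by blast
    define L where "L = lyap (D k w) (x (Suc k) w) (y (Suc k) w) (lam (Suc k) w)"
    define n2 where "n2 = (norm (x (Suc k) w - u))\<^sup>2"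
    have P0: "0 \<le> Phi k w" by (rule Phi_nonneg[OF w])
    \<comment> \<open>The step estimates keep the old matrix \<open>D k\<close>; the decrease of
      \<open>D\<close> in the Loewner order allows the passage to \<open>D (Suc k)\<close>.\<close>
    have PL: "Phi (Suc k) w \<le> L"
      unfolding Phi_def L_def lyap_def using D_decreasing[OF w] by simp
    have n2: "Cm * n2 \<le> Cm * E * \<rho> ^ k * Phi k w + Cm * E * \<rho> ^ k + R' k w"
      using mult_left_mono[OF err2[OF w u], of Cm] Cm(3) by (simp add: n2_def R'_def distrib_left mult_ac)
    have n20: "0 \<le> n2" by (simp add: n2_def)
    have b1: "Cm * E * \<rho> ^ k \<le> C * \<rho> ^ k" using C rk[of k] by (intro mult_right_mono) auto
    have b2: "Cm * E * \<rho> ^ k * Phi k w \<le> C * \<rho> ^ k * Phi k w" using b1 P0 by (rule mult_right_mono)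
    have "L \<le> C2 * (Phi k w + n2)"
      unfolding L_def Phi_def n2_def by (rule C2(2)[OF D_admissible[OF w] u outer_y[OF w] outer_lam[OF w]])
    also have "\<dots> \<le> C2 * Phi k w + Cm * n2" using Cm n20 by (simp add: distrib_left mult_right_mono)
    also have "\<dots> \<le> C2 * Phi k w + (Cm * E * 1 * Phi k w + C * \<rho> ^ k + R' k w)"
    proof -
      have "Cm * E * \<rho> ^ k * Phi k w \<le> Cm * E * 1 * Phi k w"
        using rk Cm E P0 by (intro mult_right_mono mult_left_mono) auto
      then show ?thesis using n2 b1 by linarith
    qed
    also have "\<dots> = (C2 + Cm * E) * Phi k w + C * \<rho> ^ k + R' k w" by (simp add: distrib_right)
    also have "\<dots> \<le> C * Phi k w + C * \<rho> ^ k + R' k w" using C P0 by (simp add: mult_right_mono)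
    finally have 1: "L \<le> C * Phi k w + C * \<rho> ^ k + R' k w" .
    have 2: "L \<le> (q + C * \<rho> ^ k) * Phi k w + C * \<rho> ^ k + R' k w" if k: "k \<ge> 1"
    proof -
      have "L \<le> q * Phi k w + C3 * n2"
        unfolding L_def Phi_def n2_def
        by (rule C3(4)[OF D_admissible[OF w] u outer_y[OF w] outer_lam[OF w] y_stationary[OF w k]])
      also have "\<dots> \<le> q * Phi k w + Cm * n2" using Cm n20 by (simp add: mult_right_mono)
      also have "\<dots> \<le> q * Phi k w + (C * \<rho> ^ k * Phi k w + C * \<rho> ^ k + R' k w)" using n2 b1 b2 by linarith
      finally show ?thesis by (simp add: distrib_right)
    qed
    show ?thesis using 1 2 PL by fastforce
  qed
  have R'I: "integrable P (R' k)" for k unfolding R'_def[abs_def] using R(1) by simp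
  have R'0: "0 \<le> R' k w" for k w using R(2) Cm C0 by (simp add: R'_def)
  have R'E: "(LINT w|P. R' k w) \<le> C * \<rho> ^ k" for k
  proof -
    have "(LINT w|P. R' k w) = Cm * C0 * (LINT w|P. R k w)" by (simp add: R'_def)
    also have "\<dots> \<le> Cm * C0 * (K * \<rho> ^ k)" using R(3) Cm C0 by (intro mult_left_mono) auto
    also have "\<dots> = Cm * C0 * K * \<rho> ^ k" by simp
    also have "\<dots> \<le> C * \<rho> ^ k" using C rk[of k] by (intro mult_right_mono) auto
    finally show ?thesis .
  qed
  show ?thesis using C3(1,2) C(1) R'I R'0 R'E main by blast
qed

lemma multdist_cont: "continuous_on UNIV multdist"
proof -
  have "continuous_on UNIV (closest_point \<Lambda>)"
    by (rule continuous_on_closest_point[OF convex_multipliers closed_multipliers \<Lambda>(2)])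
  from continuous_on_norm[OF continuous_on_diff[OF continuous_on_id this]]
  show ?thesis unfolding multdist_def[abs_def] by simp
qed

lemma outer_measP:
  "x k \<in> borel_measurable P" "y k \<in> borel_measurable P" "lam k \<in> borel_measurable P"
  "(\<lambda>w. xmat (D k w)) \<in> borel_measurable P"
proof -
  have o: "x k \<in> borel_measurable (F k 1)" "lam k \<in> borel_measurable (F k 1)" using outer_meas[of k] by simp_all
  show "x k \<in> borel_measurable P" by (rule F_P[OF order_refl o(1)])
  show "y k \<in> borel_measurable P" by (rule F_P[OF order_refl y_adapted])
  show "lam k \<in> borel_measurable P" by (rule F_P[OF order_refl o(2)])
  show "(\<lambda>w. xmat (D k w)) \<in> borel_measurable P" by (rule F_P[OF order_refl MM_adapted])
qed

lemma multdist_meas: "(\<lambda>w. multdist (lam k w)) \<in> borel_measurable P"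
  by (rule borel_measurable_continuous_on[OF multdist_cont outer_measP(3)])

lemma integrable_of_le:
  fixes g h :: "'w \<Rightarrow> real"
  assumes "g \<in> borel_measurable P" "\<And>w. w \<in> space P \<Longrightarrow> 0 \<le> g w" "\<And>w. w \<in> space P \<Longrightarrow> g w \<le> h w" "integrable P h"
  shows "integrable P g"
proof (rule Bochner_Integration.integrable_bound[OF assms(4,1)])
  show "AE w in P. norm (g w) \<le> norm (h w)"
  proof (rule AE_I2)
    fix w assume "w \<in> space P"
    then show "norm (g w) \<le> norm (h w)" using assms(2,3)[of w] by simp
  qed
qed

lemma Phi_meas: "Phi k \<in> borel_measurable P"
proof -
  note [measurable] = outer_measP[of k] multdist_meas[of k]
  have D: "D k w *v v = xmat (D k w) *v v - \<beta> *\<^sub>R (transpose A *v (A *v v))" for w v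
    by (simp add: xmat_apply)
  show ?thesis unfolding Phi_def[abs_def] lyap_def D res_def by measurable
qed

text \<open>At the start only \<open>D 0\<close> is random, and its form is bounded through
  \<open>c2\<close>. Afterwards the recursion valid for all k carries integrability along.\<close>

lemma Phi_integrable: "integrable P (Phi k)"
proof (induction k)
  case 0
  define K where "K = c2 * (norm (x0 - xs))\<^sup>2 + \<alpha> * (norm (y0 - ys))\<^sup>2 + \<beta> * (norm (B *v (y0 - ys)))\<^sup>2
    + (multdist lam0)\<^sup>2 / (s * \<beta>) + \<omega> * \<beta> * (norm (res x0 y0))\<^sup>2"
  have "Phi 0 w \<le> K" if w: "w \<in> space P" for w
    using init[OF w] admissibleD(3)[OF D_admissible[OF w], of "x0 - xs" 0] by (simp add: Phi_def lyap_def K_def)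
  then show ?case using Phi_meas Phi_nonneg by (intro integrable_const_bound[of _ K]) auto
next
  case (Suc k)
  obtain C :: real and R where R: "integrable P R" and le: "\<And>w. w \<in> space P \<Longrightarrow> Phi (Suc k) w \<le> C * Phi k w + C * \<rho> ^ k + R w"
    using Phi_recursion by blast
  show ?case by (rule integrable_of_le[OF Phi_meas Phi_nonneg le]) (use Suc R in auto)
qed

theorem linear_rate:
  "\<exists>c \<tau>. c > 0 \<and> 0 < \<tau> \<and> \<tau> < 1 \<and>
    (\<forall>k. integrable P (\<lambda>w. (norm (x k w - xs))\<^sup>2 + (norm (y k w - ys))\<^sup>2 + (multdist (lam k w))\<^sup>2) \<and>
      (LINT w|P. (norm (x k w - xs))\<^sup>2 + (norm (y k w - ys))\<^sup>2 + (multdist (lam k w))\<^sup>2) \<le> c * \<tau> ^ k)"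
proof -
  obtain q C R where q: "0 \<le> q" "q < 1" "C > 0" and R: "\<And>k. integrable P (R k)" "\<And>k. (LINT w|P. R k w) \<le> C * \<rho> ^ k"
    and rec: "\<And>k w. w \<in> space P \<Longrightarrow> k \<ge> 1 \<Longrightarrow> Phi (Suc k) w \<le> (q + C * \<rho> ^ k) * Phi k w + C * \<rho> ^ k + R k w"
    using Phi_recursion by metis
  define a where "a k = (LINT w|P. Phi k w)" for k
  have a0: "a k \<ge> 0" for k unfolding a_def using Phi_nonneg by (intro integral_nonneg_AE AE_I2) auto
  \<comment> \<open>The 2 merges the deterministic perturbation and the expected noise, each at most
    C \<rho>^k.\<close>
  have arec: "a (Suc k) \<le> (q + (2 * C) * \<rho> ^ k) * a k + (2 * C) * \<rho> ^ k" if k: "k \<ge> 1" for k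
  proof -
    have "a (Suc k) \<le> (LINT w|P. (q + C * \<rho> ^ k) * Phi k w + C * \<rho> ^ k + R k w)"
      unfolding a_def using rec k Phi_integrable R by (intro integral_mono) auto
    also have "\<dots> = (q + C * \<rho> ^ k) * a k + C * \<rho> ^ k + (LINT w|P. R k w)"
      using Phi_integrable R by (simp add: a_def prob_space)
    also have "\<dots> \<le> (q + (2 * C) * \<rho> ^ k) * a k + C * \<rho> ^ k + C * \<rho> ^ k"
      using R(2)[of k] a0[of k] q(3) \<rho> by (intro add_mono mult_right_mono) auto
    finally show ?thesis by simp
  qed
  obtain c \<tau> where c: "c > 0" "0 < \<tau>" "\<tau> < 1" "\<And>k. a k \<le> c * \<tau> ^ k"
    using perturbed_contraction_rate[of a q \<rho> "2 * C", OF a0 q(1,2) \<rho> _ arec] q(3) by auto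
  obtain C0 where C0: "C0 > 0" "\<And>D x y l. admissible D \<Longrightarrow>
     (norm (x - xs))\<^sup>2 + (norm (y - ys))\<^sup>2 + (multdist l)\<^sup>2 + (norm (res x y))\<^sup>2 \<le> C0 * lyap D x y l"
    using lyap_lower by blast
  define Z where "Z k w = (norm (x k w - xs))\<^sup>2 + (norm (y k w - ys))\<^sup>2 + (multdist (lam k w))\<^sup>2" for k w
  have Z: "Z k w \<le> C0 * Phi k w" if w: "w \<in> space P" for k w
    using C0(2)[OF D_admissible[OF w], of "x k w" "y k w" "lam k w" k] zero_le_power2[of "norm (res (x k w) (y k w))"]
    unfolding Z_def Phi_def by linarith
  have Z0: "0 \<le> Z k w" for k w by (simp add: Z_def)
  have Zm: "Z k \<in> borel_measurable P" for k
  proof -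
    note [measurable] = outer_measP[of k] multdist_meas[of k]
    show ?thesis unfolding Z_def[abs_def] by measurable
  qed
  have Zi: "integrable P (Z k)" for k
    by (rule integrable_of_le[OF Zm Z0 Z]) (simp_all add: Phi_integrable)
  have ZE: "(LINT w|P. Z k w) \<le> (C0 * c) * \<tau> ^ k" for k
  proof -
    have "(LINT w|P. Z k w) \<le> (LINT w|P. C0 * Phi k w)"
      using Zi Phi_integrable Z by (intro integral_mono) auto
    also have "\<dots> = C0 * a k" by (simp add: a_def)
    also have "\<dots> \<le> C0 * (c * \<tau> ^ k)" using c(4)[of k] C0(1) by simp
    finally show ?thesis by simp
  qed
  have "C0 * c > 0" using C0(1) c(1) by simp
  then show ?thesis using c(2,3) Zi ZE unfolding Z_def by blast
qed

end

section \<open>From minimization problems to optimality equations and multipliers\<close>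

lemma gderiv_average:
  assumes "\<And>j. j \<in> J \<Longrightarrow> GDERIV (fj j) x :> D j"
  shows "GDERIV (\<lambda>u. c * (\<Sum>j\<in>J. fj j u)) x :> c *\<^sub>R (\<Sum>j\<in>J. D j)"
proof -
  have "((\<lambda>u. c * (\<Sum>j\<in>J. fj j u)) has_derivative (\<lambda>h. c * (\<Sum>j\<in>J. h \<bullet> D j))) (at x)"
    using assms unfolding gderiv_def by (intro has_derivative_mult_right has_derivative_sum) auto
  then show ?thesis by (simp add: gderiv_def inner_sum_right)
qed

lemma gderiv_cmult: "GDERIV f x :> D \<Longrightarrow> GDERIV (\<lambda>u. c * f u) x :> c *\<^sub>R D"
  using gderiv_average[of "{()}" "\<lambda>_. f" x "\<lambda>_. D" c] by simp

lemma prox_quadratic_stationary: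
  fixes H Q :: "real^'n^'n"
  assumes "transpose H = H" "transpose Q = Q"
    and min: "is_arg_min (\<lambda>u. v \<bullet> u + r / 2 * qform H (u - y) + 1 / 2 * qform Q (u - z)) (\<lambda>u. u \<in> UNIV) x"
  shows "r *\<^sub>R (H *v (x - y)) + Q *v (x - z) + v = 0"
proof -
  have "GDERIV (\<lambda>u. v \<bullet> u + r / 2 * qform H (u - y) + 1 / 2 * qform Q (u - z)) x
      :> v + (r / 2) *\<^sub>R (2 *\<^sub>R (H *v (x - y))) + (1 / 2) *\<^sub>R (2 *\<^sub>R (Q *v (x - z)))"
    by (intro GDERIV_add gderiv_inner_const gderiv_cmult gderiv_qform assms)
  then have "v + (r / 2) *\<^sub>R (2 *\<^sub>R (H *v (x - y))) + (1 / 2) *\<^sub>R (2 *\<^sub>R (Q *v (x - z))) = 0"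
    by (rule gderiv_minimum) (use min in \<open>auto simp: is_arg_min_def not_less\<close>)
  then show ?thesis by (simp add: add_ac)
qed

lemma augmented_stationary:
  fixes B :: "real^'q^'n"
  assumes "\<beta> > 0" "GDERIV g y :> D"
    and min: "is_arg_min (\<lambda>v. g v + \<beta> / 2 * (norm (a + B *v v - b - (1 / \<beta>) *\<^sub>R l))\<^sup>2) (\<lambda>v. v \<in> UNIV) y"
  shows "D = transpose B *v (l - \<beta> *\<^sub>R (a + B *v y - b))"
proof -
  have e: "a + B *v v - b - (1 / \<beta>) *\<^sub>R l = (a - b - (1 / \<beta>) *\<^sub>R l) + B *v v" for v by simp
  have "GDERIV (\<lambda>v. g v + \<beta> / 2 * (norm ((a - b - (1 / \<beta>) *\<^sub>R l) + B *v v))\<^sup>2) y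
      :> D + (\<beta> / 2) *\<^sub>R (2 *\<^sub>R (transpose B *v ((a - b - (1 / \<beta>) *\<^sub>R l) + B *v y)))"
    by (intro GDERIV_add assms gderiv_cmult gderiv_norm_affine)
  then have "D + (\<beta> / 2) *\<^sub>R (2 *\<^sub>R (transpose B *v ((a - b - (1 / \<beta>) *\<^sub>R l) + B *v y))) = 0"
    by (rule gderiv_minimum) (use min in \<open>auto simp: is_arg_min_def not_less e\<close>)
  then have "D = - (\<beta> *\<^sub>R (transpose B *v ((a - b - (1 / \<beta>) *\<^sub>R l) + B *v y)))"
    by (simp add: eq_neg_iff_add_eq_0 del: transpose_matrix_vector)
  also have "\<dots> = transpose B *v (- (\<beta> *\<^sub>R ((a - b - (1 / \<beta>) *\<^sub>R l) + B *v y)))"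
    by (simp add: matrix_vector_mult_scaleR vec.neg del: transpose_matrix_vector)
  also have "- (\<beta> *\<^sub>R ((a - b - (1 / \<beta>) *\<^sub>R l) + B *v y)) = l - \<beta> *\<^sub>R (a + B *v y - b)"
    using assms(1) by (simp add: vec_eq_iff algebra_simps)
  finally show ?thesis .
qed

text \<open>The saddle point comes with its own primal part (u, v), whereas \<Lambda> is defined at
  the given solution. Maximality in the multiplier, tested at \<open>l + r\<close>, makes (u, v)
  feasible. The given solution has no larger objective value, so it minimizes the Lagrangian for
  \<open>l\<close> as well, and stationarity there gives the equations. This is how \<Lambda> is
  seen to be nonempty.\<close>

lemma saddle_point_multiplier:
  fixes A :: "real^'p^'n" and B :: "real^'q^'n"
  assumes Gf: "GDERIV f xs :> Df" and Gg: "GDERIV g ys :> Dg"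
    and sp: "saddle_point UNIV UNIV UNIV (\<lambda>u v l. f u + g v + l \<bullet> (b - A *v u - B *v v)) u v l"
    and sol: "is_arg_min (\<lambda>(u, v). f u + g v) (\<lambda>(u, v). u \<in> UNIV \<and> v \<in> UNIV \<and> A *v u + B *v v = b) (xs, ys)"
  shows "transpose A *v l = Df" "transpose B *v l = Dg"
proof -
  define r where "r = b - A *v u - B *v v"
  have mx: "l' \<bullet> r \<le> l \<bullet> r" for l' using sp by (auto simp: saddle_point_def r_def)
  from mx[of "l + r"] have "r \<bullet> r \<le> 0" by (simp add: inner_add_left)
  then have r: "r = 0" by (metis inner_gt_zero_iff not_less)
  have mn: "f u + g v \<le> f u' + g v' + l \<bullet> (b - A *v u' - B *v v')" for u' v'
    using sp r by (auto simp: saddle_point_def r_def)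
  have feas: "A *v xs + B *v ys = b" using sol by (simp add: is_arg_min_def)
  have "A *v u + B *v v = b" using r by (simp add: r_def algebra_simps)
  then have "f xs + g ys \<le> f u + g v" using sol by (auto simp: is_arg_min_def not_less)
  with mn have mn': "f xs + g ys \<le> f u' + g v' + l \<bullet> (b - A *v u' - B *v v')" for u' v'
    by (meson order_trans)
  have lA: "l \<bullet> (A *v u') = (transpose A *v l) \<bullet> u'" for u' by (rule matrix_inner_transpose)
  have lB: "l \<bullet> (B *v v') = (transpose B *v l) \<bullet> v'" for v' by (rule matrix_inner_transpose)
  have "GDERIV (\<lambda>u. f u + (- (transpose A *v l)) \<bullet> u) xs :> Df + - (transpose A *v l)"
    by (intro GDERIV_add Gf gderiv_inner_const)
  moreover have "f xs + (- (transpose A *v l)) \<bullet> xs \<le> f u' + (- (transpose A *v l)) \<bullet> u'" for u'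
  proof -
    have "l \<bullet> (b - A *v u' - B *v ys) = l \<bullet> (A *v xs) - l \<bullet> (A *v u')"
      unfolding feas[symmetric] by (simp add: inner_diff_right inner_add_right)
    then show ?thesis using mn'[of u' ys] unfolding lA inner_minus_left by linarith
  qed
  ultimately have "Df + - (transpose A *v l) = 0" by (rule gderiv_minimum)
  then show "transpose A *v l = Df" by simp
  have "GDERIV (\<lambda>v. g v + (- (transpose B *v l)) \<bullet> v) ys :> Dg + - (transpose B *v l)"
    by (intro GDERIV_add Gg gderiv_inner_const)
  moreover have "g ys + (- (transpose B *v l)) \<bullet> ys \<le> g v' + (- (transpose B *v l)) \<bullet> v'" for v'
  proof -
    have "l \<bullet> (b - A *v xs - B *v v') = l \<bullet> (B *v ys) - l \<bullet> (B *v v')"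
      unfolding feas[symmetric] by (simp add: inner_diff_right inner_add_right)
    then show ?thesis using mn'[of xs v'] unfolding lB inner_minus_left by linarith
  qed
  ultimately have "Dg + - (transpose B *v l) = 0" by (rule gderiv_minimum)
  then show "transpose B *v l = Dg" by simp
qed

text \<open>The substitution v = H z turns the form of the inverse into the form of \<open>H\<close>
  at z.\<close>

lemma norm_le_inverse_qform:
  fixes H :: "real^'n^'n"
  assumes c: "c > 0" "\<And>v. c * (norm v)\<^sup>2 \<le> v \<bullet> (H *v v)" and K: "\<And>v. norm (H *v v) \<le> K * norm v"
  shows "(norm v)\<^sup>2 \<le> K\<^sup>2 / c * qform (matrix_inv H) v"
proof -
  have pos: "0 < x \<bullet> (H *v x)" if "x \<noteq> 0" for x
  proof -
    have "0 < c * (norm x)\<^sup>2" using that c by simp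
    also have "\<dots> \<le> x \<bullet> (H *v x)" by (rule c(2))
    finally show ?thesis .
  qed
  have "invertible H" using coercive_det_nonzero[OF pos] by (simp add: invertible_det_nz)
  then have inv: "H ** matrix_inv H = mat 1"
    unfolding invertible_def matrix_inv_def by (rule someI2_ex) simp
  define z where "z = matrix_inv H *v v"
  have v: "H *v z = v" unfolding z_def matrix_vector_mul_assoc inv by simp
  have "(norm v)\<^sup>2 \<le> (K * norm z)\<^sup>2" using K[of z] unfolding v by (intro power_mono) auto
  also have "\<dots> = K\<^sup>2 / c * (c * (norm z)\<^sup>2)" using c by (simp add: power_mult_distrib)
  also have "\<dots> \<le> K\<^sup>2 / c * (z \<bullet> (H *v z))" using c by (intro mult_left_mono) auto
  also have "z \<bullet> (H *v z) = qform (matrix_inv H) v" unfolding v by (simp add: qform_def z_def inner_commute)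
  finally show ?thesis .
qed

lemma loewner_le_iff:
  "G \<preceq>\<^sub>L K \<longleftrightarrow> transpose (K - G) = K - G \<and> (\<forall>v. v \<bullet> (G *v v) \<le> v \<bullet> (K *v v))"
  by (simp add: loewner_le_def pos_semidef_def qform_def matrix_vector_mult_diff_rdistrib inner_diff_right)

lemma mat_mult_vector: "mat c *v v = c *\<^sub>R (v :: real^'n)"
  by (simp add: mat_def matrix_vector_mult_def vec_eq_iff if_distrib[of "\<lambda>a. a * _"] cong: if_cong)

theorem proposition9p3:
  fixes P :: "'w measure" and F :: "nat \<Rightarrow> nat \<Rightarrow> 'w measure"
    and X :: "(real^'n1) set" and Y :: "(real^'n2) set"
    and N :: nat and fj :: "nat \<Rightarrow> real^'n1 \<Rightarrow> real"
    and f :: "real^'n1 \<Rightarrow> real" and g :: "real^'n2 \<Rightarrow> real"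
    and A :: "real^'n1^'n" and B :: "real^'n2^'n" and b :: "real^'n"
    and H :: "real^'n1^'n1"
    and \<beta> s \<nu> \<alpha> \<sigma> \<theta> c1 c2 :: real
    and M0 :: nat and M :: "nat \<Rightarrow> 'w \<Rightarrow> nat" and \<eta> :: "nat \<Rightarrow> 'w \<Rightarrow> real"
    and MM D :: "nat \<Rightarrow> 'w \<Rightarrow> real^'n1^'n1"
    and \<xi> :: "nat \<Rightarrow> nat \<Rightarrow> 'w \<Rightarrow> nat" and e :: "nat \<Rightarrow> nat \<Rightarrow> 'w \<Rightarrow> real^'n1"
    and x0 :: "real^'n1" and y0 :: "real^'n2" and lam0 :: "real^'n"
    and x xb h :: "nat \<Rightarrow> 'w \<Rightarrow> real^'n1" and y :: "nat \<Rightarrow> 'w \<Rightarrow> real^'n2"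
    and lam :: "nat \<Rightarrow> 'w \<Rightarrow> real^'n"
    and xin xbin xhat d \<delta> :: "nat \<Rightarrow> nat \<Rightarrow> 'w \<Rightarrow> real^'n1"
    and xstar :: "real^'n1" and ystar :: "real^'n2" and \<Lambda> :: "(real^'n) set"
  assumes X: "closed X" "convex X" and Y: "closed Y" "convex Y"
    and N: "N > 0"
    and fj_convex: "\<And>j. j \<in> {1..N} \<Longrightarrow> convex_on X (fj j)"
    and fj_diff: "\<And>j u. j \<in> {1..N} \<Longrightarrow> u \<in> X \<Longrightarrow> fj j differentiable (at u)"
    and f: "f = (\<lambda>u. 1 / real N * (\<Sum>j=1..N. fj j u))"
    and g_convex: "convex_on Y g"
    and H: "pos_def H"
    and \<nu>: "\<nu> > 0"
    and fj_lip: "\<And>j u v. j \<in> {1..N} \<Longrightarrow> u \<in> X \<Longrightarrow> v \<in> X \<Longrightarrow>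
        sqrt (qform (matrix_inv H) (grad (fj j) u - grad (fj j) v)) \<le> \<nu> * sqrt (qform H (u - v))"
    and saddle: "\<exists>u v l. saddle_point X Y UNIV
        (\<lambda>u v l. f u + g v + l \<bullet> (b - A *v u - B *v v)) u v l"
    and y_solvable: "\<And>z. \<exists>v. is_arg_min
        (\<lambda>v. g v + \<beta> / 2 * (v \<bullet> ((transpose B ** B) *v v)) + z \<bullet> v) (\<lambda>v. v \<in> Y) v"
    and \<beta>: "\<beta> > 0"
    \<comment> \<open>randomness and nonanticipating choices\<close>
    and noise: "stochastic_oracle P F N \<xi> e"
    and adapted: "\<And>k. M k \<in> F k 1 \<rightarrow>\<^sub>M count_space UNIV"
        "\<And>k. \<eta> k \<in> borel_measurable (F k 1)"
        "\<And>k. MM k \<in> borel_measurable (F k 1)"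
        "\<And>k. y k \<in> borel_measurable (F k 1)"
    \<comment> \<open>algorithm AS-ADMM\<close>
    and init: "x0 \<in> X" "y0 \<in> Y"
        "\<And>\<omega>. \<omega> \<in> space P \<Longrightarrow> x 0 \<omega> = x0 \<and> y 0 \<omega> = y0 \<and> lam 0 \<omega> = lam0 \<and> xb 0 \<omega> = x0"
    and choices: "\<And>k \<omega>. \<omega> \<in> space P \<Longrightarrow> M k \<omega> > 0 \<and> \<eta> k \<omega> > 0 \<and> transpose (MM k \<omega>) = MM k \<omega>"
    and D: "\<And>k \<omega>. \<omega> \<in> space P \<Longrightarrow> D k \<omega> = MM k \<omega> - \<beta> *\<^sub>R (transpose A ** A)"
    and D_psd: "\<And>k \<omega>. \<omega> \<in> space P \<Longrightarrow> 0 \<preceq>\<^sub>L D k \<omega>"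
    and h: "\<And>k \<omega>. \<omega> \<in> space P \<Longrightarrow>
        h k \<omega> = - (transpose A *v (lam k \<omega> - \<beta> *\<^sub>R (A *v x k \<omega> + B *v y k \<omega> - b)))"
    and inner_start: "\<And>k \<omega>. \<omega> \<in> space P \<Longrightarrow> xin k 1 \<omega> = x k \<omega> \<and> xbin k 1 \<omega> = xb k \<omega>"
    and xhat: "\<And>k t \<omega>. \<omega> \<in> space P \<Longrightarrow> t \<in> {1..M k \<omega>} \<Longrightarrow>
        xhat k t \<omega> = (2 / (real t + 1)) *\<^sub>R xbin k t \<omega> + (1 - 2 / (real t + 1)) *\<^sub>R xin k t \<omega>"
    and d: "\<And>k t \<omega>. \<omega> \<in> space P \<Longrightarrow> t \<in> {1..M k \<omega>} \<Longrightarrow>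
        d k t \<omega> = grad (fj (\<xi> k t \<omega>)) (xhat k t \<omega>) + e k t \<omega>"
    and inner_xb: "\<And>k t \<omega>. \<omega> \<in> space P \<Longrightarrow> t \<in> {1..M k \<omega>} \<Longrightarrow>
        is_arg_min (\<lambda>u. (d k t \<omega> + h k \<omega>) \<bullet> u
            + (2 / (real t * \<eta> k \<omega>)) / 2 * qform H (u - xbin k t \<omega>)
            + 1 / 2 * qform (MM k \<omega>) (u - x k \<omega>))
          (\<lambda>u. u \<in> X) (xbin k (t + 1) \<omega>)"
    and inner_x: "\<And>k t \<omega>. \<omega> \<in> space P \<Longrightarrow> t \<in> {1..M k \<omega>} \<Longrightarrow>
        xin k (t + 1) \<omega> =
          (2 / (real t + 1)) *\<^sub>R xbin k (t + 1) \<omega> + (1 - 2 / (real t + 1)) *\<^sub>R xin k t \<omega>"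
    and outer_x: "\<And>k \<omega>. \<omega> \<in> space P \<Longrightarrow>
        x (k + 1) \<omega> = xin k (M k \<omega> + 1) \<omega> \<and> xb (k + 1) \<omega> = xbin k (M k \<omega> + 1) \<omega>"
    and outer_y: "\<And>k \<omega>. \<omega> \<in> space P \<Longrightarrow>
        is_arg_min (\<lambda>v. g v + \<beta> / 2 *
            (norm (A *v x (k + 1) \<omega> + B *v v - b - (1 / \<beta>) *\<^sub>R lam k \<omega>))\<^sup>2)
          (\<lambda>v. v \<in> Y) (y (k + 1) \<omega>)"
    and outer_lam: "\<And>k \<omega>. \<omega> \<in> space P \<Longrightarrow>
        lam (k + 1) \<omega> = lam k \<omega> - (s * \<beta>) *\<^sub>R (A *v x (k + 1) \<omega> + B *v y (k + 1) \<omega> - b)"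
    and \<delta>: "\<And>k t \<omega>. \<omega> \<in> space P \<Longrightarrow> t \<in> {1..M k \<omega>} \<Longrightarrow>
        \<delta> k t \<omega> = grad f (xhat k t \<omega>) - d k t \<omega>"
    \<comment> \<open>(L1)\<close>
    and L1_strong: "\<alpha> > 0" "strongly_convex_on X \<alpha> f" "strongly_convex_on Y \<alpha> g"
    and L1_lip: "\<And>v. v \<in> Y \<Longrightarrow> g differentiable (at v)"
        "\<nu>-lipschitz_on X (grad f)" "\<nu>-lipschitz_on Y (grad g)"
    \<comment> \<open>(L2)\<close>
    and L2: "X = UNIV" "Y = UNIV"
    \<comment> \<open>(L3)\<close>
    and L3_s: "0 < s" "s < (1 + sqrt 5) / 2"
    and L3_D: "c1 > 0" "c2 > 0"
        "\<And>k \<omega>. \<omega> \<in> space P \<Longrightarrow> mat c1 \<preceq>\<^sub>L D (k + 1) \<omega> \<and> D (k + 1) \<omega> \<preceq>\<^sub>L D k \<omega> \<and> D k \<omega> \<preceq>\<^sub>L mat c2"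
    and L3_\<sigma>: "\<sigma> > 0"
        "\<And>k t. t \<ge> 1 \<Longrightarrow>
          set_integrable P {\<omega> \<in> space P. t \<le> M k \<omega>} (\<lambda>\<omega>. qform (matrix_inv H) (\<delta> k t \<omega>)) \<and>
          (LINT \<omega>:{\<omega> \<in> space P. t \<le> M k \<omega>}|P. qform (matrix_inv H) (\<delta> k t \<omega>)) \<le> \<sigma>\<^sup>2"
    \<comment> \<open>(L4)\<close>
    and L4_M: "\<theta> > 0" "M0 > 0" "\<And>\<omega>. \<omega> \<in> space P \<Longrightarrow> M 0 \<omega> = M0"
        "\<And>k \<omega>. \<omega> \<in> space P \<Longrightarrow> k \<ge> 1 \<Longrightarrow>
          int (M k \<omega>) = \<lceil>(1 + \<theta>)\<^sup>2 * real (M (k - 1) \<omega>) * ((norm (xb k \<omega>))\<^sup>2 + 1)\<rceil>"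
    and L4_\<eta>: "\<And>k \<omega>. \<omega> \<in> space P \<Longrightarrow> \<eta> k \<omega> = (1 + \<theta>) powi (- int k) / real (M k \<omega>)"
    \<comment> \<open>the primal solution and its multipliers\<close>
    and sol: "is_arg_min (\<lambda>(u, v). f u + g v)
        (\<lambda>(u, v). u \<in> X \<and> v \<in> Y \<and> A *v u + B *v v = b) (xstar, ystar)"
    and \<Lambda>: "\<Lambda> = {l. transpose A *v l = grad f xstar \<and> transpose B *v l = grad g ystar}"
  shows "\<exists>c \<tau>. c > 0 \<and> 0 < \<tau> \<and> \<tau> < 1 \<and>
    (\<forall>k. integrable P (\<lambda>\<omega>. (norm (x k \<omega> - xstar))\<^sup>2 + (norm (y k \<omega> - ystar))\<^sup>2
            + (norm (lam k \<omega> - closest_point \<Lambda> (lam k \<omega>)))\<^sup>2) \<and>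
         (LINT \<omega>|P. (norm (x k \<omega> - xstar))\<^sup>2 + (norm (y k \<omega> - ystar))\<^sup>2
            + (norm (lam k \<omega> - closest_point \<Lambda> (lam k \<omega>)))\<^sup>2) \<le> c * \<tau> ^ k)"
  proof -
  note XU = L2(1) and YU = L2(2)
  define Gf where "Gf = grad f"
  define Gg where "Gg = grad g"
  define gj where "gj j = grad (fj j)" for j
  define sp where "sp = space P"
  have gjd: "GDERIV (fj j) u :> gj j u" if "j \<in> {1..N}" for j u
    unfolding gj_def using fj_diff[OF that, of u] XU by (intro gderiv_grad) auto
  have fd: "GDERIV f u :> (1 / real N) *\<^sub>R (\<Sum>j=1..N. gj j u)" for u
    unfolding f by (rule gderiv_average) (rule gjd)
  have Gf_avg: "Gf u = (1 / real N) *\<^sub>R (\<Sum>j=1..N. gj j u)" for u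
    unfolding Gf_def by (rule grad_eqI[OF fd])
  have fd': "GDERIV f u :> Gf u" for u unfolding Gf_avg by (rule fd)
  have gd: "GDERIV g v :> Gg v" for v
    unfolding Gg_def using L1_lip(1)[of v] YU by (intro gderiv_grad) auto
  have scf: "strongly_convex_on UNIV \<alpha> f" and scg: "strongly_convex_on UNIV \<alpha> g"
    using L1_strong XU YU by auto
  have f_ineq: "f v + Gf v \<bullet> (w - v) \<le> f w" for v w
  proof -
    have "0 \<le> \<alpha> / 2 * (norm (w - v))\<^sup>2" using L1_strong(1) by simp
    then show ?thesis using strongly_convex_gradient_ineq[OF scf fd', of v w] by linarith
  qed
  obtain hmin where hmin: "hmin > 0" "\<And>v. hmin * (norm v)\<^sup>2 \<le> v \<bullet> (H *v v)"
    using pos_def_coercive[OF H] by blast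
  obtain hmax where hmax: "hmax > 0" "\<And>v. norm (H *v v) \<le> hmax * norm v"
    using matrix_norm_bound[of H] by blast
  have Hsym: "transpose H = H" using H by (simp add: pos_def_def)
  define K\<phi> where "K\<phi> = hmax\<^sup>2 / hmin"
  have K\<phi>: "K\<phi> > 0" "\<And>v. (norm v)\<^sup>2 \<le> K\<phi> * qform (matrix_inv H) v"
    using norm_le_inverse_qform[OF hmin hmax(2)] hmin hmax by (auto simp: K\<phi>_def)
  \<comment> \<open>The Lipschitz hypothesis is in the norms of \<open>H\<close> and its inverse;
    \<open>hmax\<close> and \<open>K\<phi>\<close> translate it to the Euclidean norm.\<close>
  have gj_cont: "continuous_on UNIV (gj j)" if j: "j \<in> {1..N}" for j
  proof -
    have "norm (gj j u - gj j v) \<le> sqrt (K\<phi> * hmax) * \<nu> * norm (u - v)" for u v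
    proof -
      have "norm (gj j u - gj j v) \<le> sqrt (K\<phi> * qform (matrix_inv H) (gj j u - gj j v))"
        using K\<phi>(2) by (intro real_le_rsqrt)
      also have "\<dots> = sqrt K\<phi> * sqrt (qform (matrix_inv H) (gj j u - gj j v))" by (rule real_sqrt_mult)
      also have "\<dots> \<le> sqrt K\<phi> * (\<nu> * sqrt (qform H (u - v)))"
        unfolding gj_def using K\<phi>(1) fj_lip[OF j, of u v] XU by (intro mult_left_mono) auto
      also have "\<dots> \<le> sqrt K\<phi> * (\<nu> * sqrt (hmax * (norm (u - v))\<^sup>2))"
      proof (intro mult_left_mono real_sqrt_le_mono)
        have "qform H (u - v) \<le> norm (u - v) * norm (H *v (u - v))"
          unfolding qform_def by (rule norm_cauchy_schwarz)
        also have "\<dots> \<le> norm (u - v) * (hmax * norm (u - v))" by (intro mult_left_mono hmax(2)) simp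
        finally show "qform H (u - v) \<le> hmax * (norm (u - v))\<^sup>2" by (simp add: power2_eq_square mult_ac)
      qed (use K\<phi> \<nu> in auto)
      also have "\<dots> = sqrt (K\<phi> * hmax) * \<nu> * norm (u - v)" by (simp add: real_sqrt_mult)
      finally show ?thesis .
    qed
    then have "(sqrt (K\<phi> * hmax) * \<nu>)-lipschitz_on UNIV (gj j)"
      using K\<phi>(1) hmax(1) \<nu> by (intro lipschitz_onI) (auto simp: dist_norm)
    then show ?thesis by (rule lipschitz_on_continuous_on)
  qed
  have lip_f: "norm (Gf u - Gf v) \<le> \<nu> * norm (u - v)" for u v
    using lipschitz_onD[OF L1_lip(2), of u v] XU by (simp add: Gf_def dist_norm)
  have lip_g: "norm (Gg u - Gg v) \<le> \<nu> * norm (u - v)" for u v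
    using lipschitz_onD[OF L1_lip(3), of u v] YU by (simp add: Gg_def dist_norm)
  have sol': "is_arg_min (\<lambda>(u, v). f u + g v) (\<lambda>(u, v). u \<in> UNIV \<and> v \<in> UNIV \<and> A *v u + B *v v = b) (xstar, ystar)"
    using sol unfolding XU YU .
  obtain u0 v0 l0 where sp0: "saddle_point UNIV UNIV UNIV (\<lambda>u v l. f u + g v + l \<bullet> (b - A *v u - B *v v)) u0 v0 l0"
    using saddle unfolding XU YU by blast
  have \<Lambda>': "\<Lambda> = {l. transpose A *v l = Gf xstar \<and> transpose B *v l = Gg ystar}"
    unfolding \<Lambda> Gf_def Gg_def ..
  have "l0 \<in> \<Lambda>" unfolding \<Lambda>' using saddle_point_multiplier[OF fd' gd sp0 sol'] by simp
  then have \<Lambda>_ne: "\<Lambda> \<noteq> {}" by blast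
  interpret admm A B b Gf Gg xstar ystar \<alpha> \<nu> \<beta> s c1 c2 \<Lambda>
  proof
    show "A *v xstar + B *v ystar = b" using sol' by (simp add: is_arg_min_def)
    show "\<alpha> * (norm (u - v))\<^sup>2 \<le> (Gf u - Gf v) \<bullet> (u - v)" for u v
      by (rule strongly_convex_monotone[OF scf fd' fd'])
    show "\<alpha> * (norm (u - v))\<^sup>2 \<le> (Gg u - Gg v) \<bullet> (u - v)" for u v
      by (rule strongly_convex_monotone[OF scg gd gd])
  qed (fact L1_strong(1) \<nu> \<beta> L3_s L3_D(1,2) lip_f lip_g \<Lambda>' \<Lambda>_ne)+
  have MM: "xmat (D k w) = MM k w" if "w \<in> space P" for k w
    using D[OF that, of k] by (simp add: xmat_def)
  have D1: "mat c1 \<preceq>\<^sub>L D (Suc k) w" "D (Suc k) w \<preceq>\<^sub>L D k w" "D k w \<preceq>\<^sub>L mat c2" if "w \<in> space P" for k w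
    using L3_D(3)[OF that, of k] by simp_all
  have D_dec: "v \<bullet> (D (Suc k) w *v v) \<le> v \<bullet> (D k w *v v)" if "w \<in> space P" for k w v
    using D1(2)[OF that, of k] by (simp add: loewner_le_iff)
  \<comment> \<open>The lower bound by \<open>c1\<close> is given for \<open>D (Suc k)\<close>; the
    decrease of \<open>D\<close> transfers it to \<open>D k\<close>, including k = 0.\<close>
  have D_low: "c1 * (norm v)\<^sup>2 \<le> v \<bullet> (D k w *v v)" if w: "w \<in> space P" for k w v
  proof -
    have "v \<bullet> (mat c1 *v v) \<le> v \<bullet> (D (Suc k) w *v v)" using D1(1)[OF w, of k] by (simp add: loewner_le_iff)
    also have "\<dots> \<le> v \<bullet> (D k w *v v)" by (rule D_dec[OF w])
    finally show ?thesis by (simp add: mat_mult_vector dot_square_norm)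
  qed
  have D_adm: "admissible (D k w)" if w: "w \<in> space P" for k w
    unfolding admissible_def
  proof (intro conjI allI)
    show "transpose (D k w) = D k w" using D_psd[OF w, of k] by (simp add: loewner_le_iff)
    show "c1 * (norm v)\<^sup>2 \<le> v \<bullet> (D k w *v v)" for v by (rule D_low[OF w])
    have "v \<bullet> (D k w *v v) \<le> v \<bullet> (mat c2 *v v)" for v using D1(3)[OF w, of k] by (simp add: loewner_le_iff)
    then show "v \<bullet> (D k w *v v) \<le> c2 * (norm v)\<^sup>2" for v by (simp add: mat_mult_vector dot_square_norm)
  qed
  have Fsp: "space (F k 1) = space P" for k
    using noise by (simp add: stochastic_oracle_def subalgebra_def)
  \<comment> \<open>\<open>D\<close> is tied to \<open>MM\<close> on \<open>space P\<close> only,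
    which is enough because measurability depends on the values there.\<close>
  have MMad: "(\<lambda>w. xmat (D k w)) \<in> borel_measurable (F k 1)" for k
  proof -
    have "(\<lambda>w. xmat (D k w)) \<in> borel_measurable (F k 1) \<longleftrightarrow> MM k \<in> borel_measurable (F k 1)"
      by (rule measurable_cong) (simp only: Fsp MM)
    then show ?thesis using adapted(3)[of k] by simp
  qed
  have ixb: "(2 / (real t * \<eta> k w)) *\<^sub>R (H *v (xbin k (Suc t) w - xbin k t w)) + xmat (D k w) *v (xbin k (Suc t) w - x k w)
        + - (transpose A *v (lam k w - \<beta> *\<^sub>R res (x k w) (y k w))) + (Gf (xhat k t w) - \<delta> k t w) = 0"
    if w: "w \<in> space P" and t: "t \<in> {1..M k w}" for k t w
  proof -
    have MMs: "transpose (MM k w) = MM k w" using choices[OF w, of k] by simp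
    have 1: "(2 / (real t * \<eta> k w)) *\<^sub>R (H *v (xbin k (t + 1) w - xbin k t w)) + MM k w *v (xbin k (t + 1) w - x k w)
        + (d k t w + h k w) = 0"
      using inner_xb[OF w t] unfolding XU by (rule prox_quadratic_stationary[OF Hsym MMs])
    have 2: "Gf (xhat k t w) - \<delta> k t w = d k t w" using \<delta>[OF w t] by (simp add: Gf_def)
    have 3: "h k w = - (transpose A *v (lam k w - \<beta> *\<^sub>R res (x k w) (y k w)))"
      using h[OF w, of k] by (simp add: res_def)
    show ?thesis using 1 unfolding 2 3[symmetric] MM[OF w] Suc_eq_plus1
      by (simp only: add.assoc add.commute[of "d k t w"])
  qed
  have \<delta>': "\<delta> k t w = Gf (xhat k t w) - gj (\<xi> k t w) (xhat k t w) - e k t w"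
    if w: "w \<in> space P" and t: "t \<in> {1..M k w}" for k t w
    using \<delta>[OF w t] d[OF w t] by (simp add: Gf_def gj_def)
  have oy: "Gg (y (Suc k) w) = transpose B *v (lam k w - \<beta> *\<^sub>R res (x (Suc k) w) (y (Suc k) w))"
    if w: "w \<in> space P" for k w
    using outer_y[OF w, of k] unfolding YU res_def Suc_eq_plus1 by (rule augmented_stationary[OF \<beta> gd])
  have Mg: "(1 + \<theta>)\<^sup>2 * real (M k w) * ((norm (xb (Suc k) w))\<^sup>2 + 1) \<le> real (M (Suc k) w)"
    if w: "w \<in> space P" for k w
  proof -
    have "int (M (Suc k) w) = \<lceil>(1 + \<theta>)\<^sup>2 * real (M k w) * ((norm (xb (Suc k) w))\<^sup>2 + 1)\<rceil>"
      using L4_M(4)[OF w, of "Suc k"] by simp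
    then have "real (M (Suc k) w) = real_of_int \<lceil>(1 + \<theta>)\<^sup>2 * real (M k w) * ((norm (xb (Suc k) w))\<^sup>2 + 1)\<rceil>"
      by (metis of_int_of_nat_eq)
    then show ?thesis using le_of_int_ceiling by metis
  qed
  have \<eta>e: "\<eta> k w = (1 / (1 + \<theta>)) ^ k / real (M k w)" if w: "w \<in> space P" for k w
    using L4_\<eta>[OF w, of k] by (simp only: power_int_minus power_int_of_nat power_one_over inverse_eq_divide)
  interpret as_admm A B b Gf Gg xstar ystar \<alpha> \<nu> \<beta> s c1 c2 \<Lambda> P F N f gj H hmin hmax "qform (matrix_inv H)" K\<phi> "\<sigma>\<^sup>2" \<theta>
    M \<eta> D \<xi> e x0 y0 lam0 x xb y lam xin xbin xhat \<delta>
  proof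
    show "M k w > 0" if "w \<in> space P" for k w using choices[OF that, of k] by simp
    show "xin k (Suc t) w = (2 / (real t + 1)) *\<^sub>R xbin k (Suc t) w + (1 - 2 / (real t + 1)) *\<^sub>R xin k t w"
      if "w \<in> space P" "t \<in> {1..M k w}" for k t w using inner_x[OF that] by simp
    show "x (Suc k) w = xin k (Suc (M k w)) w \<and> xb (Suc k) w = xbin k (Suc (M k w)) w" if "w \<in> space P" for k w
      using outer_x[OF that, of k] by simp
    show "lam (Suc k) w = lam k w - (s * \<beta>) *\<^sub>R res (x (Suc k) w) (y (Suc k) w)" if "w \<in> space P" for k w
      using outer_lam[OF that, of k] by (simp add: res_def)
  qed (fact noise N fd' f_ineq gj_cont Gf_avg Hsym hmin hmax K\<phi> adapted(1,2,4) MMad init(3) D_adm D_dec inner_start xhat ixb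
      \<delta>' oy L3_\<sigma>(2) L4_M(1) Mg \<eta>e)+
  show ?thesis using linear_rate unfolding multdist_def .
qed

end
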